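(* Let $a>0$, let $\widetilde\mu$ be a non-negative measure on $\mathbb R$ of at most polynomial growth, and let $\mu$ be a non-negative measure on $\mathbb R$ with $\mu\preccurlyeq\widetilde\mu$. If $\mathcal E(a)$ is stably dense in $L^2(\widetilde\mu)$, then $\mathcal E(a)$ is dense in $L^2(\mu)$.
   Context: Measures are Borel measures. A non-negative measure $\mu$ on $\mathbb R$ has at most polynomial growth if $\int_{\mathbb R}\frac{d\mu(\lambda)}{1+|\lambda|^{2s}}<\infty$ for some $s<\infty$. For $a>0$, $\mathcal E(a)$ is the linear space of Fourier transforms $\widehat f(\lambda)=\int_{\mathbb R} f(x)e^{-i\lambda x}\,dx$ of complex-valued $C^\infty$ functions $f$ compactly supported in $(-a,a)$; these are entire functions, and are regarded as elements of $L^2(\mu)$ by restriction to $\mathbb R$. $\mathcal E(a)$ is said to be stably dense in $L^2(\mu)$ if for each $t\ge 0$, $\mathcal E(a)$ is dense in $L^2(\mu_t)$, where $d\mu_t(\lambda)=(1+|\lambda|)^t\,d\mu(\lambda)$. For $\delta>0$ and $x\in\mathbb R$ let $I_{x,\delta}=[x-e^{-\delta|x|},x+e^{-\delta|x|}]$, and let $2I_{x,\delta}=[x-2e^{-\delta|x|},x+2e^{-\delta|x|}]$. One writes $\mu\preccurlyeq\widetilde\mu$ if there exist constants $\delta>0$, $C>0$ and $n\ge 0$ such that for all $x\in\mathbb R$, $\mu(I_{x,\delta})\le C(1+|x|)^n\left(\widetilde\mu(2I_{x,\delta})+e^{-2\delta|x|}\right)$. *)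

theory Defs
  imports "HOL-Analysis.Analysis"
begin

text \<open>
  Throughout, a non-negative Borel measure on the real line is a term
  \<open>M :: real measure\<close> with \<open>sets M = sets borel\<close>; no finiteness is built in.
\<close>

text \<open>
  \<open>0 powr u = 0\<close> for every \<open>u\<close>, so for \<open>s \<le> 0\<close> the integrand takes the value \<open>1\<close> at the
  origin. Only \<open>s > 0\<close> is of interest: a finite measure satisfies the condition for every such \<open>s\<close>.
\<close>

definition at_most_polynomial_growth :: "real measure \<Rightarrow> bool" where
  "at_most_polynomial_growth M \<longleftrightarrow>
     (\<exists>s::real. (\<integral>\<^sup>+ x. ennreal (1 / (1 + \<bar>x\<bar> powr (2 * s))) \<partial>M) < \<infinity>)"

definition smooth :: "(real \<Rightarrow> complex) \<Rightarrow> bool" where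
  "smooth f \<longleftrightarrow>
     (\<forall>k::nat. ((\<lambda>g x. vector_derivative g (at x)) ^^ k) f differentiable_on UNIV)"

text \<open>The topological support; it is compact as soon as it lies in a bounded set.\<close>

definition tsupport :: "(real \<Rightarrow> complex) \<Rightarrow> real set" where
  "tsupport f = closure {x. f x \<noteq> 0}"

definition fourier :: "(real \<Rightarrow> complex) \<Rightarrow> complex \<Rightarrow> complex" where
  "fourier f z = (LINT x|lborel. f x * exp (- (\<i> * z * complex_of_real x)))"

definition entire_space :: "real \<Rightarrow> (complex \<Rightarrow> complex) set" where
  "entire_space a =
     {fourier f | f. smooth f \<and> compact (tsupport f) \<and> tsupport f \<subseteq> {-a<..<a}}"

text \<open>
  Elements of \<open>L\<^sup>2\<close> are represented by square-integrable functions, so \<open>L2_norm\<close> is a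
  seminorm on \<open>L2_functions\<close>, vanishing exactly on the functions that are zero
  almost everywhere.
\<close>

definition L2_functions :: "real measure \<Rightarrow> (real \<Rightarrow> complex) set" where
  "L2_functions M = {g \<in> borel_measurable M. integrable M (\<lambda>x. (cmod (g x))\<^sup>2)}"

definition L2_norm :: "real measure \<Rightarrow> (real \<Rightarrow> complex) \<Rightarrow> real" where
  "L2_norm M g = sqrt (LINT x|M. (cmod (g x))\<^sup>2)"

text \<open>
  Density includes the requirement that the restrictions to the real line belong to
  \<open>L\<^sup>2\<close>. Without it, \<open>L2_norm\<close> of a difference could be \<open>0\<close> merely because the
  integral does not exist.
\<close>

definition dense_in_L2 :: "(complex \<Rightarrow> complex) set \<Rightarrow> real measure \<Rightarrow> bool" where
  "dense_in_L2 E M \<longleftrightarrow>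
     (\<forall>F\<in>E. (\<lambda>x. F (complex_of_real x)) \<in> L2_functions M) \<and>
     (\<forall>g\<in>L2_functions M. \<forall>\<epsilon>>0. \<exists>F\<in>E.
        L2_norm M (\<lambda>x. g x - F (complex_of_real x)) < \<epsilon>)"

definition weighted_measure :: "real measure \<Rightarrow> real \<Rightarrow> real measure" where
  "weighted_measure M t = density M (\<lambda>x. ennreal ((1 + \<bar>x\<bar>) powr t))"

definition stably_dense_in_L2 :: "(complex \<Rightarrow> complex) set \<Rightarrow> real measure \<Rightarrow> bool" where
  "stably_dense_in_L2 E M \<longleftrightarrow> (\<forall>t\<ge>0. dense_in_L2 E (weighted_measure M t))"

text \<open>\<open>exp_interval r x \<delta>\<close> is \<open>r I\<^sub>x\<^sub>,\<^sub>\<delta>\<close>, the interval dilated by \<open>r\<close> about its centre \<open>x\<close>.\<close>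

definition exp_interval :: "real \<Rightarrow> real \<Rightarrow> real \<Rightarrow> real set" where
  "exp_interval r x \<delta> = {x - r * exp (- \<delta> * \<bar>x\<bar>) .. x + r * exp (- \<delta> * \<bar>x\<bar>)}"

definition dominated :: "real measure \<Rightarrow> real measure \<Rightarrow> bool" (infix "\<preceq>\<^sub>e" 50) where
  "M \<preceq>\<^sub>e N \<longleftrightarrow>
     (\<exists>\<delta>>0. \<exists>C>0. \<exists>n\<ge>0. \<forall>x::real.
        emeasure M (exp_interval 1 x \<delta>)
          \<le> ennreal (C * (1 + \<bar>x\<bar>) powr n)
             * (emeasure N (exp_interval 2 x \<delta>) + ennreal (exp (- 2 * \<delta> * \<bar>x\<bar>))))"

end

theory Submission
  imports Defs "HOL-Complex_Analysis.Complex_Analysis" "HOL-Real_Asymp.Real_Asymp"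
begin

text \<open>
  Write \<open>E\<close> for the space of Fourier transforms, and \<open>\<nu>\<^sub>t\<close> for the measure \<open>(1 + \<bar>x\<bar>)\<^sup>t d\<nu>\<close>, where \<open>\<nu> = \<mu>'\<close> is the
  dominating measure. The link between density and complex analysis is the evaluation \<open>F \<mapsto> F(\<i>)\<close>. If it is
  unbounded for the norm of \<open>L\<^sup>2(\<mu>)\<close>, then \<open>E\<close> is dense in \<open>L\<^sup>2(\<mu>)\<close> (\<open>dense_if_evaluation_unbounded\<close>): zeros
  at \<open>\<i>\<close> can be created at no cost and divided out, so the closure of \<open>E\<close> is invariant under \<open>1 / (x - \<i>)\<close> and its
  conjugate, and hence under multiplication by all bounded Borel functions. Conversely, density in
  \<open>L\<^sup>2(\<nu>\<^sub>t\<^sub>+\<^sub>2)\<close> makes evaluation unbounded for \<open>L\<^sup>2(\<nu>\<^sub>t)\<close> (\<open>dense_imp_evaluation_unbounded\<close>). So suppose that evaluation at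
  \<open>\<i>\<close> is bounded for \<open>L\<^sup>2(\<mu>)\<close>; it remains to show that it is bounded for some \<open>L\<^sup>2(\<nu>\<^sub>t)\<close>.

  The first step is an estimate of \<open>\<bar>F(z)\<bar>\<close> by \<open>A * exp (\<epsilon> * \<bar>Re z\<bar>)\<close> times the norm of \<open>F\<close> in \<open>L\<^sup>2(\<mu>)\<close>, on every horizontal
  strip and for every \<open>\<epsilon> > 0\<close> (\<open>subexponential_bound\<close>). Functions \<open>p\<close> with \<open>p(\<i>) = 1\<close> and nearly minimal norm are almost
  orthogonal to functions vanishing at \<open>\<i>\<close>. This gives
  control of all evaluations in the upper half-plane by \<open>\<bar>p(z)\<bar>\<close>, and by one holomorphic
  function \<open>\<Phi>\<close> in the limit (\<open>evaluation_majorant\<close>, \<open>lower_bounded_majorant\<close>). Up to polynomial factors \<open>\<Phi>\<close> is bounded below,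
  because translates of a fixed member of \<open>E\<close> are bounded below and have norms of polynomial growth. Thus
  \<open>ln \<bar>\<Phi>\<bar>\<close> is essentially a positive harmonic function. Harnack's inequality leaves it no growth in sectors around the
  imaginary axis except \<open>c * Im z\<close> plus a small multiple of \<open>\<bar>z\<bar>\<close>, and limits its growth at the real axis. A
  Phragmen-Lindelof argument in a thin sector around the real axis, on whose sides \<open>c * Im z\<close> is small compared
  with \<open>Re z\<close>, converts this into the bound on strips.

  The second step is the comparison of the two norms (\<open>bounded_evaluation_transfers\<close>). A function that grows like
  \<open>exp (\<epsilon> * \<bar>x\<bar>)\<close> in a strip, with \<open>\<epsilon> < \<delta>\<close>, is almost constant on intervals of length \<open>exp (- \<delta> * \<bar>x\<bar>)\<close>. Integrating the domination over the
  centres of the intervals (\<open>nn_integral_transfer\<close>) therefore shows that far from the origin the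
  mass of \<open>\<bar>F\<bar>\<^sup>2\<close> for \<open>\<mu>\<close> is at most a multiple of that for \<open>\<nu>\<^sub>n\<close>, up to a small multiple of the squared norm of \<open>F\<close> in
  \<open>L\<^sup>2(\<mu>)\<close> (\<open>tail_estimate\<close>). For
  functions with a zero of high order at the origin, also the mass near the origin is a small multiple of
  the squared norm (\<open>high_order_zero_bound\<close>). For \<open>F = z\<^sup>m G\<close> the small multiples are absorbed, which bounds the norm of \<open>z\<^sup>m G\<close> in
  \<open>L\<^sup>2(\<mu>)\<close> by that of \<open>G\<close> in \<open>L\<^sup>2(\<nu>\<^sub>t)\<close> with \<open>t = n + 2 * m\<close>. Since \<open>\<bar>\<i>\<^sup>m G(\<i>)\<bar> = \<bar>G(\<i>)\<bar>\<close>, evaluation at \<open>\<i>\<close> is bounded for \<open>L\<^sup>2(\<nu>\<^sub>t)\<close>.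
\<close>

section \<open>Harnack's inequality and zero-free functions in the upper half-plane\<close>

text \<open>
  The Schwarz lemma, after the upper half-plane is mapped to the disc by a Moebius map taking \<open>z0\<close>
  to \<open>0\<close>, and the right half-plane by one taking \<open>g z0\<close> to \<open>0\<close>. Written without quotients.
\<close>

lemma Schwarz_Pick_right_half_plane:
  assumes hol: "g holomorphic_on {z. 0 < Im z}"
    and pos: "\<And>z. 0 < Im z \<Longrightarrow> 0 < Re (g z)"
    and z: "0 < Im z" and z0: "0 < Im z0"
  shows "cmod (g z - g z0) * cmod (z - cnj z0) \<le> cmod (z - z0) * cmod (g z + cnj (g z0))"
proof -
  define T where "T \<zeta> = (z0 - cnj z0 * \<zeta>) / (1 - \<zeta>)" for \<zeta>
  define \<phi> where "\<phi> \<zeta> = (g (T \<zeta>) - g z0) / (g (T \<zeta>) + cnj (g z0))" for \<zeta>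
  have imT: "0 < Im (T \<zeta>)" if "norm \<zeta> < 1" for \<zeta>
  proof -
    have ne: "1 - \<zeta> \<noteq> 0" using that by auto
    have "Im (T \<zeta>) = Im ((z0 - cnj z0 * \<zeta>) * cnj (1 - \<zeta>)) / (cmod (1 - \<zeta>))\<^sup>2"
      unfolding T_def by (simp only: complex_div_cnj[of _ "1 - \<zeta>"] Im_divide_of_real flip: of_real_power)
    also have "Im ((z0 - cnj z0 * \<zeta>) * cnj (1 - \<zeta>)) = Im z0 * (1 - (cmod \<zeta>)\<^sup>2)"
      unfolding cmod_power2 by (simp add: algebra_simps power2_eq_square)
    finally show ?thesis
      using that z0 ne by (simp add: power_less_one_iff abs_square_less_1)
  qed
  have ne: "g (T \<zeta>) + cnj (g z0) \<noteq> 0" if "norm \<zeta> < 1" for \<zeta>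
    using pos[OF imT[OF that]] pos[OF z0] by (auto simp: complex_eq_iff)
  have "T holomorphic_on ball 0 1"
    unfolding T_def by (intro holomorphic_intros) auto
  then have "(g \<circ> T) holomorphic_on ball 0 1"
    by (rule holomorphic_on_compose_gen[OF _ hol]) (auto simp: imT)
  then have h\<phi>: "\<phi> holomorphic_on ball 0 1"
    unfolding \<phi>_def using ne by (auto intro!: holomorphic_intros simp: o_def)
  have "\<phi> 0 = 0" by (simp add: \<phi>_def T_def)
  have lt: "norm (\<phi> \<zeta>) < 1" if "norm \<zeta> < 1" for \<zeta>
  proof -
    have "(Re (g (T \<zeta>)) - Re (g z0))\<^sup>2 < (Re (g (T \<zeta>)) + Re (g z0))\<^sup>2"
      using mult_pos_pos[OF pos[OF imT[OF that]] pos[OF z0]]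
      by (simp add: power2_eq_square algebra_simps)
    then have "(cmod (g (T \<zeta>) - g z0))\<^sup>2 < (cmod (g (T \<zeta>) + cnj (g z0)))\<^sup>2"
      unfolding cmod_power2 by simp
    then have "cmod (g (T \<zeta>) - g z0) < cmod (g (T \<zeta>) + cnj (g z0))"
      by (rule power2_less_imp_less) simp
    then show ?thesis using ne[OF that] by (simp add: \<phi>_def norm_divide)
  qed
  define \<zeta> where "\<zeta> = (z - z0) / (z - cnj z0)"
  have nz: "z - cnj z0 \<noteq> 0" using z z0 by (auto simp: complex_eq_iff)
  have "cmod (z - z0) < cmod (z - cnj z0)"
  proof (rule power2_less_imp_less)
    show "(cmod (z - z0))\<^sup>2 < (cmod (z - cnj z0))\<^sup>2"
      unfolding cmod_power2 using mult_pos_pos[OF z z0] by (simp add: power2_eq_square algebra_simps)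
  qed simp
  then have \<zeta>1: "norm \<zeta> < 1" using nz by (simp add: \<zeta>_def norm_divide)
  have "z0 \<noteq> cnj z0" using z0 by (auto simp: complex_eq_iff)
  have d1: "(z - cnj z0) * (1 - \<zeta>) = z0 - cnj z0" "(z - cnj z0) * (z0 - cnj z0 * \<zeta>) = (z0 - cnj z0) * z"
    using nz unfolding \<zeta>_def by (simp_all add: field_simps)
  have "T \<zeta> = ((z - cnj z0) * (z0 - cnj z0 * \<zeta>)) / ((z - cnj z0) * (1 - \<zeta>))"
    unfolding T_def using nz by simp
  then have T\<zeta>: "T \<zeta> = z"
    unfolding d1 using \<open>z0 \<noteq> cnj z0\<close> by simp
  have "norm (\<phi> \<zeta>) \<le> norm \<zeta>"
    by (rule Schwarz_Lemma(1)[OF h\<phi> \<open>\<phi> 0 = 0\<close> lt \<zeta>1])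
  then show ?thesis
    using ne[OF \<zeta>1] nz unfolding \<phi>_def T\<zeta> by (simp add: norm_divide \<zeta>_def field_simps)
qed

text \<open>
  Put \<open>p = \<bar>z - z0\<bar>\<close> and \<open>q = \<bar>z - cnj z0\<bar>\<close>. The Schwarz-Pick inequality gives
  \<open>Re (g z) * (q - p) \<le> Re (g z0) * (q + p)\<close>; multiplying by \<open>q + p \<le> 2 * q\<close> and using
  \<open>q\<^sup>2 - p\<^sup>2 = 4 * Im z * Im z0\<close> yields the bound, which is not sharp but has a simple form.
\<close>

lemma Harnack_upper_half_plane:
  assumes hol: "g holomorphic_on {z. 0 < Im z}"
    and pos: "\<And>z. 0 < Im z \<Longrightarrow> 0 < Re (g z)"
    and z: "0 < Im z" and z0: "0 < Im z0"
  shows "Re (g z) \<le> Re (g z0) * (cmod (z - cnj z0))\<^sup>2 / (Im z * Im z0)"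
proof -
  define s t s0 t0 where "s = Re (g z)" and "t = Im (g z)" and "s0 = Re (g z0)" and "t0 = Im (g z0)"
  define p q where "p = cmod (z - z0)" and "q = cmod (z - cnj z0)"
  have s: "s > 0" and s0: "s0 > 0" using pos z z0 by (auto simp: s_def s0_def)
  have q: "q > 0" and p: "p \<ge> 0" using z z0 by (auto simp: q_def p_def complex_eq_iff)
  have pq: "q\<^sup>2 - p\<^sup>2 = 4 * (Im z * Im z0)"
    unfolding p_def q_def cmod_power2 by (simp add: power2_eq_square algebra_simps)
  have "0 \<le> q\<^sup>2 - p\<^sup>2" unfolding pq using z z0 by simp
  then have pq2: "p\<^sup>2 \<le> q\<^sup>2" by (simp only: diff_ge_0_iff_ge)
  then have "p \<le> q" using q by (metis less_imp_le power2_le_imp_le)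
  have "(cmod (g z - g z0) * q)\<^sup>2 \<le> (p * cmod (g z + cnj (g z0)))\<^sup>2"
    unfolding p_def q_def
    by (rule power_mono[OF Schwarz_Pick_right_half_plane[OF hol pos z z0]]) simp_all
  then have "((s - s0)\<^sup>2 + (t - t0)\<^sup>2) * q\<^sup>2 \<le> p\<^sup>2 * ((s + s0)\<^sup>2 + (t - t0)\<^sup>2)"
    unfolding power_mult_distrib cmod_power2 s_def t_def s0_def t0_def by simp
  moreover have "p\<^sup>2 * (t - t0)\<^sup>2 \<le> (t - t0)\<^sup>2 * q\<^sup>2"
    using mult_right_mono[OF pq2, of "(t-t0)\<^sup>2"] by (simp add: mult.commute)
  ultimately have "((s - s0) * q)\<^sup>2 \<le> (p * (s + s0))\<^sup>2"
    unfolding power_mult_distrib by (simp add: distrib_left distrib_right mult.commute)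
  then have "(s - s0) * q \<le> p * (s + s0)"
    by (rule power2_le_imp_le) (use p s s0 in auto)
  then have "s * (q - p) \<le> s0 * (q + p)" by (simp add: algebra_simps)
  then have "s * (q - p) * (q + p) \<le> s0 * (q + p) * (q + p)"
    using p q by (intro mult_right_mono) auto
  also have "s * (q - p) * (q + p) = s * (q\<^sup>2 - p\<^sup>2)" by (simp add: algebra_simps power2_eq_square)
  also have "s0 * (q + p) * (q + p) \<le> s0 * (2 * q) * (2 * q)"
    using \<open>p \<le> q\<close> p q s0 by (intro mult_mono) auto
  finally have "s * (Im z * Im z0) \<le> s0 * q\<^sup>2"
    unfolding pq by (simp add: power2_eq_square)
  then show ?thesis
    using z z0 by (simp add: s_def s0_def q_def field_simps)
qed

lemma Harnack_half_plane:
  fixes h :: real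
  assumes hol: "g holomorphic_on {z. h < Im z}"
    and pos: "\<And>z. h < Im z \<Longrightarrow> 0 < Re (g z)"
    and z: "h < Im z" and z0: "h < Im z0"
  shows "Re (g z) \<le> Re (g z0) * (cmod (z - cnj z0 - 2 * \<i> * h))\<^sup>2 / ((Im z - h) * (Im z0 - h))"
proof -
  define g' where "g' w = g (w + \<i> * h)" for w
  have "(g \<circ> (\<lambda>w. w + \<i> * h)) holomorphic_on {z. 0 < Im z}"
    by (rule holomorphic_on_compose_gen[OF _ hol]) (auto intro!: holomorphic_intros)
  then have 1: "g' holomorphic_on {z. 0 < Im z}" unfolding g'_def by (simp add: o_def)
  have 2: "0 < Re (g' w)" if "0 < Im w" for w using pos that by (simp add: g'_def)
  have "Re (g' (z - \<i> * h)) \<le> Re (g' (z0 - \<i> * h)) * (cmod (z - \<i> * h - cnj (z0 - \<i> * h)))\<^sup>2 /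
     (Im (z - \<i> * h) * Im (z0 - \<i> * h))"
    using z z0 by (intro Harnack_upper_half_plane 1 2) auto
  moreover have "z - \<i> * h - cnj (z0 - \<i> * h) = z - cnj z0 - 2 * \<i> * h" by simp
  ultimately show ?thesis by (simp add: g'_def mult.assoc)
qed

context
  fixes \<Phi> :: "complex \<Rightarrow> complex"
  assumes hol: "\<Phi> holomorphic_on {z. 0 < Im z}"
    and lower: "\<And>z. 0 < Im z \<Longrightarrow> Im z \<le> cmod (\<Phi> z)"
begin

lemma holomorphic_log_of_lower_bounded:
  "\<exists>g. g holomorphic_on {z. 0 < Im z} \<and> (\<forall>z. 0 < Im z \<longrightarrow> Re (g z) = ln (cmod (\<Phi> z)))"
proof -
  have ne: "\<Phi> z \<noteq> 0" if "z \<in> {z. 0 < Im z}" for z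
    using lower[of z] that by auto
  have "\<i> \<in> {z. 0 < Im z}" by simp
  then obtain g where g: "g holomorphic_on {z. 0 < Im z}" "\<And>z. z \<in> {z. 0 < Im z} \<Longrightarrow> exp (g z) = \<Phi> z"
    using holomorphic_logarithm_exists[OF convex_halfspace_Im_gt open_halfspace_Im_gt hol ne] by blast
  have "Re (g z) = ln (cmod (\<Phi> z))" if "0 < Im z" for z
  proof -
    have "cmod (\<Phi> z) = exp (Re (g z))" using g(2)[of z] that by (metis mem_Collect_eq norm_exp_eq_Re)
    then show ?thesis by simp
  qed
  with g(1) show ?thesis by blast
qed

text \<open>
  The function \<open>ln \<bar>\<Phi>\<bar> = Re g\<close> is harmonic, and it is nonnegative on \<open>1 \<le> Im z\<close> by the lower bound on
  \<open>\<bar>\<Phi>\<bar>\<close>. Let \<open>c\<close> be the largest constant with \<open>c * (Im z - 1) \<le> Re g\<close>. The difference is again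
  positive harmonic, and is at some point \<open>z0\<close> arbitrarily small compared with \<open>Im z0 - 1\<close>. Harnack's
  inequality based at \<open>z0\<close> carries this smallness to all \<open>z\<close>. Thus \<open>c * Im z\<close> is the only part of
  \<open>ln \<bar>\<Phi>\<bar>\<close> that grows linearly inside a sector around the imaginary axis.
\<close>

lemma growth_away_from_real_axis:
  obtains c where "c \<ge> 0"
    and "\<And>\<eta>. \<eta> > 0 \<Longrightarrow>
      \<exists>B\<ge>0. \<forall>z. 2 \<le> Im z \<longrightarrow> cmod (\<Phi> z) \<le> exp (c * Im z + (\<eta> * (cmod z)\<^sup>2 + B) / Im z)"
proof -
  obtain g where "g holomorphic_on {z. 0 < Im z} \<and> (\<forall>z. 0 < Im z \<longrightarrow> Re (g z) = ln (cmod (\<Phi> z)))"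
    using holomorphic_log_of_lower_bounded ..
  then have g: "g holomorphic_on {z. 0 < Im z}" "\<And>z. 0 < Im z \<Longrightarrow> Re (g z) = ln (cmod (\<Phi> z))"
    by simp_all
  define Q where "Q = (\<lambda>z. Re (g z) / (Im z - 1)) ` {z. 1 < Im z}"
  define c where "c = Inf Q"
  have Re0: "0 \<le> Re (g z)" if "1 < Im z" for z
    using lower[of z] that by (simp add: g(2))
  then have Q0: "0 \<le> q" if "q \<in> Q" for q using that by (auto simp: Q_def)
  then have bdd: "bdd_below Q" unfolding bdd_below_def by blast
  have "2 * \<i> \<in> {z. 1 < Im z}" by simp
  then have Qne: "Q \<noteq> {}" unfolding Q_def by blast
  have c0: "c \<ge> 0" unfolding c_def by (rule cInf_greatest[OF Qne Q0])
  have cle: "c * (Im z - 1) \<le> Re (g z)" if "1 < Im z" for z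
  proof -
    have "c \<le> Re (g z) / (Im z - 1)"
      unfolding c_def using that by (intro cInf_lower[OF _ bdd]) (auto simp: Q_def)
    then show ?thesis using that by (simp add: field_simps)
  qed
  have "\<exists>B\<ge>0. \<forall>z. 2 \<le> Im z \<longrightarrow> cmod (\<Phi> z) \<le> exp (c * Im z + (\<eta> * (cmod z)\<^sup>2 + B) / Im z)"
    if \<eta>: "\<eta> > 0" for \<eta>
  proof -
    define \<kappa> where "\<kappa> = \<eta> / 8"
    have \<kappa>: "\<kappa> > 0" using \<eta> by (simp add: \<kappa>_def)
    have "c < c + \<kappa>" using \<kappa> by simp
    then obtain q where "q \<in> Q" "q < c + \<kappa>"
      unfolding c_def using cInf_less_iff[OF Qne bdd] by blast
    then obtain z0 where z0: "1 < Im z0" "Re (g z0) / (Im z0 - 1) < c + \<kappa>"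
      by (auto simp: Q_def)
    \<comment> \<open>Adding \<open>m\<close> makes the difference strictly positive, and at most doubles its bound at \<open>z0\<close>.\<close>
    define m where "m = \<kappa> * (Im z0 - 1)"
    have m: "m > 0" using z0 \<kappa> by (simp add: m_def)
    have z0': "Re (g z0) - c * (Im z0 - 1) \<le> m"
      using z0 by (simp add: m_def field_simps)
    define g1 where "g1 z = g z + \<i> * c * (z - \<i>) + of_real m" for z
    have Re1: "Re (g1 z) = Re (g z) - c * (Im z - 1) + m" for z
      by (simp add: g1_def algebra_simps)
    define D where "D = cmod (cnj z0 + 2 * \<i>)"
    have "cmod (\<Phi> z) \<le> exp (c * Im z + (\<eta> * (cmod z)\<^sup>2 + \<eta> * D\<^sup>2) / Im z)" if z: "2 \<le> Im z" for z
    proof -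
      have "g holomorphic_on {z. 1 < Im z}" by (rule holomorphic_on_subset[OF g(1)]) auto
      then have hg1: "g1 holomorphic_on {z. 1 < Im z}"
        unfolding g1_def by (intro holomorphic_intros)
      have pos1: "0 < Re (g1 w)" if "1 < Im w" for w
        using cle[OF that] m by (simp add: Re1)
      define N where "N = cmod (z - cnj z0 - 2 * \<i>)"
      have "Re (g1 z) \<le> Re (g1 z0) * N\<^sup>2 / ((Im z - 1) * (Im z0 - 1))"
        using Harnack_half_plane[OF hg1 pos1, of z z0] z z0 by (simp add: N_def)
      also have "\<dots> \<le> (2 * m) * N\<^sup>2 / ((Im z - 1) * (Im z0 - 1))"
        using z z0 z0' by (intro divide_right_mono mult_right_mono) (auto simp: Re1)
      also have "\<dots> = 2 * \<kappa> * N\<^sup>2 / (Im z - 1)"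
        using z z0 by (simp add: m_def)
      also have "\<dots> \<le> 2 * \<kappa> * N\<^sup>2 / (Im z / 2)"
        using z \<kappa> by (intro divide_left_mono) auto
      also have "\<dots> \<le> 2 * \<kappa> * (2 * (cmod z)\<^sup>2 + 2 * D\<^sup>2) / (Im z / 2)"
      proof -
        have "N \<le> cmod z + D"
          unfolding N_def D_def using norm_triangle_ineq4[of z "cnj z0 + 2 * \<i>"] by (simp add: diff_diff_eq)
        then have "N\<^sup>2 \<le> (cmod z + D)\<^sup>2" by (intro power_mono) (auto simp: N_def)
        also have "\<dots> \<le> 2 * (cmod z)\<^sup>2 + 2 * D\<^sup>2"
          using zero_le_power2[of "cmod z - D"] by (simp add: power2_eq_square algebra_simps)
        finally show ?thesis using \<kappa> z by (intro divide_right_mono mult_left_mono) auto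
      qed
      also have "\<dots> = (\<eta> * (cmod z)\<^sup>2 + \<eta> * D\<^sup>2) / Im z"
        by (simp add: \<kappa>_def add_divide_distrib distrib_left)
      finally have "Re (g z) \<le> c * Im z + (\<eta> * (cmod z)\<^sup>2 + \<eta> * D\<^sup>2) / Im z"
        using c0 m by (simp add: Re1 algebra_simps)
      moreover have "cmod (\<Phi> z) = exp (Re (g z))"
        using lower[of z] z by (cases "\<Phi> z = 0") (auto simp: g(2))
      ultimately show ?thesis by simp
    qed
    then show ?thesis using \<eta> by (intro exI[of _ "\<eta> * D\<^sup>2"]) auto
  qed
  with c0 show ?thesis by (rule that)
qed

text \<open>
  Here Harnack's inequality is applied in the half-plane above the height \<open>h = Im z / 2\<close>, where
  \<open>ln \<bar>\<Phi>\<bar> - ln h\<close> is positive, with the fixed base point \<open>3 * \<i>\<close>.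
\<close>

lemma growth_near_real_axis:
  obtains C where "C > 0"
    and "\<And>z. 0 < Im z \<Longrightarrow> Im z \<le> 2 \<Longrightarrow> cmod (\<Phi> z) \<le> exp (C * (1 + (cmod z)\<^sup>2) / (Im z)\<^sup>2)"
proof -
  obtain g where "g holomorphic_on {z. 0 < Im z} \<and> (\<forall>z. 0 < Im z \<longrightarrow> Re (g z) = ln (cmod (\<Phi> z)))"
    using holomorphic_log_of_lower_bounded ..
  then have g: "g holomorphic_on {z. 0 < Im z}" "\<And>z. 0 < Im z \<Longrightarrow> Re (g z) = ln (cmod (\<Phi> z))"
    by simp_all
  define L where "L = ln (cmod (\<Phi> (3 * \<i>)))"
  have L0: "L \<ge> 0" using lower[of "3 * \<i>"] by (simp add: L_def)
  have "cmod (\<Phi> z) \<le> exp (100 * (L + 1) * (1 + (cmod z)\<^sup>2) / (Im z)\<^sup>2)" if z: "0 < Im z" "Im z \<le> 2" for z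
  proof -
    define h where "h = Im z / 2"
    have h: "h > 0" "h \<le> 1" using z by (auto simp: h_def)
    define g1 where "g1 w = g w - of_real (ln h)" for w
    have "g holomorphic_on {z. h < Im z}" by (rule holomorphic_on_subset[OF g(1)]) (use h in auto)
    then have hg1: "g1 holomorphic_on {z. h < Im z}"
      unfolding g1_def by (intro holomorphic_intros)
    have pos1: "0 < Re (g1 w)" if "h < Im w" for w
    proof -
      have "ln h < ln (cmod (\<Phi> w))"
        using lower[of w] that h by (subst ln_less_cancel_iff) auto
      then show ?thesis using that h by (simp add: g1_def g(2))
    qed
    define N where "N = cmod (z - cnj (3 * \<i>) - 2 * \<i> * h)"
    have "ln (2 / Im z) \<le> 2 / Im z - 1" using z by (intro ln_le_minus_one) auto
    then have "- ln h \<le> 2 / Im z" using z by (simp add: h_def ln_div)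
    moreover have "L \<le> 2 * L / Im z" using z L0 mult_left_mono[of "Im z" 2 L] by (simp add: field_simps)
    ultimately have "L - ln h \<le> 2 * (L + 1) / Im z" by (simp add: add_divide_distrib)
    moreover have "Re (g1 (3 * \<i>)) = L - ln h" by (simp add: g1_def g(2) L_def)
    ultimately have R1: "Re (g1 (3 * \<i>)) \<le> 2 * (L + 1) / Im z" by simp
    have "N \<le> cmod z + 5"
    proof -
      have "N \<le> cmod z + cmod (cnj (3 * \<i>) + 2 * \<i> * h)"
        unfolding N_def using norm_triangle_ineq4[of z "cnj (3 * \<i>) + 2 * \<i> * h"]
        by (simp only: diff_diff_eq)
      also have "cmod (cnj (3 * \<i>) + 2 * \<i> * h) \<le> 3 + 2 * h"
        using norm_triangle_ineq[of "cnj (3 * \<i>)" "2 * \<i> * h"] h by (simp add: norm_mult)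
      finally show ?thesis using h by simp
    qed
    then have "N\<^sup>2 \<le> (cmod z + 5)\<^sup>2" by (intro power_mono) (auto simp: N_def)
    also have "\<dots> \<le> 50 * (1 + (cmod z)\<^sup>2)"
    proof -
      have "0 \<le> (cmod z - 5)\<^sup>2 + 48 * (cmod z)\<^sup>2" by simp
      then show ?thesis by (simp add: power2_sum power2_diff)
    qed
    finally have N: "N\<^sup>2 \<le> 50 * (1 + (cmod z)\<^sup>2)" .
    have "Re (g1 z) \<le> Re (g1 (3 * \<i>)) * N\<^sup>2 / ((Im z - h) * (Im (3 * \<i>) - h))"
      unfolding N_def using h z by (intro Harnack_half_plane[OF hg1 pos1]) (auto simp: h_def)
    also have "\<dots> \<le> (2 * (L + 1) / Im z) * (50 * (1 + (cmod z)\<^sup>2)) / Im z"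
    proof (rule frac_le)
      show "Re (g1 (3 * \<i>)) * N\<^sup>2 \<le> (2 * (L + 1) / Im z) * (50 * (1 + (cmod z)\<^sup>2))"
        using R1 N L0 z by (intro mult_mono) auto
      have "Im z \<le> h * (3 - h)" using h mult_right_mono[of 2 "3 - h" h] by (simp add: h_def mult.commute)
      then show "Im z \<le> (Im z - h) * (Im (3 * \<i>) - h)" by (simp add: h_def)
    qed (use z L0 in auto)
    also have "\<dots> = 100 * (L + 1) * (1 + (cmod z)\<^sup>2) / (Im z)\<^sup>2"
      by (simp add: power2_eq_square) (simp add: algebra_simps)
    finally have "Re (g z) \<le> 100 * (L + 1) * (1 + (cmod z)\<^sup>2) / (Im z)\<^sup>2"
      using h by (simp add: g1_def ln_le_zero_iff) (smt (verit) ln_le_zero_iff)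
    moreover have "cmod (\<Phi> z) = exp (Re (g z))"
      using lower[of z] z by (cases "\<Phi> z = 0") (auto simp: g(2))
    ultimately show ?thesis by simp
  qed
  with L0 show ?thesis by (intro that[of "100 * (L + 1)"]) auto
qed

end

section \<open>A Phragmen-Lindelof principle in thin sectors\<close>

lemma frontier_truncated_sector:
  fixes \<tau> r R :: real
  defines "S \<equiv> {z. r < Re z \<and> Re z < R \<and> \<bar>Im z\<bar> < \<tau> * Re z}"
  shows "closure S \<subseteq> {z. r \<le> Re z \<and> Re z \<le> R \<and> \<bar>Im z\<bar> \<le> \<tau> * Re z}"
    and "z \<in> frontier S \<Longrightarrow> r \<le> Re z \<and> Re z \<le> R \<and> \<bar>Im z\<bar> \<le> \<tau> * Re z \<and>
           (Re z = r \<or> Re z = R \<or> \<bar>Im z\<bar> = \<tau> * Re z)"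
proof -
  have op: "open S"
    unfolding S_def by (intro open_Collect_conj open_Collect_less continuous_intros)
  have "closed {z. r \<le> Re z \<and> Re z \<le> R \<and> \<bar>Im z\<bar> \<le> \<tau> * Re z}"
    by (intro closed_Collect_conj closed_Collect_le continuous_intros)
  then show cl: "closure S \<subseteq> {z. r \<le> Re z \<and> Re z \<le> R \<and> \<bar>Im z\<bar> \<le> \<tau> * Re z}"
    by (intro closure_minimal) (auto simp: S_def)
  show "r \<le> Re z \<and> Re z \<le> R \<and> \<bar>Im z\<bar> \<le> \<tau> * Re z \<and>
           (Re z = r \<or> Re z = R \<or> \<bar>Im z\<bar> = \<tau> * Re z)" if "z \<in> frontier S"
  proof -
    have "z \<in> closure S" "z \<notin> S" using that op by (auto simp: frontier_def interior_open)
    then have "r \<le> Re z \<and> Re z \<le> R \<and> \<bar>Im z\<bar> \<le> \<tau> * Re z"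
      "\<not> (r < Re z \<and> Re z < R \<and> \<bar>Im z\<bar> < \<tau> * Re z)"
      using cl by (auto simp: S_def)
    then show ?thesis by linarith
  qed
qed

text \<open>
  In a thin sector around the positive axis, \<open>1 / z\<^sup>2\<close> and \<open>z\<^sup>2\<close> have real parts comparable to their
  moduli, so exponentials of their negatives serve as damping factors at the vertex and at infinity.
\<close>

lemma thin_sector_squares:
  fixes \<tau> :: real
  assumes \<tau>: "\<tau> \<le> 1/4" and z: "0 < Re z" "\<bar>Im z\<bar> \<le> \<tau> * Re z"
  shows "1 / (2 * (Re z)\<^sup>2) \<le> Re (1 / z\<^sup>2)" and "(Re z)\<^sup>2 / 2 \<le> Re (z\<^sup>2)"
proof -
  define p q where "p = (Re z)\<^sup>2" and "q = (Im z)\<^sup>2"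
  have "\<tau> * Re z \<le> 1/4 * Re z" using \<tau> z by (intro mult_right_mono) auto
  with z have "\<bar>Im z\<bar> \<le> 1/4 * Re z" by linarith
  then have "\<bar>Im z\<bar>\<^sup>2 \<le> (1/4 * Re z)\<^sup>2" by (intro power_mono) auto
  then have q: "q \<le> p / 16" by (simp add: p_def q_def power_mult_distrib power_divide)
  have p: "p > 0" "q \<ge> 0" using z by (auto simp: p_def q_def)
  have Rez: "Re (z\<^sup>2) = p - q" by (simp add: power2_eq_square p_def q_def)
  show "(Re z)\<^sup>2 / 2 \<le> Re (z\<^sup>2)" using q p by (simp add: Rez p_def[symmetric])
  have "(cmod (z\<^sup>2))\<^sup>2 = (p + q)\<^sup>2"
    by (simp add: norm_power cmod_power2 p_def q_def)
  then have R: "Re (1 / z\<^sup>2) = (p - q) / (p + q)\<^sup>2"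
    by (simp add: Re_divide' Rez)
  have "(p + q)\<^sup>2 \<le> (17/16 * p)\<^sup>2" using p q by (intro power_mono) auto
  also have "\<dots> = (289/256 * p) * p" by (simp add: power2_eq_square)
  also have "\<dots> \<le> (2 * (p - q)) * p" using p q by (intro mult_right_mono) auto
  finally have "(p + q)\<^sup>2 \<le> (p - q) * (2 * p)" by (simp add: mult_ac)
  moreover have "(p + q)\<^sup>2 > 0" using p by simp
  ultimately have "1 / (2 * p) \<le> (p - q) / (p + q)\<^sup>2" using p by (simp add: divide_simps mult_ac)
  then show "1 / (2 * (Re z)\<^sup>2) \<le> Re (1 / z\<^sup>2)" by (simp add: R p_def)
qed

text \<open>
  On the sides the bound blows up like \<open>exp (D / (Re z)\<^sup>2)\<close> at the vertex, which is compensated by the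
  factor \<open>exp (- 2 * D / z\<^sup>2)\<close>. A further factor \<open>exp (- \<eta> * z\<^sup>2)\<close> makes the product small far out, because
  the growth allowed there is only exponential; \<open>\<eta>\<close> tends to \<open>0\<close> in the end. The crude bound
  only starts the argument, so the conclusion is uniform in \<open>K\<close> and \<open>b\<close>.
\<close>

lemma Phragmen_Lindelof_thin_sector:
  fixes F :: "complex \<Rightarrow> complex" and \<tau> D D' e K b :: real
  assumes hol: "F holomorphic_on UNIV"
    and crude: "\<And>z::complex. cmod (F z) \<le> exp (K + b * \<bar>Im z\<bar>)" and b: "b \<ge> 0"
    and \<tau>: "0 < \<tau>" "\<tau> \<le> 1/4" and D: "D > 0" and e: "e \<ge> 0"
    and sides: "\<And>z::complex. 0 < Re z \<Longrightarrow> \<bar>Im z\<bar> = \<tau> * Re z \<Longrightarrow> cmod (F z) \<le> exp (D / (Re z)\<^sup>2 + e * Re z + D')"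
    and z: "1 \<le> Re z" "\<bar>Im z\<bar> < \<tau> * Re z"
  shows "cmod (F z) \<le> exp (D' + 2 * D + e * Re z)"
proof -
  have main: "cmod (F z) \<le> exp (D' + 2 * D + e * Re z + \<eta> * (Re z)\<^sup>2)" if \<eta>: "\<eta> > 0" for \<eta>
  proof -
    define G where "G w = F w * exp (- (2 * D / w\<^sup>2) - e * w - \<eta> * w\<^sup>2)" for w :: complex
    have normG: "cmod (G w) = cmod (F w) * exp (- (2 * D * Re (1 / w\<^sup>2)) - e * Re w - \<eta> * Re (w\<^sup>2))" for w :: complex
    proof -
      have "2 * complex_of_real D / w\<^sup>2 = of_real (2 * D) * (1 / w\<^sup>2)" by simp
      then have "Re (2 * complex_of_real D / w\<^sup>2) = 2 * D * Re (1 / w\<^sup>2)"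
        by (simp only: times_complex.sel Re_complex_of_real Im_complex_of_real mult_zero_left diff_zero)
      then show ?thesis by (simp add: G_def norm_mult)
    qed
    have Gle: "cmod (G w) \<le> cmod (F w) * exp (- (D / (Re w)\<^sup>2) - e * Re w - \<eta> * (Re w)\<^sup>2 / 2)"
      if w: "0 < Re w" "\<bar>Im w\<bar> \<le> \<tau> * Re w" for w
    proof -
      have "D / (Re w)\<^sup>2 \<le> 2 * D * Re (1 / w\<^sup>2)"
        using mult_left_mono[OF thin_sector_squares(1)[OF \<tau>(2) w], of "2 * D"] D by simp
      moreover have "\<eta> * (Re w)\<^sup>2 / 2 \<le> \<eta> * Re (w\<^sup>2)"
        using mult_left_mono[OF thin_sector_squares(2)[OF \<tau>(2) w], of \<eta>] \<eta> by simp
      ultimately show ?thesis unfolding normG by (intro mult_left_mono) auto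
    qed
    have Fle: "cmod (F w) \<le> exp (K + b * Re w)" if w: "0 < Re w" "\<bar>Im w\<bar> \<le> \<tau> * Re w" for w
    proof -
      have "\<tau> * Re w \<le> 1 * Re w" using \<tau> w by (intro mult_right_mono) auto
      then have "\<bar>Im w\<bar> \<le> Re w" using w by linarith
      then have "b * \<bar>Im w\<bar> \<le> b * Re w" using b by (rule mult_left_mono)
      then show ?thesis using crude[of w] by (smt (verit) exp_le_cancel_iff)
    qed
    \<comment> \<open>With these constants \<open>D / r\<^sup>2\<close> and \<open>\<eta> * R\<^sup>2 / 2\<close> exceed the crude bound on the vertical sides
      \<open>Re w = r\<close> and \<open>Re w = R\<close> of the truncated sector.\<close>
    define A where "A = \<bar>K - D'\<bar> + b + 1"
    have A: "A \<ge> 1" "A \<ge> b" "A \<ge> K - D'" "A \<ge> K - D' + b" using b by (auto simp: A_def)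
    define R where "R = Re z + 1 + 2 * A / \<eta>"
    define r where "r = min (1/2) (D / A)"
    have R: "R > Re z" "R \<ge> 1" "\<eta> * R \<ge> 2 * A"
    proof -
      show "R > Re z" "R \<ge> 1" using z A \<eta> by (auto simp: R_def intro: add_strict_increasing)
      have "2 * A = \<eta> * (2 * A / \<eta>)" using \<eta> by simp
      also have "\<dots> \<le> \<eta> * R" using z \<eta> by (intro mult_left_mono) (auto simp: R_def)
      finally show "\<eta> * R \<ge> 2 * A" .
    qed
    have r: "0 < r" "r < Re z" "r \<le> 1" "A * r \<le> D"
    proof -
      have "r \<le> 1/2" "r \<le> D / A" unfolding r_def by (rule min.cobounded1, rule min.cobounded2)
      then show "r < Re z" "r \<le> 1" "A * r \<le> D" using z A by (auto simp: field_simps)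
      show "0 < r" using A D by (auto simp: r_def)
    qed
    define S where "S = {w. r < Re w \<and> Re w < R \<and> \<bar>Im w\<bar> < \<tau> * Re w}"
    note fr = frontier_truncated_sector[where r = r and R = R and \<tau> = \<tau>, folded S_def]
    have nz: "w \<noteq> 0" if "w \<in> closure S" for w using fr(1) that r by auto
    have holG: "G holomorphic_on closure S"
      unfolding G_def using nz
      by (intro holomorphic_intros holomorphic_on_subset[OF hol]) auto
    have "cmod (G z) \<le> exp D'"
    proof (rule maximum_modulus_frontier[of G S])
      show "G holomorphic_on interior S"
        by (rule holomorphic_on_subset[OF holG]) (meson closure_subset dual_order.trans interior_subset)
      show "continuous_on (closure S) G" by (rule holomorphic_on_imp_continuous_on[OF holG])
      have "S \<subseteq> cbox (Complex r (- \<tau> * R)) (Complex R (\<tau> * R))"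
      proof
        fix w assume "w \<in> S"
        then have w: "r < Re w" "Re w < R" "\<bar>Im w\<bar> < \<tau> * Re w" by (auto simp: S_def)
        moreover have "\<tau> * Re w \<le> \<tau> * R" using w \<tau> by (intro mult_left_mono) auto
        ultimately show "w \<in> cbox (Complex r (- \<tau> * R)) (Complex R (\<tau> * R))"
          by (auto simp: in_cbox_complex_iff)
      qed
      then show "bounded S" by (rule bounded_subset[OF bounded_cbox])
      show "z \<in> S" using z r R by (auto simp: S_def)
    next
      fix w assume "w \<in> frontier S"
      from fr(2)[OF this] have w: "r \<le> Re w" "0 < Re w" "\<bar>Im w\<bar> \<le> \<tau> * Re w"
        and or: "Re w = r \<or> Re w = R \<or> \<bar>Im w\<bar> = \<tau> * Re w"
        using r by auto
      have combine: "cmod (G w) \<le> exp D'"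
        if "cmod (F w) \<le> exp X" "X - D / (Re w)\<^sup>2 - e * Re w - \<eta> * (Re w)\<^sup>2 / 2 \<le> D'" for X
      proof -
        have "cmod (G w) \<le> exp X * exp (- (D / (Re w)\<^sup>2) - e * Re w - \<eta> * (Re w)\<^sup>2 / 2)"
          using Gle[OF w(2,3)] that(1) by (meson exp_ge_zero mult_right_mono order_trans)
        also have "\<dots> \<le> exp D'" using that(2) by (simp flip: exp_add)
        finally show ?thesis .
      qed
      have nonneg: "0 \<le> D / (Re w)\<^sup>2" "0 \<le> e * Re w" "0 \<le> \<eta> * (Re w)\<^sup>2 / 2"
        using D e w \<eta> by auto
      show "cmod (G w) \<le> exp D'"
        using or
      proof (elim disjE)
        assume eq: "Re w = r"
        have "A * (r * r) \<le> A * r" using r A by (intro mult_left_mono mult_left_le) auto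
        then have "A * r\<^sup>2 \<le> D" using r by (simp add: power2_eq_square)
        then have "A \<le> D / r\<^sup>2" using r by (simp add: field_simps)
        moreover have "b * r \<le> b" using b r by (intro mult_left_le) auto
        ultimately show ?thesis
          using combine[OF Fle[OF w(2,3)]] nonneg eq A by auto
      next
        assume eq: "Re w = R"
        have "2 * A * R \<le> \<eta> * R * R" using R by (intro mult_right_mono) auto
        then have "A * R \<le> \<eta> * R\<^sup>2 / 2" by (simp add: power2_eq_square)
        moreover have "A * R = b * R + (\<bar>K - D'\<bar> + 1) * R" by (simp add: A_def algebra_simps)
        moreover have "\<bar>K - D'\<bar> + 1 \<le> (\<bar>K - D'\<bar> + 1) * R" using R by (simp add: mult_le_cancel_left1)
        ultimately show ?thesis
          using combine[OF Fle[OF w(2,3)]] nonneg eq by auto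
      next
        assume "\<bar>Im w\<bar> = \<tau> * Re w"
        then show ?thesis using combine[OF sides[OF w(2)]] nonneg by auto
      qed
    qed
    then have "cmod (F z) * exp (- (2 * D * Re (1 / z\<^sup>2)) - e * Re z - \<eta> * Re (z\<^sup>2)) \<le> exp D'"
      by (simp add: normG)
    then have "cmod (F z) \<le> exp D' / exp (- (2 * D * Re (1 / z\<^sup>2)) - e * Re z - \<eta> * Re (z\<^sup>2))"
      by (simp add: pos_le_divide_eq)
    also have "\<dots> = exp (D' + 2 * D * Re (1 / z\<^sup>2) + e * Re z + \<eta> * Re (z\<^sup>2))"
      by (simp flip: exp_diff)
    also have "\<dots> \<le> exp (D' + 2 * D + e * Re z + \<eta> * (Re z)\<^sup>2)"
    proof -
      have "1 \<le> cmod z" using z complex_Re_le_cmod[of z] by linarith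
      then have "1 \<le> (cmod z)\<^sup>2" by simp
      then have "cmod (1 / z\<^sup>2) \<le> 1" by (simp add: norm_divide norm_power divide_le_eq_1)
      then have "Re (1 / z\<^sup>2) \<le> 1" using complex_Re_le_cmod order_trans by blast
      then have "2 * D * Re (1 / z\<^sup>2) \<le> 2 * D" using D by (intro mult_left_le) auto
      moreover have "Re (z\<^sup>2) \<le> (Re z)\<^sup>2" by (simp add: power2_eq_square)
      then have "\<eta> * Re (z\<^sup>2) \<le> \<eta> * (Re z)\<^sup>2" using \<eta> by (intro mult_left_mono) auto
      ultimately show ?thesis by simp
    qed
    finally show ?thesis .
  qed
  show ?thesis
  proof (cases "F z = 0")
    case False
    \<comment> \<open>Let \<open>\<eta>\<close> tend to \<open>0\<close>.\<close>
    have "ln (cmod (F z)) \<le> D' + 2 * D + e * Re z"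
    proof (rule field_le_epsilon)
      fix \<epsilon> :: real assume "\<epsilon> > 0"
      then have "cmod (F z) \<le> exp (D' + 2 * D + e * Re z + \<epsilon> / (Re z)\<^sup>2 * (Re z)\<^sup>2)"
        using z by (intro main) auto
      also have "\<epsilon> / (Re z)\<^sup>2 * (Re z)\<^sup>2 = \<epsilon>" using z by auto
      finally have "ln (cmod (F z)) \<le> ln (exp (D' + 2 * D + e * Re z + \<epsilon>))"
        using False by (subst ln_le_cancel_iff) auto
      then show "ln (cmod (F z)) \<le> D' + 2 * D + e * Re z + \<epsilon>" by simp
    qed
    then have "exp (ln (cmod (F z))) \<le> exp (D' + 2 * D + e * Re z)" by simp
    then show ?thesis using False by simp
  qed simp
qed

text \<open>
  The Phragmen-Lindelof principle is applied in a sector so thin that the term \<open>c * \<bar>Im z\<bar>\<close> costs at most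
  \<open>\<epsilon> / 2 * Re z\<close> on its sides, with vertex so far to the left that the sector contains the half-strip.
  It matters that \<open>A\<close> is chosen before \<open>F\<close>, \<open>K\<close> and \<open>b\<close>: the bound is used for the whole unit ball of
  a space of entire functions, on which \<open>K\<close> is not bounded.
\<close>

lemma subexponential_on_right_half_strip:
  fixes c0 c C \<epsilon> L :: real and B :: "real \<Rightarrow> real"
  assumes c: "c \<ge> 0" and C: "C > 0" and B: "\<And>\<eta>. \<eta> > 0 \<Longrightarrow> B \<eta> \<ge> 0" and \<epsilon>: "\<epsilon> > 0" and L: "L \<ge> 0"
  shows "\<exists>A. \<forall>F K b. F holomorphic_on UNIV \<longrightarrow> b \<ge> 0 \<longrightarrow>
      (\<forall>z. cmod (F z) \<le> exp (K + b * \<bar>Im z\<bar>)) \<longrightarrow>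
      (\<forall>\<eta>>0. \<forall>z. 2 \<le> \<bar>Im z\<bar> \<longrightarrow>
        cmod (F z) \<le> exp (c0 + c * \<bar>Im z\<bar> + (\<eta> * (cmod z)\<^sup>2 + B \<eta>) / \<bar>Im z\<bar>)) \<longrightarrow>
      (\<forall>z. 0 < \<bar>Im z\<bar> \<longrightarrow> \<bar>Im z\<bar> \<le> 2 \<longrightarrow> cmod (F z) \<le> exp (c0 + C * (1 + (cmod z)\<^sup>2) / (Im z)\<^sup>2)) \<longrightarrow>
      (\<forall>z. 0 \<le> Re z \<longrightarrow> \<bar>Im z\<bar> \<le> L \<longrightarrow> cmod (F z) \<le> exp (A + \<epsilon> * Re z))"
proof -
  \<comment> \<open>The opening ensures \<open>c * \<tau> \<le> \<epsilon> / 2\<close>.\<close>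
  define \<tau> where "\<tau> = min (1/4) (\<epsilon> / (2 * (c + 1)))"
  have \<tau>: "0 < \<tau>" using \<epsilon> c by (auto simp: \<tau>_def)
  have \<tau>4: "\<tau> \<le> 1/4" unfolding \<tau>_def by (rule min.cobounded1)
  note \<tau> = \<tau> \<tau>4
  have "c * \<tau> \<le> (c + 1) * (\<epsilon> / (2 * (c + 1)))"
    using c \<tau> by (intro mult_mono) (auto simp: \<tau>_def)
  also have "\<dots> = \<epsilon> / 2" using c nonzero_mult_div_cancel_left[of "c + 1" \<epsilon>]
    by (simp only: times_divide_eq_right mult.left_commute[of _ 2] divide_divide_eq_left[symmetric] mult.commute[of 2])
  finally have c\<tau>: "c * \<tau> \<le> \<epsilon> / 2" .
  \<comment> \<open>The vertex lies at \<open>-X\<close>, where the half-strip of width \<open>L\<close> fits strictly inside the sector.\<close>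
  define X where "X = (1 + L) / \<tau>"
  have X: "X > 0" "\<tau> * X = 1 + L" "X \<ge> 1"
  proof -
    show "X > 0" "\<tau> * X = 1 + L" using \<tau> L by (auto simp: X_def)
    have "\<tau> \<le> 1 + L" using \<tau> L by linarith
    then show "X \<ge> 1" using \<tau> by (simp add: X_def)
  qed
  \<comment> \<open>On the sides \<open>\<eta> * \<bar>z\<bar>\<^sup>2 / \<bar>Im z\<bar>\<close> is then at most \<open>\<epsilon> / 2 * Re z\<close> up to a constant.\<close>
  define \<eta> where "\<eta> = \<epsilon> * \<tau> / 16"
  have \<eta>: "\<eta> > 0" using \<epsilon> \<tau> by (simp add: \<eta>_def)
  \<comment> \<open>A bound of \<open>\<bar>z\<bar>\<close> on the part of the sides near the vertex, where \<open>\<bar>Im z\<bar> \<le> 2\<close>.\<close>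
  define Y where "Y = 4 / \<tau> + X"
  define D where "D = C * (1 + Y\<^sup>2) / \<tau>\<^sup>2"
  have "1 + Y\<^sup>2 > 0" by (simp add: add_pos_nonneg)
  then have D: "D > 0" using C \<tau> by (simp add: D_def)
  define D' where "D' = c0 + \<eta> * X\<^sup>2 + B \<eta> / 2"
  show ?thesis
  proof (intro exI[of _ "D' + 2 * D + \<epsilon> * X"] allI impI)
    fix F K b z
    assume F: "F holomorphic_on UNIV" and b: "b \<ge> 0" and crude: "\<forall>z. cmod (F z) \<le> exp (K + b * \<bar>Im z\<bar>)"
      and far: "\<forall>\<eta>>0. \<forall>z. 2 \<le> \<bar>Im z\<bar> \<longrightarrow>
        cmod (F z) \<le> exp (c0 + c * \<bar>Im z\<bar> + (\<eta> * (cmod z)\<^sup>2 + B \<eta>) / \<bar>Im z\<bar>)"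
      and near: "\<forall>z. 0 < \<bar>Im z\<bar> \<longrightarrow> \<bar>Im z\<bar> \<le> 2 \<longrightarrow>
        cmod (F z) \<le> exp (c0 + C * (1 + (cmod z)\<^sup>2) / (Im z)\<^sup>2)"
      and z: "0 \<le> Re z" "\<bar>Im z\<bar> \<le> L"
    define F1 where "F1 w = F (w - of_real X)" for w
    have "(F \<circ> (\<lambda>w. w - of_real X)) holomorphic_on UNIV"
      by (rule holomorphic_on_compose_gen[OF _ F]) (auto intro!: holomorphic_intros)
    then have F1: "F1 holomorphic_on UNIV" unfolding F1_def by (simp add: o_def)
    have crude1: "cmod (F1 w) \<le> exp (K + b * \<bar>Im w\<bar>)" for w
      using crude[rule_format, of "w - of_real X"] by (simp add: F1_def)
    have sides: "cmod (F1 w) \<le> exp (D / (Re w)\<^sup>2 + \<epsilon> * Re w + D')"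
      if w: "0 < Re w" "\<bar>Im w\<bar> = \<tau> * Re w" for w
    proof -
      define \<xi> where "\<xi> = Re w"
      define u where "u = w - of_real X"
      have \<xi>: "\<xi> > 0" and Imu: "\<bar>Im u\<bar> = \<tau> * \<xi>" using w by (auto simp: \<xi>_def u_def)
      have "\<tau> * \<xi> \<le> 1/4 * \<xi>" using \<tau> \<xi> by (intro mult_right_mono) auto
      then have "cmod w \<le> 2 * \<xi>"
        using cmod_le[of w] w unfolding \<xi>_def by linarith
      then have u: "cmod u \<le> 2 * \<xi> + X"
        unfolding u_def using norm_triangle_ineq4[of w "of_real X"] X by simp
      show ?thesis
      proof (cases "2 \<le> \<tau> * \<xi>")
        case True
        have "(cmod u)\<^sup>2 \<le> (2 * \<xi> + X)\<^sup>2" using u by (intro power_mono) auto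
        also have "\<dots> \<le> 8 * \<xi>\<^sup>2 + 2 * X\<^sup>2"
          using zero_le_power2[of "2 * \<xi> - X"] by (simp add: power2_eq_square algebra_simps)
        finally have "\<eta> * (cmod u)\<^sup>2 \<le> \<eta> * (8 * \<xi>\<^sup>2 + 2 * X\<^sup>2)"
          using \<eta> by (intro mult_left_mono) auto
        then have "(\<eta> * (cmod u)\<^sup>2 + B \<eta>) / (\<tau> * \<xi>) \<le> (\<eta> * (8 * \<xi>\<^sup>2 + 2 * X\<^sup>2) + B \<eta>) / (\<tau> * \<xi>)"
          using True by (intro divide_right_mono) auto
        also have "\<dots> = \<eta> * (8 * \<xi>\<^sup>2) / (\<tau> * \<xi>) + (2 * \<eta> * X\<^sup>2 + B \<eta>) / (\<tau> * \<xi>)"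
          by (simp add: add_divide_distrib distrib_left)
        also have "\<eta> * (8 * \<xi>\<^sup>2) / (\<tau> * \<xi>) = \<epsilon> / 2 * \<xi>"
          using \<xi> \<tau> by (simp add: \<eta>_def power2_eq_square)
        also have "(2 * \<eta> * X\<^sup>2 + B \<eta>) / (\<tau> * \<xi>) \<le> (2 * \<eta> * X\<^sup>2 + B \<eta>) / 2"
          using True \<eta> B[OF \<eta>] by (intro divide_left_mono) auto
        finally have "(\<eta> * (cmod u)\<^sup>2 + B \<eta>) / (\<tau> * \<xi>) \<le> \<epsilon> / 2 * \<xi> + \<eta> * X\<^sup>2 + B \<eta> / 2"
          by (simp add: add_divide_distrib)
        moreover have "c * (\<tau> * \<xi>) \<le> \<epsilon> / 2 * \<xi>"
          using mult_right_mono[OF c\<tau>, of \<xi>] \<xi> by (simp add: mult.assoc)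
        moreover have "0 \<le> D / \<xi>\<^sup>2" using D by simp
        ultimately have "c0 + c * (\<tau> * \<xi>) + (\<eta> * (cmod u)\<^sup>2 + B \<eta>) / (\<tau> * \<xi>) \<le> D / \<xi>\<^sup>2 + \<epsilon> * \<xi> + D'"
          by (simp add: D'_def)
        moreover have "cmod (F1 w) \<le> exp (c0 + c * (\<tau> * \<xi>) + (\<eta> * (cmod u)\<^sup>2 + B \<eta>) / (\<tau> * \<xi>))"
          using far[rule_format, OF \<eta>, of u] True Imu by (simp add: F1_def u_def)
        ultimately show ?thesis unfolding \<xi>_def[symmetric] by (meson exp_le_cancel_iff order_trans)
      next
        case False
        then have "\<xi> \<le> 2 / \<tau>" using \<tau> by (simp add: field_simps)
        then have "cmod u \<le> Y" using u by (simp add: Y_def)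
        then have "(cmod u)\<^sup>2 \<le> Y\<^sup>2" by (intro power_mono) auto
        then have "C * (1 + (cmod u)\<^sup>2) / (\<tau> * \<xi>)\<^sup>2 \<le> C * (1 + Y\<^sup>2) / (\<tau> * \<xi>)\<^sup>2"
          using C by (intro divide_right_mono mult_left_mono) auto
        also have "\<dots> = D / \<xi>\<^sup>2" by (simp add: D_def power_mult_distrib)
        finally have "C * (1 + (cmod u)\<^sup>2) / (\<tau> * \<xi>)\<^sup>2 \<le> D / \<xi>\<^sup>2" .
        moreover have "0 \<le> \<epsilon> * \<xi> + \<eta> * X\<^sup>2 + B \<eta> / 2" using \<epsilon> \<xi> \<eta> B[OF \<eta>] by simp
        ultimately have "c0 + C * (1 + (cmod u)\<^sup>2) / (\<tau> * \<xi>)\<^sup>2 \<le> D / \<xi>\<^sup>2 + \<epsilon> * \<xi> + D'"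
          by (simp add: D'_def)
        moreover have "cmod (F1 w) \<le> exp (c0 + C * (1 + (cmod u)\<^sup>2) / (\<tau> * \<xi>)\<^sup>2)"
        proof -
          have "(Im u)\<^sup>2 = (\<tau> * \<xi>)\<^sup>2" using Imu by (metis power2_abs)
          moreover have "0 < \<bar>Im u\<bar>" "\<bar>Im u\<bar> \<le> 2" using Imu \<tau> \<xi> False by simp_all
          ultimately show ?thesis
            using near[rule_format, of u] by (simp add: F1_def u_def)
        qed
        ultimately show ?thesis unfolding \<xi>_def[symmetric] by (meson exp_le_cancel_iff order_trans)
      qed
    qed
    define w where "w = z + of_real X"
    have "\<tau> * X \<le> \<tau> * Re w" using z \<tau> by (intro mult_left_mono) (auto simp: w_def)
    then have "cmod (F1 w) \<le> exp (D' + 2 * D + \<epsilon> * Re w)"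
      using z X \<epsilon>
      by (intro Phragmen_Lindelof_thin_sector[OF F1 crude1 b \<tau> D _ sides]) (auto simp: w_def)
    then show "cmod (F z) \<le> exp (D' + 2 * D + \<epsilon> * X + \<epsilon> * Re z)"
      by (simp add: F1_def w_def algebra_simps)
  qed
qed

section \<open>Smooth functions and Fourier transforms of test functions\<close>

text \<open>
  Smoothness is defined through iterated total derivatives. The recursion below allows the derivative to be
  supplied as a witness instead, so that sums, products and compositions are handled by induction.
\<close>

primrec differentiable_times :: "nat \<Rightarrow> (real \<Rightarrow> complex) \<Rightarrow> bool" where
  "differentiable_times 0 f = True"
| "differentiable_times (Suc n) f =
     (\<exists>f'. (\<forall>x. (f has_vector_derivative f' x) (at x)) \<and> differentiable_times n f')"

lemma differentiable_times_SucI: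
  "(\<And>x. (f has_vector_derivative f' x) (at x)) \<Longrightarrow> differentiable_times n f' \<Longrightarrow> differentiable_times (Suc n) f"
  by auto

lemma smooth_imp_differentiable_times: "smooth f \<Longrightarrow> differentiable_times n f"
proof (induction n arbitrary: f)
  case (Suc n)
  define f' where "f' = (\<lambda>x. vector_derivative f (at x))"
  have "f differentiable_on UNIV"
    using Suc.prems[unfolded smooth_def, rule_format, of 0] by simp
  then have "f differentiable (at x)" for x by (simp add: differentiable_on_def)
  then have 1: "(f has_vector_derivative f' x) (at x)" for x
    unfolding f'_def by (simp add: vector_derivative_works)
  have "smooth f'"
    unfolding smooth_def
  proof
    fix k
    show "((\<lambda>g x. vector_derivative g (at x)) ^^ k) f' differentiable_on UNIV"
      using Suc.prems[unfolded smooth_def, rule_format, of "Suc k"]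
      by (simp only: funpow_Suc_right o_def f'_def)
  qed
  then show ?case using Suc.IH 1 by auto
qed simp

lemma differentiable_times_imp_smooth:
  assumes "\<And>n. differentiable_times n f"
  shows "smooth f"
proof -
  have "((\<lambda>g x. vector_derivative g (at x)) ^^ k) f differentiable_on UNIV" for k
    using assms
  proof (induction k arbitrary: f)
    case 0
    from "0.prems"[of 1] obtain f' where "\<And>x. (f has_vector_derivative f' x) (at x)" by auto
    then show ?case
      by (auto simp: differentiable_on_def intro: differentiableI_vector)
  next
    case (Suc k)
    have "differentiable_times n (\<lambda>x. vector_derivative f (at x))" for n
    proof -
      from Suc.prems[of "Suc n"] obtain f' where
        f': "\<And>x. (f has_vector_derivative f' x) (at x)" "differentiable_times n f'" by auto
      then have "(\<lambda>x. vector_derivative f (at x)) = f'"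
        by (auto intro: vector_derivative_at)
      with f' show ?thesis by simp
    qed
    from Suc.IH[OF this] show ?case by (simp only: funpow_Suc_right o_def)
  qed
  then show ?thesis by (simp add: smooth_def)
qed

lemma differentiable_times_SucD: "differentiable_times (Suc n) f \<Longrightarrow> differentiable_times n f"
proof (induction n arbitrary: f)
  case (Suc n)
  then obtain f' where "\<And>x. (f has_vector_derivative f' x) (at x)" "differentiable_times (Suc n) f'"
    by auto
  with Suc.IH[of f'] show ?case by auto
qed simp

lemma differentiable_times_const: "differentiable_times n (\<lambda>x. c)"
proof (induction n arbitrary: c)
  case (Suc n)
  have "\<forall>x. ((\<lambda>x. c) has_vector_derivative 0) (at x)" by simp
  with Suc.IH[of 0] show ?case by (auto intro: exI[of _ "\<lambda>x. 0"])
qed simp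

lemma differentiable_times_add:
  "differentiable_times n f \<Longrightarrow> differentiable_times n g \<Longrightarrow> differentiable_times n (\<lambda>x. f x + g x)"
proof (induction n arbitrary: f g)
  case (Suc n)
  from Suc.prems obtain f' g' where
    "\<And>x. (f has_vector_derivative f' x) (at x)" "differentiable_times n f'"
    "\<And>x. (g has_vector_derivative g' x) (at x)" "differentiable_times n g'" by auto
  with Suc.IH[of f' g'] show ?case
    by (auto intro!: exI[of _ "\<lambda>x. f' x + g' x"] has_vector_derivative_add)
qed simp

lemma differentiable_times_mult:
  "differentiable_times n f \<Longrightarrow> differentiable_times n g \<Longrightarrow> differentiable_times n (\<lambda>x. f x * g x)"
proof (induction n arbitrary: f g)
  case (Suc n)
  from Suc.prems obtain f' g' where
    d: "\<And>x. (f has_vector_derivative f' x) (at x)" "differentiable_times n f'"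
    "\<And>x. (g has_vector_derivative g' x) (at x)" "differentiable_times n g'" by auto
  have "differentiable_times n f" "differentiable_times n g"
    using Suc.prems differentiable_times_SucD by blast+
  then have "differentiable_times n (\<lambda>x. f x * g' x + f' x * g x)"
    using d by (intro differentiable_times_add Suc.IH)
  with d show ?case
    by (auto intro!: exI[of _ "\<lambda>x. f x * g' x + f' x * g x"] has_vector_derivative_mult)
qed simp

lemma has_vector_derivative_exp_linear:
  "((\<lambda>x. exp (w * of_real x)) has_vector_derivative w * exp (w * of_real x)) (at x)" for w :: complex
proof -
  have "((\<lambda>z. exp (w * z)) has_field_derivative w * exp (w * of_real x)) (at (of_real x))"
    by (auto intro!: derivative_eq_intros)
  then show ?thesis by (rule has_vector_derivative_real_field)
qed

lemma differentiable_times_exp: "differentiable_times n (\<lambda>x. exp (w * of_real x))"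
proof (induction n)
  case (Suc n)
  have "differentiable_times n (\<lambda>x. w * exp (w * of_real x))"
    by (intro differentiable_times_mult differentiable_times_const Suc.IH)
  with has_vector_derivative_exp_linear show ?case by (rule differentiable_times_SucI)
qed simp

lemma differentiable_times_cnj_reflect:
  "differentiable_times n f \<Longrightarrow> differentiable_times n (\<lambda>x. cnj (f (- x)))"
proof (induction n arbitrary: f)
  case (Suc n)
  from Suc.prems obtain f' where
    d: "\<And>x. (f has_vector_derivative f' x) (at x)" "differentiable_times n f'" by auto
  have "((\<lambda>x. cnj (f (- x))) has_vector_derivative (- 1) * cnj (f' (- x))) (at x)" for x
  proof -
    have "((f \<circ> uminus) has_vector_derivative (- 1) *\<^sub>R f' (- x)) (at x)"
      by (rule vector_diff_chain_at) (auto intro!: derivative_eq_intros d)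
    from has_vector_derivative_cnj[OF this] show ?thesis by (simp add: o_def)
  qed
  moreover have "differentiable_times n (\<lambda>x. (- 1) * cnj (f' (- x)))"
    by (intro differentiable_times_mult differentiable_times_const Suc.IH d)
  ultimately show ?case by (rule differentiable_times_SucI)
qed simp

lemma smooth_const: "smooth (\<lambda>x. c)"
  by (intro differentiable_times_imp_smooth differentiable_times_const)

lemma smooth_add: "smooth f \<Longrightarrow> smooth g \<Longrightarrow> smooth (\<lambda>x. f x + g x)"
  by (rule differentiable_times_imp_smooth, rule differentiable_times_add)
    (rule smooth_imp_differentiable_times, assumption)+

lemma smooth_mult: "smooth f \<Longrightarrow> smooth g \<Longrightarrow> smooth (\<lambda>x. f x * g x)"
  by (rule differentiable_times_imp_smooth, rule differentiable_times_mult)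
    (rule smooth_imp_differentiable_times, assumption)+

lemma smooth_exp: "smooth (\<lambda>x. exp (w * of_real x))"
  by (intro differentiable_times_imp_smooth differentiable_times_exp)

lemma smooth_cnj_reflect: "smooth f \<Longrightarrow> smooth (\<lambda>x. cnj (f (- x)))"
  by (rule differentiable_times_imp_smooth, rule differentiable_times_cnj_reflect)
    (rule smooth_imp_differentiable_times, assumption)+

lemma smooth_derivative:
  assumes "smooth f"
  obtains f' where "smooth f'" "\<And>x. (f has_vector_derivative f' x) (at x)"
proof -
  from smooth_imp_differentiable_times[OF assms, of 1] obtain f' where
    f': "\<And>x. (f has_vector_derivative f' x) (at x)" by auto
  have "differentiable_times n f'" for n
  proof -
    from smooth_imp_differentiable_times[OF assms, of "Suc n"] obtain f'' where
      "\<And>x. (f has_vector_derivative f'' x) (at x)" "differentiable_times n f''" by auto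
    moreover from this f' have "f'' = f'" by (blast intro: vector_derivative_unique_at)
    ultimately show ?thesis by simp
  qed
  then have "smooth f'" by (rule differentiable_times_imp_smooth)
  with f' show ?thesis by (intro that)
qed

lemma smooth_imp_continuous: "smooth f \<Longrightarrow> continuous_on UNIV f"
  by (meson smooth_derivative continuous_at_imp_continuous_on has_vector_derivative_continuous)

text \<open>
  Vanishing outside \<open>(-b, b)\<close> is a pointwise condition, unlike one on the topological support, and passes directly to
  sums, products and primitives.
\<close>

definition test_function :: "real \<Rightarrow> (real \<Rightarrow> complex) \<Rightarrow> bool" where
  "test_function b f \<longleftrightarrow> smooth f \<and> (\<forall>x. b \<le> \<bar>x\<bar> \<longrightarrow> f x = 0)"

text \<open>
  A compact set in \<open>(-a, a)\<close> lies in \<open>[-c, c]\<close> for some \<open>c < a\<close>, so a transform in the space comes from a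
  test function that vanishes outside a smaller interval. This leaves room for taking derivatives.
\<close>

lemma entire_space_iff:
  assumes a: "a > 0"
  shows "F \<in> entire_space a \<longleftrightarrow> (\<exists>b f. 0 < b \<and> b < a \<and> test_function b f \<and> F = fourier f)"
proof
  assume "F \<in> entire_space a"
  then obtain f where f: "F = fourier f" "smooth f" "compact (tsupport f)" "tsupport f \<subseteq> {-a<..<a}"
    by (auto simp: entire_space_def)
  have "compact (abs ` tsupport f)"
    by (intro compact_continuous_image f continuous_intros)
  then obtain c where c: "0 \<le> c" "c < a" "\<And>x. x \<in> tsupport f \<Longrightarrow> \<bar>x\<bar> \<le> c"
  proof (cases "tsupport f = {}")
    case True
    then show ?thesis using that[of 0] a by simp
  next
    case False
    then obtain x where "x \<in> tsupport f" "\<And>y. y \<in> tsupport f \<Longrightarrow> \<bar>y\<bar> \<le> \<bar>x\<bar>"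
      using compact_attains_sup[OF \<open>compact (abs ` tsupport f)\<close>] by auto
    then show ?thesis using that[of "\<bar>x\<bar>"] f(4) by (auto simp: abs_less_iff)
  qed
  define b where "b = (c + a) / 2"
  have "f x = 0" if "b \<le> \<bar>x\<bar>" for x
  proof (rule ccontr)
    assume "f x \<noteq> 0"
    then have "x \<in> tsupport f" unfolding tsupport_def using closure_subset[of "{x. f x \<noteq> 0}"] by auto
    then have "\<bar>x\<bar> \<le> c" by (rule c(3))
    then show False using c(2) that by (simp add: b_def)
  qed
  then show "\<exists>b f. 0 < b \<and> b < a \<and> test_function b f \<and> F = fourier f"
    using f c by (intro exI[of _ b] exI[of _ f]) (auto simp: b_def test_function_def)
next
  assume "\<exists>b f. 0 < b \<and> b < a \<and> test_function b f \<and> F = fourier f"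
  then obtain b f where f: "0 < b" "b < a" "test_function b f" "F = fourier f" by blast
  have "x \<in> {-b..b}" if "f x \<noteq> 0" for x
  proof -
    have "\<not> b \<le> \<bar>x\<bar>" using f(3) that by (auto simp: test_function_def)
    then show ?thesis by auto
  qed
  then have sub: "tsupport f \<subseteq> {-b..b}"
    unfolding tsupport_def by (intro closure_minimal) auto
  then have "bounded (tsupport f)" by (rule bounded_subset[OF bounded_closed_interval])
  then have "compact (tsupport f)" by (simp add: compact_eq_bounded_closed tsupport_def)
  moreover have "tsupport f \<subseteq> {-a<..<a}" using sub f(2) by auto
  moreover have "smooth f" using f(3) by (simp add: test_function_def)
  ultimately show "F \<in> entire_space a" unfolding entire_space_def f(4) by blast
qed

lemma integral_compactly_supported:
  fixes g :: "real \<Rightarrow> 'b::euclidean_space"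
  assumes "continuous_on UNIV g" and "\<And>x. b \<le> \<bar>x\<bar> \<Longrightarrow> g x = 0"
  shows "integrable lborel g" and "(LINT x|lborel. g x) = integral {-b..b} g"
    and "g integrable_on {-b..b}"
proof -
  have eq: "(\<lambda>x. indicator {-b..b} x *\<^sub>R g x) = g"
    using assms(2) by (auto simp: indicator_def fun_eq_iff abs_le_iff)
  have cont: "continuous_on {-b..b} g" using assms(1) by (rule continuous_on_subset) simp
  have "integrable lborel (\<lambda>x. indicator {-b..b} x *\<^sub>R g x)"
    by (rule borel_integrable_compact) (use cont in auto)
  then have si: "set_integrable lborel {-b..b} g" by (simp add: set_integrable_def)
  then show "integrable lborel g" by (simp add: set_integrable_def eq)
  show "(LINT x|lborel. g x) = integral {-b..b} g"
    using set_borel_integral_eq_integral(2)[OF si] by (simp add: set_lebesgue_integral_def eq)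
  show "g integrable_on {-b..b}" by (rule integrable_continuous_interval[OF cont])
qed

lemma test_function_integrand:
  assumes "test_function b f"
  shows "continuous_on UNIV (\<lambda>x. f x * exp (- (\<i> * z * complex_of_real x)))"
    and "b \<le> \<bar>x\<bar> \<Longrightarrow> f x * exp (- (\<i> * z * complex_of_real x)) = 0"
proof -
  have "continuous_on UNIV f" using assms by (simp add: test_function_def smooth_imp_continuous)
  then show "continuous_on UNIV (\<lambda>x. f x * exp (- (\<i> * z * complex_of_real x)))"
    by (auto intro!: continuous_intros)
  show "f x * exp (- (\<i> * z * complex_of_real x)) = 0" if "b \<le> \<bar>x\<bar>"
    using assms that by (simp add: test_function_def)
qed

lemma fourier_integrable:
  "test_function b f \<Longrightarrow> integrable lborel (\<lambda>x. f x * exp (- (\<i> * z * complex_of_real x)))"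
  using integral_compactly_supported(1) test_function_integrand by blast

lemma fourier_eq_integral:
  "test_function b f \<Longrightarrow> fourier f z = integral {-b..b} (\<lambda>x. f x * exp (- (\<i> * z * complex_of_real x)))"
  unfolding fourier_def by (rule integral_compactly_supported(2)[OF test_function_integrand])

lemma fourier_holomorphic:
  assumes "test_function b f"
  shows "fourier f holomorphic_on UNIV"
proof -
  have cont: "continuous_on UNIV f" using assms by (simp add: test_function_def smooth_imp_continuous)
  have "(\<lambda>z. integral (cbox (-b) b) (\<lambda>x. f x * exp (- (\<i> * z * complex_of_real x)))) holomorphic_on UNIV"
  proof (rule leibniz_rule_holomorphic)
    show "((\<lambda>z. f t * exp (- (\<i> * z * complex_of_real t))) has_field_derivative
        f t * (exp (- (\<i> * z * complex_of_real t)) * (- (\<i> * complex_of_real t)))) (at z within UNIV)" for z t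
      by (auto intro!: derivative_eq_intros)
    show "(\<lambda>x. f x * exp (- (\<i> * z * complex_of_real x))) integrable_on cbox (- b) b" for z
      using integral_compactly_supported(3)[OF test_function_integrand[OF assms]] by simp
    have "continuous_on (UNIV \<times> cbox (- b) b) (\<lambda>p. f (snd p))"
      by (rule continuous_on_compose2[OF cont continuous_on_snd[OF continuous_on_id]]) simp
    then show "continuous_on (UNIV \<times> cbox (- b) b)
     (\<lambda>(z, t). f t * (exp (- (\<i> * z * complex_of_real t)) * (- (\<i> * complex_of_real t))))"
      unfolding case_prod_beta by (intro continuous_intros)
  qed auto
  moreover have "fourier f = (\<lambda>z. integral (cbox (-b) b) (\<lambda>x. f x * exp (- (\<i> * z * complex_of_real x))))"
    by (simp add: fun_eq_iff fourier_eq_integral[OF assms])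
  ultimately show ?thesis by simp
qed

section \<open>Bump functions and their transforms\<close>

definition flat_germ :: "real poly \<Rightarrow> real \<Rightarrow> complex" where
  "flat_germ p x = (if 0 < x then of_real (poly p (1 / x) * exp (- (1 / x))) else 0)"

lemma poly_times_exp_minus_tendsto_0: "((\<lambda>t. poly p t * exp (- t)) \<longlongrightarrow> 0) at_top" for p :: "real poly"
proof -
  have "((\<lambda>t. \<Sum>i\<le>degree p. coeff p i * (t ^ i / exp t)) \<longlongrightarrow> (\<Sum>i\<le>degree p. coeff p i * 0)) at_top"
    by (intro tendsto_sum tendsto_mult tendsto_const tendsto_power_div_exp_0)
  moreover have "poly p t * exp (- t) = (\<Sum>i\<le>degree p. coeff p i * (t ^ i / exp t))" for t
    by (simp add: poly_altdef sum_distrib_right exp_minus divide_inverse mult.assoc)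
  ultimately show ?thesis by simp
qed

text \<open>
  The family \<open>p (1 / x) * exp (- (1 / x))\<close> is closed under differentiation, also at the origin, where every
  member is flat. Smoothness of all members follows by induction.
\<close>

lemma flat_germ_has_vector_derivative:
  "(flat_germ p has_vector_derivative flat_germ ([:0, 0, 1:] * (p - pderiv p)) x) (at x)"
proof -
  consider "x < 0" | "x = 0" | "x > 0" by linarith
  then show ?thesis
  proof cases
    case 1
    have "((\<lambda>x. 0) has_vector_derivative 0) (at x)" by simp
    then have "(flat_germ p has_vector_derivative 0) (at x)"
      by (rule has_vector_derivative_transform_within_open[of _ _ _ "{..<0}"])
         (use 1 in \<open>auto simp: flat_germ_def\<close>)
    then show ?thesis using 1 by (simp add: flat_germ_def)
  next
    case 3
    have "((\<lambda>x. poly p (1 / x) * exp (- (1 / x))) has_real_derivative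
        poly ([:0, 0, 1:] * (p - pderiv p)) (1 / x) * exp (- (1 / x))) (at x)"
    proof -
      have d: "((\<lambda>x. 1 / x) has_real_derivative - (1 / x)\<^sup>2) (at x)"
        using 3 by (auto intro!: derivative_eq_intros simp: power2_eq_square)
      have "((\<lambda>x. poly p (1 / x)) has_real_derivative poly (pderiv p) (1 / x) * (- (1 / x)\<^sup>2)) (at x)"
        by (rule DERIV_chain2[OF poly_DERIV d])
      moreover have "((\<lambda>x. exp (- (1 / x))) has_real_derivative exp (- (1 / x)) * (1 / x)\<^sup>2) (at x)"
        using DERIV_chain2[OF DERIV_exp DERIV_minus[OF d]] by simp
      ultimately have "((\<lambda>x. poly p (1 / x) * exp (- (1 / x))) has_real_derivative
         poly (pderiv p) (1 / x) * (- (1 / x)\<^sup>2) * exp (- (1 / x)) + exp (- (1 / x)) * (1 / x)\<^sup>2 * poly p (1 / x)) (at x)"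
        by (rule DERIV_mult)
      then show ?thesis by (simp add: algebra_simps power2_eq_square)
    qed
    then have "((\<lambda>x. of_real (poly p (1 / x) * exp (- (1 / x)))) has_vector_derivative
        complex_of_real (poly ([:0, 0, 1:] * (p - pderiv p)) (1 / x) * exp (- (1 / x)))) (at x)"
      by (intro has_vector_derivative_of_real) (simp add: has_real_derivative_iff_has_vector_derivative)
    then have "(flat_germ p has_vector_derivative
        complex_of_real (poly ([:0, 0, 1:] * (p - pderiv p)) (1 / x) * exp (- (1 / x)))) (at x)"
      by (rule has_vector_derivative_transform_within_open[of _ _ _ "{0<..}"])
         (use 3 in \<open>auto simp: flat_germ_def\<close>)
    then show ?thesis using 3 by (simp add: flat_germ_def)
  next
    case 2
    have "filterlim (\<lambda>h::real. 1 / \<bar>h\<bar>) at_top (at 0)" by real_asymp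
    then have "((\<lambda>h. poly ([:0,1:] * p) (1 / \<bar>h\<bar>) * exp (- (1 / \<bar>h\<bar>))) \<longlongrightarrow> 0) (at 0)"
      using poly_times_exp_minus_tendsto_0 by (rule filterlim_compose[rotated])
    then have lim: "((\<lambda>h. \<bar>poly ([:0,1:] * p) (1 / \<bar>h\<bar>) * exp (- (1 / \<bar>h\<bar>))\<bar>) \<longlongrightarrow> 0) (at 0)"
      by (rule tendsto_rabs_zero)
    have "((\<lambda>h. flat_germ p h /\<^sub>R h) \<longlongrightarrow> 0) (at 0)"
    proof (rule Lim_null_comparison[OF _ lim])
      have "norm (flat_germ p h /\<^sub>R h) \<le> \<bar>poly ([:0,1:] * p) (1 / \<bar>h\<bar>) * exp (- (1 / \<bar>h\<bar>))\<bar>" for h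
      proof (cases "0 < h")
        case True
        then show ?thesis by (simp add: flat_germ_def norm_mult abs_mult divide_inverse)
      next
        case False
        then show ?thesis
          by (simp only: flat_germ_def if_False scaleR_zero_right norm_zero abs_ge_zero)
      qed
      then show "\<forall>\<^sub>F h in at 0. norm (flat_germ p h /\<^sub>R h) \<le> \<bar>poly ([:0,1:] * p) (1 / \<bar>h\<bar>) * exp (- (1 / \<bar>h\<bar>))\<bar>"
        by simp
    qed
    then have "(flat_germ p has_vector_derivative 0) (at 0)"
    proof -
      assume "((\<lambda>h. flat_germ p h /\<^sub>R h) \<longlongrightarrow> 0) (at 0)"
      then have "((\<lambda>h. norm (flat_germ p h /\<^sub>R h)) \<longlongrightarrow> 0) (at 0)" by (rule tendsto_norm_zero)
      moreover have "norm (flat_germ p h /\<^sub>R h) = norm (flat_germ p h) / norm h" for h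
        by (simp add: divide_inverse mult.commute)
      moreover have "flat_germ p 0 = 0" by (simp add: flat_germ_def)
      ultimately show ?thesis
        by (simp add: has_vector_derivative_def has_derivative_at bounded_linear_zero)
    qed
    then show ?thesis using 2 by (simp add: flat_germ_def)
  qed
qed

lemma smooth_flat_germ: "smooth (flat_germ p)"
proof (rule differentiable_times_imp_smooth)
  show "differentiable_times n (flat_germ p)" for n
    by (induction n arbitrary: p)
       (auto intro: differentiable_times_SucI[OF flat_germ_has_vector_derivative] simp del: differentiable_times.simps(2))
qed

lemma differentiable_times_reflect:
  "differentiable_times n f \<Longrightarrow> differentiable_times n (\<lambda>x. f (c - x))"
proof (induction n arbitrary: f)
  case (Suc n)
  from Suc.prems obtain f' where
    d: "\<And>x. (f has_vector_derivative f' x) (at x)" "differentiable_times n f'" by auto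
  have "((\<lambda>x. f (c - x)) has_vector_derivative (- 1) * f' (c - x)) (at x)" for x
  proof -
    have "((f \<circ> (\<lambda>x. c - x)) has_vector_derivative (- 1) *\<^sub>R f' (c - x)) (at x)"
      by (rule vector_diff_chain_at) (auto intro!: derivative_eq_intros d)
    then show ?thesis by (simp add: o_def)
  qed
  moreover have "differentiable_times n (\<lambda>x. (- 1) * f' (c - x))"
    by (intro differentiable_times_mult differentiable_times_const Suc.IH d)
  ultimately show ?case by (rule differentiable_times_SucI)
qed simp

lemma bump_exists:
  assumes s: "s > 0"
  obtains f :: "real \<Rightarrow> real" where "smooth (\<lambda>x. of_real (f x))" "\<And>x. 0 < x \<Longrightarrow> x < s \<Longrightarrow> 0 < f x"
    "\<And>x. x \<le> 0 \<or> s \<le> x \<Longrightarrow> f x = 0"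
proof -
  define f where "f x = (if 0 < x \<and> x < s then exp (- (1 / x)) * exp (- (1 / (s - x))) else 0)" for x :: real
  have "smooth (\<lambda>x. flat_germ 1 (s - x))"
    by (rule differentiable_times_imp_smooth, rule differentiable_times_reflect,
        rule smooth_imp_differentiable_times, rule smooth_flat_germ)
  then have "smooth (\<lambda>x. flat_germ 1 x * flat_germ 1 (s - x))"
    by (rule smooth_mult[OF smooth_flat_germ])
  moreover have "(\<lambda>x. flat_germ 1 x * flat_germ 1 (s - x)) = (\<lambda>x. of_real (f x))"
    by (auto simp: fun_eq_iff flat_germ_def f_def)
  ultimately show ?thesis by (intro that[of f]) (auto simp: f_def)
qed

text \<open>
  For real \<open>t\<close> with \<open>\<bar>t\<bar> * s < pi / 2\<close> the kernel has the positive real part \<open>cos (t * x)\<close> on the support, and at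
  \<open>\<i> * y\<close> the kernel is \<open>exp (y * x) \<ge> 1\<close> there, since the support lies in \<open>[0, s]\<close>. Hence the transform of a short
  bump has no zeros on a long real interval, and stays away from \<open>0\<close> on the positive imaginary axis.
\<close>

lemma fourier_of_bump_pos:
  assumes s: "s > 0" and sm: "smooth (\<lambda>x. of_real (f x))"
    and pos: "\<And>x. 0 < x \<Longrightarrow> x < s \<Longrightarrow> 0 < (f x :: real)" and zero: "\<And>x. x \<le> 0 \<or> s \<le> x \<Longrightarrow> f x = 0"
    and b: "s \<le> b"
  shows "test_function b (\<lambda>x. of_real (f x))"
    and "\<bar>t\<bar> * s < pi / 2 \<Longrightarrow> 0 < Re (fourier (\<lambda>x. of_real (f x)) (of_real t))"
    and "0 \<le> y \<Longrightarrow> Re (fourier (\<lambda>x. of_real (f x)) 0) \<le> Re (fourier (\<lambda>x. of_real (f x)) (\<i> * of_real y))"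
proof -
  let ?f = "\<lambda>x. complex_of_real (f x)"
  show tf: "test_function b ?f"
  proof -
    have "f x = 0" if "b \<le> \<bar>x\<bar>" for x using that b by (intro zero) auto
    then show ?thesis using sm by (simp add: test_function_def)
  qed
  have Re: "Re (fourier ?f z) = (LINT x|lborel. Re (?f x * exp (- (\<i> * z * of_real x))))"
    and int: "integrable lborel (\<lambda>x. Re (?f x * exp (- (\<i> * z * of_real x))))" for z
    unfolding fourier_def
    by (rule integral_Re[symmetric, OF fourier_integrable[OF tf]])
       (rule integrable_Re[OF fourier_integrable[OF tf]])
  have fnn: "f x \<ge> 0" for x using pos[of x] zero[of x] by (cases "0 < x \<and> x < s") auto
  show "0 < Re (fourier ?f (of_real t))" if t: "\<bar>t\<bar> * s < pi / 2"
  proof -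
    have val: "Re (?f x * exp (- (\<i> * of_real t * of_real x))) = f x * cos (t * x)" for x
      by (simp add: Re_exp)
    have cospos: "0 < cos (t * x)" if "0 < x" "x < s" for x
    proof -
      have "\<bar>t * x\<bar> \<le> \<bar>t\<bar> * s" using that by (simp add: abs_mult mult_left_mono)
      then have "\<bar>t * x\<bar> < pi / 2" using t by linarith
      then show ?thesis by (intro cos_gt_zero_pi) auto
    qed
    have nn: "0 \<le> f x * cos (t * x)" for x
      using cospos[of x] pos[of x] zero[of x] by (cases "0 < x \<and> x < s") auto
    have "(LINT x|lborel. f x * cos (t * x)) \<noteq> 0"
    proof
      assume "(LINT x|lborel. f x * cos (t * x)) = 0"
      then have "AE x in lborel. f x * cos (t * x) = 0"
        using int[of "of_real t"] nn unfolding val by (subst (asm) integral_nonneg_eq_0_iff_AE) auto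
      then have "AE x in lborel. x \<notin> {0<..<s}"
        by eventually_elim (use pos cospos in force)
      then have "emeasure lborel {0<..<s} = 0"
        by (subst (asm) AE_iff_measurable[of "{0<..<s}"]) auto
      then show False using s by simp
    qed
    moreover have "0 \<le> (LINT x|lborel. f x * cos (t * x))" using nn by (intro integral_nonneg_AE) auto
    ultimately show ?thesis unfolding Re val by linarith
  qed
  show "Re (fourier ?f 0) \<le> Re (fourier ?f (\<i> * of_real y))" if "0 \<le> y"
    unfolding Re
  proof (intro integral_mono int)
    fix x
    have "f x * 1 \<le> f x * exp (y * x)"
      using that zero[of x] fnn[of x] by (cases "x \<le> 0", simp, intro mult_left_mono) auto
    then show "Re (?f x * exp (- (\<i> * 0 * of_real x))) \<le> Re (?f x * exp (- (\<i> * (\<i> * of_real y) * of_real x)))"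
      by (simp add: Re_exp mult.assoc[symmetric])
  qed
qed

lemma fourier_bump:
  assumes s: "s > 0"
  shows "\<exists>f. test_function s f \<and> (\<forall>t::real. \<bar>t\<bar> * s < pi / 2 \<longrightarrow> 0 < Re (fourier f (of_real t))) \<and>
    (\<forall>y\<ge>0. Re (fourier f 0) \<le> Re (fourier f (\<i> * of_real y)))"
proof -
  obtain f :: "real \<Rightarrow> real" where f: "smooth (\<lambda>x. of_real (f x))" "\<And>x. 0 < x \<Longrightarrow> x < s \<Longrightarrow> 0 < f x"
    "\<And>x. x \<le> 0 \<or> s \<le> x \<Longrightarrow> f x = 0"
    using bump_exists[OF s] by blast
  have "test_function s (\<lambda>x. of_real (f x))"
    by (rule fourier_of_bump_pos(1)[OF s f(1) _ _ order_refl]) (use f in auto)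
  moreover have "0 < Re (fourier (\<lambda>x. of_real (f x)) (of_real t))" if "\<bar>t\<bar> * s < pi / 2" for t
    by (rule fourier_of_bump_pos(2)[OF s f(1) _ _ order_refl that]) (use f in auto)
  moreover have "Re (fourier (\<lambda>x. of_real (f x)) 0) \<le> Re (fourier (\<lambda>x. of_real (f x)) (\<i> * of_real y))" if "0 \<le> y" for y
    by (rule fourier_of_bump_pos(3)[OF s f(1) _ _ order_refl that]) (use f in auto)
  ultimately show ?thesis by (intro exI[of _ "\<lambda>x. of_real (f x)"]) blast
qed

section \<open>Operations on the space of Fourier transforms\<close>

lemma has_integral_test_function_derivative:
  assumes "\<And>x. (h has_vector_derivative h' x) (at x)" and "\<And>x. b \<le> \<bar>x\<bar> \<Longrightarrow> h x = (0::complex)" and "b \<ge> 0"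
  shows "(h' has_integral 0) {-b..b}"
proof -
  have "(h' has_integral (h b - h (-b))) {-b..b}"
    by (rule fundamental_theorem_of_calculus)
       (use assms in \<open>auto intro: has_vector_derivative_at_within\<close>)
  then show ?thesis using assms(2)[of b] assms(2)[of "-b"] assms(3) by simp
qed

lemma derivative_zero_outside:
  assumes "\<And>x. (h has_vector_derivative h' x) (at x)" and "\<And>x. b \<le> \<bar>x\<bar> \<Longrightarrow> h x = (0::complex)"
    and "b < \<bar>x\<bar>"
  shows "h' x = 0"
proof -
  have "open {x::real. b < \<bar>x\<bar>}" by (intro open_Collect_less continuous_intros)
  then have "((\<lambda>x. 0) has_vector_derivative h' x) (at x)"
    by (rule has_vector_derivative_transform_within_open[OF assms(1)[of x]]) (use assms in auto)
  then show ?thesis using vector_derivative_unique_at[OF has_vector_derivative_const, of 0 "h' x"] by simp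
qed

lemma test_function_mono: "test_function b f \<Longrightarrow> b \<le> b' \<Longrightarrow> test_function b' f"
  by (auto simp: test_function_def)

lemma test_function_continuous: "test_function b f \<Longrightarrow> continuous_on UNIV f"
  by (simp add: test_function_def smooth_imp_continuous)

lemma test_function_cmult:
  assumes "test_function b f"
  shows "test_function b (\<lambda>x. c * f x)"
proof -
  have "smooth (\<lambda>x. c * f x)"
    using assms by (intro smooth_mult[OF smooth_const]) (simp add: test_function_def)
  then show ?thesis using assms by (simp add: test_function_def)
qed

lemma test_function_add:
  assumes "test_function b f" "test_function b g"
  shows "test_function b (\<lambda>x. f x + g x)"
proof -
  have "smooth (\<lambda>x. f x + g x)" by (rule smooth_add) (use assms in \<open>simp_all add: test_function_def\<close>)
  then show ?thesis using assms by (simp add: test_function_def)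
qed

lemma fourier_add:
  assumes "test_function b f" "test_function b g"
  shows "fourier (\<lambda>x. f x + g x) = (\<lambda>z. fourier f z + fourier g z)"
  using fourier_integrable[OF assms(1)] fourier_integrable[OF assms(2)]
  by (simp add: fourier_def fun_eq_iff distrib_right)

lemma fourier_cmult: "fourier (\<lambda>x. c * f x) = (\<lambda>z. c * fourier f z)"
  by (simp add: fourier_def fun_eq_iff mult.assoc)

lemma fourier_derivative:
  assumes f: "\<And>x. (f has_vector_derivative f' x) (at x)" and tf: "test_function b f" "test_function b f'"
    and b: "b \<ge> 0"
  shows "fourier f' z = \<i> * z * fourier f z"
proof -
  let ?e = "\<lambda>x. exp (- (\<i> * z * complex_of_real x))"
  have d: "((\<lambda>x. f x * ?e x) has_vector_derivative (f' x * ?e x - \<i> * z * (f x * ?e x))) (at x)" for x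
    using has_vector_derivative_mult[OF f has_vector_derivative_exp_linear[of "- (\<i> * z)" x]]
    by (simp add: algebra_simps)
  have "((\<lambda>x. f' x * ?e x - \<i> * z * (f x * ?e x)) has_integral 0) {-b..b}"
    by (rule has_integral_test_function_derivative[OF d test_function_integrand(2)[OF tf(1)] b])
  moreover have "((\<lambda>x. f' x * ?e x - \<i> * z * (f x * ?e x)) has_integral (fourier f' z - \<i> * z * fourier f z)) {-b..b}"
    unfolding fourier_eq_integral[OF tf(1)] fourier_eq_integral[OF tf(2)]
    by (intro has_integral_diff has_integral_mult_right integrable_integral
        integral_compactly_supported(3)[OF test_function_integrand[OF tf(1)]]
        integral_compactly_supported(3)[OF test_function_integrand[OF tf(2)]])
  ultimately have "0 = fourier f' z - \<i> * z * fourier f z" by (rule has_integral_unique)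
  then show ?thesis by simp
qed

text \<open>
  Dividing the transform by \<open>z - w\<close> amounts to solving \<open>g' = \<i> * w * g + f\<close>. The solution is
  \<open>exp (\<i> * w * x)\<close> times the primitive of \<open>f x * exp (- \<i> * w * x)\<close>, and the total integral of the latter is
  \<open>fourier f w = 0\<close>; so the solution vanishes on both sides of the support of \<open>f\<close>.
\<close>

lemma fourier_division:
  assumes tf: "test_function b f" and b: "b > 0" and zero: "fourier f w = 0"
  shows "\<exists>g. test_function b g \<and> (\<forall>z. fourier f z = (z - w) * fourier g z)"
proof -
  define h where "h x = f x * exp (- (\<i> * w * complex_of_real x))" for x
  define P where "P x = integral {-b..x} h" for x
  define e where "e x = exp (\<i> * w * complex_of_real x)" for x
  have h: "continuous_on UNIV h" "\<And>x. b \<le> \<bar>x\<bar> \<Longrightarrow> h x = 0"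
    using test_function_integrand[OF tf] unfolding h_def by auto
  have hi: "h integrable_on {u..v}" for u v
    by (rule integrable_continuous_interval, rule continuous_on_subset[OF h(1)]) simp
  have extend: "P x = integral {-M..x} h" if "b \<le> M" for M x
  proof (cases "x \<le> -b")
    case True
    then have "integral {u..x} h = integral {u..x} (\<lambda>x. 0)" for u
      by (intro integral_cong h(2)) (use b in auto)
    then show ?thesis by (simp add: P_def)
  next
    case False
    have "integral {-M..-b} h + integral {-b..x} h = integral {-M..x} h"
      using that False by (intro Henstock_Kurzweil_Integration.integral_combine hi) auto
    moreover have "integral {-M..-b} h = integral {-M..-b} (\<lambda>x. 0)"
      by (rule integral_cong) (use h(2) in auto)
    ultimately show ?thesis by (simp add: P_def)
  qed
  have P': "(P has_vector_derivative h x) (at x)" for x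
  proof -
    define M where "M = \<bar>x\<bar> + b + 1"
    have xM: "x \<in> {-M<..<M}" using b by (auto simp: M_def abs_if)
    have "((\<lambda>u. integral {-M..u} h) has_vector_derivative h x) (at x within {-M..M})"
      by (rule integral_has_vector_derivative) (use xM in \<open>auto intro: continuous_on_subset[OF h(1)]\<close>)
    then have "((\<lambda>u. integral {-M..u} h) has_vector_derivative h x) (at x)"
      using xM at_within_interior[of x "{-M..M}"] by simp
    moreover have "(\<lambda>u. integral {-M..u} h) = P"
      using extend[of M] b by (auto simp: fun_eq_iff M_def)
    ultimately show ?thesis by simp
  qed
  have P0: "P x = 0" if "b \<le> \<bar>x\<bar>" for x
  proof (cases "x \<le> -b")
    case True
    then show ?thesis using extend[of "-x"] b by (cases "x = -b") (auto simp: P_def)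
  next
    case False
    then have x: "b \<le> x" using that by auto
    have "integral {-b..b} h + integral {b..x} h = integral {-b..x} h"
      using x b by (intro Henstock_Kurzweil_Integration.integral_combine hi) auto
    moreover have "integral {b..x} h = integral {b..x} (\<lambda>x. 0)"
      by (rule integral_cong) (use h(2) b in auto)
    moreover have "integral {-b..b} h = 0"
      using zero fourier_eq_integral[OF tf, of w] by (simp add: h_def[abs_def])
    ultimately show ?thesis by (simp add: P_def)
  qed
  define g where "g x = e x * P x" for x
  have eh: "e x * h x = f x" for x
    by (simp add: e_def h_def flip: exp_add)
  have g': "(g has_vector_derivative (\<i> * w * g x + f x)) (at x)" for x
  proof -
    have "((\<lambda>x. e x * P x) has_vector_derivative (e x * h x + \<i> * w * e x * P x)) (at x)"
      unfolding e_def by (rule has_vector_derivative_mult[OF has_vector_derivative_exp_linear P'])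
    then show ?thesis by (simp add: g_def[abs_def] eh algebra_simps)
  qed
  have smf: "smooth f" using tf by (simp add: test_function_def)
  have "differentiable_times n g" for n
  proof (induction n)
    case (Suc n)
    have "differentiable_times n (\<lambda>x. \<i> * w * g x + f x)"
      by (intro differentiable_times_add differentiable_times_mult differentiable_times_const Suc.IH
          smooth_imp_differentiable_times[OF smf])
    with g' show ?case by (rule differentiable_times_SucI)
  qed simp
  then have "smooth g" by (rule differentiable_times_imp_smooth)
  then have tg: "test_function b g" by (simp add: test_function_def g_def P0)
  then have tg1: "test_function b (\<lambda>x. \<i> * w * g x)"
    by (rule test_function_cmult)
  then have tg2: "test_function b (\<lambda>x. \<i> * w * g x + f x)"
    using tf by (rule test_function_add)
  have "fourier f z = (z - w) * fourier (\<lambda>x. \<i> * g x) z" for z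
  proof -
    have "fourier (\<lambda>x. \<i> * w * g x + f x) z = \<i> * z * fourier g z"
      using fourier_derivative[OF g' tg tg2] b by simp
    moreover have "fourier (\<lambda>x. \<i> * w * g x + f x) z = \<i> * w * fourier g z + fourier f z"
      using fourier_add[OF tg1 tf] fourier_cmult[of "\<i> * w" g] by simp
    ultimately have "fourier f z = (z - w) * (\<i> * fourier g z)"
      by (simp add: algebra_simps)
    then show ?thesis by (simp only: fourier_cmult)
  qed
  moreover have "test_function b (\<lambda>x. \<i> * g x)"
    using tg by (rule test_function_cmult)
  ultimately show ?thesis by blast
qed

context
  fixes a :: real
  assumes a: "a > 0"
begin

lemma entire_spaceI:
  assumes "0 < b" "b < a" "test_function b f"
  shows "fourier f \<in> entire_space a"
  unfolding entire_space_iff[OF a] by (intro exI[of _ b] exI[of _ f] conjI assms refl)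

lemma entire_spaceE:
  assumes "F \<in> entire_space a"
  obtains b f where "0 < b" "b < a" "test_function b f" "F = fourier f"
  using assms unfolding entire_space_iff[OF a] by (elim exE conjE)

lemma entire_space_add:
  assumes "F \<in> entire_space a" "G \<in> entire_space a"
  shows "(\<lambda>z. F z + G z) \<in> entire_space a"
proof -
  obtain b f where f: "0 < b" "b < a" "test_function b f" "F = fourier f" by (rule entire_spaceE[OF assms(1)])
  obtain c g where g: "0 < c" "c < a" "test_function c g" "G = fourier g" by (rule entire_spaceE[OF assms(2)])
  have t: "test_function (max b c) f" "test_function (max b c) g"
    using f g test_function_mono by (meson max.cobounded1, meson max.cobounded2)
  then have "test_function (max b c) (\<lambda>x. f x + g x)"
    by (rule test_function_add)
  then have "fourier (\<lambda>x. f x + g x) \<in> entire_space a"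
    using f g by (intro entire_spaceI[of "max b c"]) auto
  then show ?thesis by (simp add: fourier_add[OF t] f g)
qed

lemma entire_space_cmult:
  assumes "F \<in> entire_space a"
  shows "(\<lambda>z. c * F z) \<in> entire_space a"
proof -
  obtain b f where f: "0 < b" "b < a" "test_function b f" "F = fourier f" by (rule entire_spaceE[OF assms(1)])
  have "test_function b (\<lambda>x. c * f x)"
    using f(3) by (rule test_function_cmult)
  then have "fourier (\<lambda>x. c * f x) \<in> entire_space a" using f by (intro entire_spaceI[of b])
  then show ?thesis by (simp add: fourier_cmult f)
qed

lemma entire_space_mult_ident:
  assumes "F \<in> entire_space a"
  shows "(\<lambda>z. z * F z) \<in> entire_space a"
proof -
  obtain b f where f: "0 < b" "b < a" "test_function b f" "F = fourier f" by (rule entire_spaceE[OF assms])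
  obtain f' where f': "smooth f'" "\<And>x. (f has_vector_derivative f' x) (at x)"
    using f(3) smooth_derivative unfolding test_function_def by blast
  define c where "c = (b + a) / 2"
  have c: "b < c" "c < a" using f by (auto simp: c_def)
  have "f' x = 0" if "c \<le> \<bar>x\<bar>" for x
    by (rule derivative_zero_outside[OF f'(2), of b]) (use f c that in \<open>auto simp: test_function_def\<close>)
  then have t: "test_function c f'" using f' by (simp add: test_function_def)
  have "test_function c f" using test_function_mono[OF f(3)] c by simp
  then have "fourier f' z = \<i> * z * fourier f z" for z
    using f c by (intro fourier_derivative[OF f'(2) _ t]) auto
  moreover have "(\<lambda>z. - \<i> * fourier f' z) \<in> entire_space a"
    using f c t by (intro entire_space_cmult entire_spaceI[of c]) auto
  ultimately show ?thesis by (simp add: f(4) mult.assoc[symmetric])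
qed

lemma entire_space_divide:
  assumes "F \<in> entire_space a" "F w = 0"
  shows "\<exists>G\<in>entire_space a. \<forall>z. F z = (z - w) * G z"
proof -
  obtain b f where f: "0 < b" "b < a" "test_function b f" "F = fourier f" by (rule entire_spaceE[OF assms(1)])
  have "fourier f w = 0" using assms(2) f(4) by simp
  from fourier_division[OF f(3,1) this] obtain g where
    g: "test_function b g \<and> (\<forall>z. fourier f z = (z - w) * fourier g z)" ..
  then have "fourier g \<in> entire_space a" using f by (intro entire_spaceI[of b]) auto
  with g show ?thesis unfolding f(4) by (intro bexI[of _ "fourier g"]) simp_all
qed

lemma entire_space_holomorphic: "F \<in> entire_space a \<Longrightarrow> F holomorphic_on UNIV"
  by (elim entire_spaceE) (simp add: fourier_holomorphic)

text \<open>
  A translation of the transform is a modulation of the test function.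
\<close>

lemma entire_space_shift:
  assumes "F \<in> entire_space a"
  shows "(\<lambda>z. F (z - of_real t)) \<in> entire_space a"
proof -
  obtain b f where f: "0 < b" "b < a" "test_function b f" "F = fourier f" by (rule entire_spaceE[OF assms])
  have "test_function b (\<lambda>x. f x * exp (\<i> * of_real t * of_real x))"
  proof -
    have "smooth (\<lambda>x. f x * exp (\<i> * of_real t * of_real x))"
      by (rule smooth_mult[OF _ smooth_exp]) (use f in \<open>simp add: test_function_def\<close>)
    then show ?thesis using f(3) by (simp add: test_function_def)
  qed
  then have "fourier (\<lambda>x. f x * exp (\<i> * of_real t * of_real x)) \<in> entire_space a"
    using f by (intro entire_spaceI[of b])
  moreover have "fourier (\<lambda>x. f x * exp (\<i> * of_real t * of_real x)) = (\<lambda>z. F (z - of_real t))"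
    unfolding f(4) fourier_def by (simp add: fun_eq_iff mult.assoc algebra_simps flip: exp_add)
  ultimately show ?thesis by simp
qed

lemma entire_space_cnj:
  assumes "F \<in> entire_space a"
  shows "(\<lambda>z. cnj (F (cnj z))) \<in> entire_space a"
proof -
  obtain b f where f: "0 < b" "b < a" "test_function b f" "F = fourier f" by (rule entire_spaceE[OF assms])
  have "test_function b (\<lambda>x. cnj (f (- x)))"
    using f(3) by (simp add: test_function_def smooth_cnj_reflect)
  then have "fourier (\<lambda>x. cnj (f (- x))) \<in> entire_space a"
    using f by (intro entire_spaceI[of b])
  moreover have "fourier (\<lambda>x. cnj (f (- x))) = (\<lambda>z. cnj (F (cnj z)))"
  proof
    fix z
    have "cnj (fourier f (cnj z)) = (LINT x|lborel. cnj (f x * exp (- (\<i> * cnj z * complex_of_real x))))"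
      unfolding fourier_def by (rule Bochner_Integration.integral_cnj[symmetric])
    also have "\<dots> = (LINT x|lborel. cnj (f (- x) * exp (- (\<i> * cnj z * complex_of_real (- x)))))"
      using lborel_integral_real_affine[of "-1" "\<lambda>x. cnj (f x * exp (- (\<i> * cnj z * complex_of_real x)))" 0] by simp
    also have "\<dots> = fourier (\<lambda>x. cnj (f (- x))) z"
      unfolding fourier_def by (simp add: exp_cnj)
    finally show "fourier (\<lambda>x. cnj (f (- x))) z = cnj (F (cnj z))" by (simp add: f(4))
  qed
  ultimately show ?thesis by simp
qed

lemma entire_space_exponential_type:
  assumes "F \<in> entire_space a"
  shows "\<exists>K. \<forall>z. cmod (F z) \<le> exp (K + a * \<bar>Im z\<bar>)"
proof -
  obtain b f where f: "0 < b" "b < a" "test_function b f" "F = fourier f" by (rule entire_spaceE[OF assms])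
  have cont: "continuous_on UNIV (\<lambda>x. cmod (f x))"
    by (intro continuous_intros test_function_continuous[OF f(3)])
  then have int: "integrable lborel (\<lambda>x. cmod (f x))"
    using f(3) by (intro integral_compactly_supported(1)[of _ b]) (auto simp: test_function_def)
  define I where "I = (LINT x|lborel. cmod (f x))"
  have I: "I \<ge> 0" unfolding I_def by (intro integral_nonneg_AE) auto
  have "cmod (F z) \<le> exp (ln (I + 1) + a * \<bar>Im z\<bar>)" for z
  proof -
    have "cmod (F z) \<le> (LINT x|lborel. cmod (f x * exp (- (\<i> * z * complex_of_real x))))"
      unfolding f(4) fourier_def by (rule integral_norm_bound)
    also have "\<dots> \<le> (LINT x|lborel. cmod (f x) * exp (a * \<bar>Im z\<bar>))"
    proof (intro integral_mono integrable_mult_left int integrable_norm fourier_integrable[OF f(3)])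
      fix x
      show "cmod (f x * exp (- (\<i> * z * complex_of_real x))) \<le> cmod (f x) * exp (a * \<bar>Im z\<bar>)"
      proof (cases "b \<le> \<bar>x\<bar>")
        case True
        then show ?thesis using f(3) by (simp add: test_function_def)
      next
        case False
        have "Im z * x \<le> \<bar>Im z\<bar> * \<bar>x\<bar>" by (metis abs_ge_self abs_mult)
        also have "\<dots> \<le> \<bar>Im z\<bar> * a" using False f by (intro mult_left_mono) auto
        finally have "cmod (exp (- (\<i> * z * complex_of_real x))) \<le> exp (a * \<bar>Im z\<bar>)"
          by (simp add: mult.commute)
        then show ?thesis unfolding norm_mult by (rule mult_left_mono) simp
      qed
    qed
    also have "\<dots> = I * exp (a * \<bar>Im z\<bar>)" by (simp add: I_def)
    also have "\<dots> \<le> (I + 1) * exp (a * \<bar>Im z\<bar>)" by (intro mult_right_mono) auto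
    also have "\<dots> = exp (ln (I + 1) + a * \<bar>Im z\<bar>)" using I by (simp add: exp_add)
    finally show ?thesis .
  qed
  then show ?thesis by blast
qed

lemma entire_space_power: "F \<in> entire_space a \<Longrightarrow> (\<lambda>z. z ^ n * F z) \<in> entire_space a"
proof (induction n)
  case (Suc n)
  then have "(\<lambda>z. z * (z ^ n * F z)) \<in> entire_space a" by (intro entire_space_mult_ident)
  then show ?case by (simp only: power_Suc mult.assoc)
qed simp

text \<open>
  Multiplication by powers of \<open>z\<close> preserves the space, and its members are bounded on the real line.
\<close>

lemma entire_space_decay:
  assumes "F \<in> entire_space a"
  shows "\<exists>C>0. \<forall>x::real. (1 + \<bar>x\<bar>) ^ n * cmod (F (of_real x)) \<le> C"
proof -
  obtain K where K: "\<forall>z. cmod (F z) \<le> exp (K + a * \<bar>Im z\<bar>)"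
    using entire_space_exponential_type[OF assms] ..
  obtain K' where K': "\<forall>z. cmod (z ^ n * F z) \<le> exp (K' + a * \<bar>Im z\<bar>)"
    using entire_space_exponential_type[OF entire_space_power[OF assms]] ..
  have "(1 + \<bar>x\<bar>) ^ n * cmod (F (of_real x)) \<le> 2 ^ n * (exp K + exp K')" for x
  proof -
    have "(1 + \<bar>x\<bar>) ^ n \<le> (2 * max 1 \<bar>x\<bar>) ^ n" by (intro power_mono) auto
    also have "\<dots> = 2 ^ n * max 1 \<bar>x\<bar> ^ n" by (simp add: power_mult_distrib)
    also have "max 1 \<bar>x\<bar> ^ n \<le> 1 + \<bar>x\<bar> ^ n" by (auto simp: max_def)
    finally have "(1 + \<bar>x\<bar>) ^ n * cmod (F (of_real x)) \<le> 2 ^ n * (1 + \<bar>x\<bar> ^ n) * cmod (F (of_real x))"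
      by (intro mult_right_mono) auto
    also have "\<dots> = 2 ^ n * (cmod (F (of_real x)) + cmod ((of_real x) ^ n * F (of_real x)))"
      by (simp add: norm_mult norm_power algebra_simps)
    also have "\<dots> \<le> 2 ^ n * (exp K + exp K')"
      using K[rule_format, of "of_real x"] K'[rule_format, of "of_real x"]
      by (intro mult_left_mono add_mono) auto
    finally show ?thesis .
  qed
  then show ?thesis by (intro exI[of _ "2 ^ n * (exp K + exp K')"]) (simp add: add_pos_pos)
qed

end

section \<open>Square-integrable functions\<close>

lemma L2_functionsD:
  assumes "g \<in> L2_functions M"
  shows "g \<in> borel_measurable M" and "integrable M (\<lambda>x. (cmod (g x))\<^sup>2)"
  using assms by (auto simp: L2_functions_def)

lemma L2_norm_nonneg [simp]: "0 \<le> L2_norm M g"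
  unfolding L2_norm_def by (intro real_sqrt_ge_zero integral_nonneg_AE) auto

lemma L2_norm_power2: "(L2_norm M g)\<^sup>2 = (LINT x|M. (cmod (g x))\<^sup>2)"
  unfolding L2_norm_def by (intro real_sqrt_pow2 integral_nonneg_AE) auto

lemma L2_functions_dominated:
  assumes h: "h \<in> L2_functions M" and g: "g \<in> borel_measurable M"
    and le: "\<And>x. cmod (g x) \<le> c * cmod (h x)"
  shows "g \<in> L2_functions M"
proof -
  have "integrable M (\<lambda>x. (cmod (g x))\<^sup>2)"
  proof (rule Bochner_Integration.integrable_bound)
    show "integrable M (\<lambda>x. c\<^sup>2 * (cmod (h x))\<^sup>2)"
      by (intro integrable_mult_right L2_functionsD(2)[OF h])
    have "(cmod (g x))\<^sup>2 \<le> (c * cmod (h x))\<^sup>2" for x using le[of x] by (intro power_mono) auto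
    then show "AE x in M. norm ((cmod (g x))\<^sup>2) \<le> norm (c\<^sup>2 * (cmod (h x))\<^sup>2)"
      by (simp add: power_mult_distrib)
  qed (use g in measurable)
  with g show ?thesis by (simp add: L2_functions_def)
qed

lemma L2_norm_dominated:
  assumes h: "h \<in> L2_functions M" and g: "g \<in> borel_measurable M"
    and le: "\<And>x. cmod (g x) \<le> c * cmod (h x)" and c: "c \<ge> 0"
  shows "L2_norm M g \<le> c * L2_norm M h"
proof (rule power2_le_imp_le)
  have "(LINT x|M. (cmod (g x))\<^sup>2) \<le> (LINT x|M. c\<^sup>2 * (cmod (h x))\<^sup>2)"
  proof (intro integral_mono integrable_mult_right L2_functionsD(2)[OF h])
    show "integrable M (\<lambda>x. (cmod (g x))\<^sup>2)"
      by (rule L2_functionsD(2)[OF L2_functions_dominated[OF h g le]])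
    show "(cmod (g x))\<^sup>2 \<le> c\<^sup>2 * (cmod (h x))\<^sup>2" for x
      unfolding power_mult_distrib[symmetric] using le[of x] by (intro power_mono) auto
  qed
  then show "(L2_norm M g)\<^sup>2 \<le> (c * L2_norm M h)\<^sup>2"
    by (simp add: L2_norm_power2 power_mult_distrib)
qed (use c in auto)

lemma L2_functions_cmult:
  assumes g: "g \<in> L2_functions M"
  shows "(\<lambda>x. c * g x) \<in> L2_functions M"
proof (rule L2_functions_dominated[OF g, of _ "cmod c"])
  show "(\<lambda>x. c * g x) \<in> borel_measurable M" using L2_functionsD(1)[OF g] by simp
qed (simp add: norm_mult)

lemma L2_norm_cmult: "L2_norm M (\<lambda>x. c * g x) = cmod c * L2_norm M g"
  by (simp add: L2_norm_def norm_mult power_mult_distrib real_sqrt_mult)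

lemma L2_functions_add:
  assumes "g \<in> L2_functions M" "h \<in> L2_functions M"
  shows "(\<lambda>x. g x + h x) \<in> L2_functions M"
proof -
  note [measurable] = L2_functionsD(1)[OF assms(1)] L2_functionsD(1)[OF assms(2)]
  have "integrable M (\<lambda>x. (cmod (g x + h x))\<^sup>2)"
  proof (rule Bochner_Integration.integrable_bound)
    show "integrable M (\<lambda>x. 2 * (cmod (g x))\<^sup>2 + 2 * (cmod (h x))\<^sup>2)"
      using L2_functionsD(2)[OF assms(1)] L2_functionsD(2)[OF assms(2)] by simp
    have "(cmod (g x + h x))\<^sup>2 \<le> 2 * (cmod (g x))\<^sup>2 + 2 * (cmod (h x))\<^sup>2" for x
    proof -
      have "(cmod (g x + h x))\<^sup>2 \<le> (cmod (g x) + cmod (h x))\<^sup>2"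
        by (intro power_mono norm_triangle_ineq) auto
      also have "\<dots> \<le> 2 * (cmod (g x))\<^sup>2 + 2 * (cmod (h x))\<^sup>2"
        using zero_le_power2[of "cmod (g x) - cmod (h x)"] by (simp add: power2_sum power2_diff)
      finally show ?thesis .
    qed
    then show "AE x in M. norm ((cmod (g x + h x))\<^sup>2) \<le> norm (2 * (cmod (g x))\<^sup>2 + 2 * (cmod (h x))\<^sup>2)"
      by simp
  qed measurable
  then show ?thesis by (simp add: L2_functions_def)
qed

lemma L2_functions_diff:
  assumes "g \<in> L2_functions M" "h \<in> L2_functions M"
  shows "(\<lambda>x. g x - h x) \<in> L2_functions M"
  using L2_functions_add[OF assms(1) L2_functions_cmult[OF assms(2), of "-1"]] by simp

lemma L2_functions_cnj:
  assumes g: "g \<in> L2_functions M"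
  shows "(\<lambda>x. cnj (g x)) \<in> L2_functions M"
proof (rule L2_functions_dominated[OF g, of _ 1])
  have "cnj \<in> borel_measurable borel"
    by (intro borel_measurable_continuous_onI continuous_intros)
  then show "(\<lambda>x. cnj (g x)) \<in> borel_measurable M"
    by (rule measurable_compose[OF L2_functionsD(1)[OF g]])
qed simp

lemma L2_integrable_mult:
  assumes "g \<in> L2_functions M" "h \<in> L2_functions M"
  shows "integrable M (\<lambda>x. cmod (g x) * cmod (h x))" and "integrable M (\<lambda>x. g x * h x)"
proof -
  note [measurable] = L2_functionsD(1)[OF assms(1)] L2_functionsD(1)[OF assms(2)]
  have int: "integrable M (\<lambda>x. (cmod (g x))\<^sup>2 + (cmod (h x))\<^sup>2)"
    by (intro Bochner_Integration.integrable_add L2_functionsD(2) assms)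
  have le: "cmod (g x * h x) \<le> (cmod (g x))\<^sup>2 + (cmod (h x))\<^sup>2" for x
  proof -
    have "0 \<le> cmod (g x) * cmod (h x)" by simp
    then show ?thesis
      using zero_le_power2[of "cmod (g x) - cmod (h x)"] unfolding power2_diff norm_mult by linarith
  qed
  show "integrable M (\<lambda>x. g x * h x)"
  proof (rule Bochner_Integration.integrable_bound[OF int])
    show "AE x in M. norm (g x * h x) \<le> norm ((cmod (g x))\<^sup>2 + (cmod (h x))\<^sup>2)"
      using le by simp
  qed measurable
  from integrable_norm[OF this] show "integrable M (\<lambda>x. cmod (g x) * cmod (h x))"
    by (simp add: norm_mult)
qed

lemma quadratic_nonneg_imp_discriminant:
  fixes A X B :: real
  assumes A: "0 \<le> A" and q: "\<And>s. 0 \<le> s\<^sup>2 * A - 2 * s * X + B"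
  shows "X\<^sup>2 \<le> A * B"
proof (cases "A = 0")
  case True
  have "X = 0"
  proof (rule ccontr)
    assume "X \<noteq> 0"
    then show False using q[of "(B + 1) / (2 * X)"] True by simp
  qed
  then show ?thesis using True by simp
next
  case False
  with A have A: "A > 0" by simp
  have "0 \<le> (X / A)\<^sup>2 * A - 2 * (X / A) * X + B" by (rule q)
  also have "\<dots> = B - X\<^sup>2 / A" using A by (simp add: power2_eq_square)
  finally show ?thesis using A by (simp add: field_simps)
qed

lemma L2_Cauchy_Schwarz:
  assumes g: "g \<in> L2_functions M" and h: "h \<in> L2_functions M"
  shows "(LINT x|M. cmod (g x) * cmod (h x)) \<le> L2_norm M g * L2_norm M h"
    and "cmod (LINT x|M. g x * h x) \<le> L2_norm M g * L2_norm M h"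
proof -
  define A B X where "A = (LINT x|M. (cmod (g x))\<^sup>2)" and "B = (LINT x|M. (cmod (h x))\<^sup>2)"
    and "X = (LINT x|M. cmod (g x) * cmod (h x))"
  note int = L2_functionsD(2)[OF g] L2_functionsD(2)[OF h] L2_integrable_mult(1)[OF g h]
  have "0 \<le> s\<^sup>2 * A - 2 * s * X + B" for s
  proof -
    have "0 \<le> (LINT x|M. (s * cmod (g x) - cmod (h x))\<^sup>2)" by (intro integral_nonneg_AE) auto
    also have "\<dots> = (LINT x|M. s\<^sup>2 * (cmod (g x))\<^sup>2 - 2 * s * (cmod (g x) * cmod (h x)) + (cmod (h x))\<^sup>2)"
      by (simp add: power2_eq_square algebra_simps)
    also have "\<dots> = s\<^sup>2 * A - 2 * s * X + B"
      unfolding A_def B_def X_def using int by simp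
    finally show ?thesis .
  qed
  moreover have "0 \<le> A" unfolding A_def by (intro integral_nonneg_AE) auto
  ultimately have "X\<^sup>2 \<le> A * B" by (intro quadratic_nonneg_imp_discriminant)
  then have "X\<^sup>2 \<le> (L2_norm M g * L2_norm M h)\<^sup>2"
    by (simp add: A_def B_def L2_norm_power2 power_mult_distrib)
  then show *: "X \<le> L2_norm M g * L2_norm M h"
    by (rule power2_le_imp_le) simp
  have "cmod (LINT x|M. g x * h x) \<le> (LINT x|M. cmod (g x * h x))" by (rule integral_norm_bound)
  then show "cmod (LINT x|M. g x * h x) \<le> L2_norm M g * L2_norm M h"
    using * by (simp add: norm_mult X_def)
qed

lemma L2_norm_add_power2:
  assumes g: "g \<in> L2_functions M" and h: "h \<in> L2_functions M"
  shows "(L2_norm M (\<lambda>x. g x + h x))\<^sup>2 =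
    (L2_norm M g)\<^sup>2 + 2 * Re (LINT x|M. h x * cnj (g x)) + (L2_norm M h)\<^sup>2"
proof -
  have int: "integrable M (\<lambda>x. h x * cnj (g x))"
    by (rule L2_integrable_mult(2)[OF h L2_functions_cnj[OF g]])
  have eq: "(cmod (g x + h x))\<^sup>2 = (cmod (g x))\<^sup>2 + 2 * Re (h x * cnj (g x)) + (cmod (h x))\<^sup>2" for x
    unfolding cmod_power2 by (simp add: power2_eq_square algebra_simps)
  have "(L2_norm M (\<lambda>x. g x + h x))\<^sup>2 =
      (LINT x|M. (cmod (g x))\<^sup>2 + 2 * Re (h x * cnj (g x)) + (cmod (h x))\<^sup>2)"
    unfolding L2_norm_power2 eq ..
  also have "\<dots> = (LINT x|M. (cmod (g x))\<^sup>2) + 2 * (LINT x|M. Re (h x * cnj (g x))) + (LINT x|M. (cmod (h x))\<^sup>2)"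
    using L2_functionsD(2)[OF g] L2_functionsD(2)[OF h] integrable_Re[OF int]
    by (simp del: times_complex.sel)
  also have "(LINT x|M. Re (h x * cnj (g x))) = Re (LINT x|M. h x * cnj (g x))"
    by (rule integral_Re[OF int])
  finally show ?thesis by (simp add: L2_norm_power2)
qed

lemma L2_norm_triangle:
  assumes g: "g \<in> L2_functions M" and h: "h \<in> L2_functions M"
  shows "L2_norm M (\<lambda>x. g x + h x) \<le> L2_norm M g + L2_norm M h"
proof (rule power2_le_imp_le)
  have "Re (LINT x|M. h x * cnj (g x)) \<le> L2_norm M h * L2_norm M (\<lambda>x. cnj (g x))"
    by (rule order_trans[OF complex_Re_le_cmod L2_Cauchy_Schwarz(2)[OF h L2_functions_cnj[OF g]]])
  then have "Re (LINT x|M. h x * cnj (g x)) \<le> L2_norm M h * L2_norm M g"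
    by (simp add: L2_norm_def)
  then show "(L2_norm M (\<lambda>x. g x + h x))\<^sup>2 \<le> (L2_norm M g + L2_norm M h)\<^sup>2"
    unfolding L2_norm_add_power2[OF g h] by (simp add: power2_sum mult_ac)
qed simp

lemma L2_parallelogram:
  assumes g: "g \<in> L2_functions M" and h: "h \<in> L2_functions M"
  shows "(L2_norm M (\<lambda>x. g x - h x))\<^sup>2 + (L2_norm M (\<lambda>x. g x + h x))\<^sup>2 = 2 * (L2_norm M g)\<^sup>2 + 2 * (L2_norm M h)\<^sup>2"
  using L2_norm_add_power2[OF g h] L2_norm_add_power2[OF g L2_functions_cmult[OF h, of "-1"]]
    L2_norm_cmult[of M "-1" h] by simp

text \<open>
  For an exact minimizer of the norm on the line \<open>p + t * g\<close> this says that \<open>g\<close> is orthogonal to \<open>p\<close>.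
  The quantitative form replaces the minimizer, which need not exist in an incomplete space, by an
  approximate one.
\<close>

lemma near_minimizer_almost_orthogonal:
  assumes p: "p \<in> L2_functions M" and g: "g \<in> L2_functions M"
    and min: "\<And>t. d\<^sup>2 \<le> (L2_norm M (\<lambda>x. p x + t * g x))\<^sup>2"
  shows "(cmod (LINT x|M. g x * cnj (p x)))\<^sup>2 \<le> ((L2_norm M p)\<^sup>2 - d\<^sup>2) * (L2_norm M g)\<^sup>2"
proof -
  define I where "I = (LINT x|M. g x * cnj (p x))"
  have q: "0 \<le> s\<^sup>2 * ((cmod I)\<^sup>2 * (L2_norm M g)\<^sup>2) - 2 * s * (cmod I)\<^sup>2 + ((L2_norm M p)\<^sup>2 - d\<^sup>2)" for s :: real
  proof -
    define t where "t = - complex_of_real s * cnj I"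
    have eq: "(LINT x|M. t * g x * cnj (p x)) = t * I"
      by (simp add: I_def mult.assoc)
    have "Re (t * I) = - s * (cmod I)\<^sup>2"
      unfolding t_def cmod_power2 by (simp add: power2_eq_square algebra_simps)
    moreover have "(cmod t)\<^sup>2 = s\<^sup>2 * (cmod I)\<^sup>2" by (simp add: t_def norm_mult power_mult_distrib)
    moreover have "d\<^sup>2 \<le> (L2_norm M p)\<^sup>2 + 2 * Re (t * I) + (cmod t * L2_norm M g)\<^sup>2"
      using min[of t] unfolding L2_norm_add_power2[OF p L2_functions_cmult[OF g]] L2_norm_cmult eq .
    ultimately show ?thesis
      by (simp add: power_mult_distrib mult.assoc del: times_complex.sel)
  qed
  have "((cmod I)\<^sup>2)\<^sup>2 \<le> (cmod I)\<^sup>2 * (L2_norm M g)\<^sup>2 * ((L2_norm M p)\<^sup>2 - d\<^sup>2)"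
    by (rule quadratic_nonneg_imp_discriminant[OF _ q]) simp
  then have "(cmod I)\<^sup>2 * (cmod I)\<^sup>2 \<le> (cmod I)\<^sup>2 * (((L2_norm M p)\<^sup>2 - d\<^sup>2) * (L2_norm M g)\<^sup>2)"
    by (simp add: power2_eq_square mult_ac)
  moreover have "0 \<le> ((L2_norm M p)\<^sup>2 - d\<^sup>2) * (L2_norm M g)\<^sup>2"
    using min[of 0] by simp
  ultimately have "(cmod I)\<^sup>2 \<le> ((L2_norm M p)\<^sup>2 - d\<^sup>2) * (L2_norm M g)\<^sup>2"
    by (cases "I = 0", simp, blast intro: mult_left_le_imp_le[of "(cmod I)\<^sup>2"] zero_less_power zero_less_norm_iff[THEN iffD2])
  then show ?thesis by (simp add: I_def)
qed

section \<open>Density when point evaluation is unbounded\<close>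

text \<open>
  The properties on which the argument about point evaluations rests, as in the theory of de Branges spaces:
  zeros can be divided out, and the space is invariant under multiplication by \<open>z\<close> and under reflection
  in the real axis.
\<close>

locale division_space =
  fixes E :: "(complex \<Rightarrow> complex) set" and M :: "real measure"
  assumes sets_M: "sets M = sets borel"
    and add: "F \<in> E \<Longrightarrow> G \<in> E \<Longrightarrow> (\<lambda>z. F z + G z) \<in> E"
    and cmult: "F \<in> E \<Longrightarrow> (\<lambda>z. c * F z) \<in> E"
    and mult_ident: "F \<in> E \<Longrightarrow> (\<lambda>z. z * F z) \<in> E"
    and divide: "F \<in> E \<Longrightarrow> F w = 0 \<Longrightarrow> \<exists>G\<in>E. \<forall>z. F z = (z - w) * G z"
    and cnj: "F \<in> E \<Longrightarrow> (\<lambda>z. cnj (F (cnj z))) \<in> E"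
    and entire: "F \<in> E \<Longrightarrow> F holomorphic_on UNIV"
    and square_integrable: "F \<in> E \<Longrightarrow> (\<lambda>x. F (of_real x)) \<in> L2_functions M"
begin

abbreviation norm_E :: "(complex \<Rightarrow> complex) \<Rightarrow> real" where
  "norm_E F \<equiv> L2_norm M (\<lambda>x. F (of_real x))"

lemma diff: "F \<in> E \<Longrightarrow> G \<in> E \<Longrightarrow> (\<lambda>z. F z - G z) \<in> E"
  using add[of F "\<lambda>z. - 1 * G z"] cmult[of G "-1"] by simp

lemma mult_linear:
  assumes "F \<in> E"
  shows "(\<lambda>z. (z - w) * F z) \<in> E"
proof -
  have "(\<lambda>z. z * F z - w * F z) \<in> E" by (intro diff mult_ident cmult assms)
  then show ?thesis by (simp add: left_diff_distrib)
qed

lemma norm_E_reflect: "norm_E (\<lambda>z. cnj (F (cnj z))) = norm_E F"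
  by (simp add: L2_norm_def)

definition closure_E :: "(real \<Rightarrow> complex) set" where
  "closure_E = {g \<in> L2_functions M. \<forall>\<epsilon>>0. \<exists>F\<in>E. L2_norm M (\<lambda>x. g x - F (of_real x)) < \<epsilon>}"

lemma closure_E_L2: "g \<in> closure_E \<Longrightarrow> g \<in> L2_functions M"
  by (simp add: closure_E_def)

lemma closure_E_approx:
  assumes "g \<in> closure_E" "\<epsilon> > 0"
  shows "\<exists>F\<in>E. L2_norm M (\<lambda>x. g x - F (of_real x)) < \<epsilon>"
  using assms by (simp add: closure_E_def)

lemma subset_closure_E: "F \<in> E \<Longrightarrow> (\<lambda>x. F (of_real x)) \<in> closure_E"
  by (auto simp: closure_E_def square_integrable L2_norm_def intro!: bexI[of _ F])

lemma closure_E_limit: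
  assumes g: "g \<in> L2_functions M" and lim: "\<And>\<epsilon>. \<epsilon> > 0 \<Longrightarrow> \<exists>h\<in>closure_E. L2_norm M (\<lambda>x. g x - h x) < \<epsilon>"
  shows "g \<in> closure_E"
proof -
  have "\<exists>F\<in>E. L2_norm M (\<lambda>x. g x - F (of_real x)) < \<epsilon>" if "\<epsilon> > 0" for \<epsilon>
  proof -
    have half: "\<epsilon> / 2 > 0" using that by simp
    obtain h where h: "h \<in> closure_E" "L2_norm M (\<lambda>x. g x - h x) < \<epsilon> / 2"
      using lim[OF half] by blast
    obtain F where F: "F \<in> E" "L2_norm M (\<lambda>x. h x - F (of_real x)) < \<epsilon> / 2"
      using closure_E_approx[OF h(1) half] by blast
    have "L2_norm M (\<lambda>x. (g x - h x) + (h x - F (of_real x))) \<le>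
        L2_norm M (\<lambda>x. g x - h x) + L2_norm M (\<lambda>x. h x - F (of_real x))"
      by (intro L2_norm_triangle L2_functions_diff g closure_E_L2[OF h(1)] square_integrable F(1))
    then show ?thesis using h(2) F by (intro bexI[of _ F]) auto
  qed
  with g show ?thesis by (simp add: closure_E_def)
qed

lemma closure_E_add:
  assumes g: "g \<in> closure_E" and h: "h \<in> closure_E"
  shows "(\<lambda>x. g x + h x) \<in> closure_E"
proof -
  have "\<exists>F\<in>E. L2_norm M (\<lambda>x. g x + h x - F (of_real x)) < \<epsilon>" if "\<epsilon> > 0" for \<epsilon>
  proof -
    have half: "\<epsilon> / 2 > 0" using that by simp
    obtain F where F: "F \<in> E" "L2_norm M (\<lambda>x. g x - F (of_real x)) < \<epsilon> / 2"
      using closure_E_approx[OF g half] by blast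
    obtain G where G: "G \<in> E" "L2_norm M (\<lambda>x. h x - G (of_real x)) < \<epsilon> / 2"
      using closure_E_approx[OF h half] by blast
    have "L2_norm M (\<lambda>x. (g x - F (of_real x)) + (h x - G (of_real x))) \<le>
        L2_norm M (\<lambda>x. g x - F (of_real x)) + L2_norm M (\<lambda>x. h x - G (of_real x))"
      by (intro L2_norm_triangle L2_functions_diff closure_E_L2[OF g] closure_E_L2[OF h] square_integrable F(1) G(1))
    also have "\<dots> < \<epsilon>" using F G by simp
    also have "(\<lambda>x. (g x - F (of_real x)) + (h x - G (of_real x))) = (\<lambda>x. g x + h x - (F (of_real x) + G (of_real x)))"
      by (simp add: fun_eq_iff)
    finally show ?thesis using add[OF F(1) G(1)] by (intro bexI[of _ "\<lambda>z. F z + G z"])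
  qed
  then show ?thesis by (simp add: closure_E_def L2_functions_add closure_E_L2[OF g] closure_E_L2[OF h])
qed

lemma closure_E_cmult:
  assumes g: "g \<in> closure_E"
  shows "(\<lambda>x. c * g x) \<in> closure_E"
proof -
  have "\<exists>F\<in>E. L2_norm M (\<lambda>x. c * g x - F (of_real x)) < \<epsilon>" if "\<epsilon> > 0" for \<epsilon>
  proof -
    have \<eta>: "\<epsilon> / (cmod c + 1) > 0" using that by (simp add: add_nonneg_pos)
    obtain F where F: "F \<in> E" "L2_norm M (\<lambda>x. g x - F (of_real x)) < \<epsilon> / (cmod c + 1)"
      using closure_E_approx[OF g \<eta>] by blast
    have "0 \<le> L2_norm M (\<lambda>x. g x - F (of_real x))" by simp
    then have "cmod c * L2_norm M (\<lambda>x. g x - F (of_real x)) \<le> (cmod c + 1) * L2_norm M (\<lambda>x. g x - F (of_real x))"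
      by (intro mult_right_mono) auto
    also have "\<dots> < \<epsilon>" using F(2) by (simp add: pos_less_divide_eq add_nonneg_pos mult.commute)
    finally have "L2_norm M (\<lambda>x. c * (g x - F (of_real x))) < \<epsilon>" by (simp only: L2_norm_cmult)
    then show ?thesis using cmult[OF F(1), of c]
      by (intro bexI[of _ "\<lambda>z. c * F z"]) (simp_all add: right_diff_distrib)
  qed
  then show ?thesis by (simp add: closure_E_def L2_functions_cmult closure_E_L2[OF g])
qed

text \<open>
  Pointwise convergence with a square-integrable bound is convergence in \<open>L\<^sup>2\<close>.
\<close>

lemma closure_E_dominated_limit:
  assumes h: "\<And>n::nat. h n \<in> closure_E" and g: "g \<in> L2_functions M" and G: "G \<in> L2_functions M"
    and bound: "\<And>n x. cmod (g x - h n x) \<le> C * cmod (G x)" and lim: "\<And>x. (\<lambda>n. h n x) \<longlonglongrightarrow> g x"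
  shows "g \<in> closure_E"
proof (rule closure_E_limit[OF g])
  have [measurable]: "g \<in> borel_measurable M" by (rule L2_functionsD(1)[OF g])
  have [measurable]: "h n \<in> borel_measurable M" for n by (rule L2_functionsD(1)[OF closure_E_L2[OF h]])
  have "(\<lambda>n. LINT x|M. (cmod (g x - h n x))\<^sup>2) \<longlonglongrightarrow> (LINT x|M. 0)"
  proof (rule integral_dominated_convergence)
    show "integrable M (\<lambda>x. C\<^sup>2 * (cmod (G x))\<^sup>2)"
      by (intro integrable_mult_right L2_functionsD(2)[OF G])
    show "AE x in M. (\<lambda>n. (cmod (g x - h n x))\<^sup>2) \<longlonglongrightarrow> 0"
    proof (rule AE_I2)
      fix x
      have "(\<lambda>n. (cmod (g x - h n x))\<^sup>2) \<longlonglongrightarrow> (cmod (g x - g x))\<^sup>2"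
        by (intro tendsto_intros lim)
      then show "(\<lambda>n. (cmod (g x - h n x))\<^sup>2) \<longlonglongrightarrow> 0" by simp
    qed
    show "AE x in M. norm ((cmod (g x - h n x))\<^sup>2) \<le> C\<^sup>2 * (cmod (G x))\<^sup>2" for n
    proof (rule AE_I2)
      fix x
      have "(cmod (g x - h n x))\<^sup>2 \<le> (C * cmod (G x))\<^sup>2" by (intro power_mono bound) auto
      then show "norm ((cmod (g x - h n x))\<^sup>2) \<le> C\<^sup>2 * (cmod (G x))\<^sup>2"
        by (simp add: power_mult_distrib)
    qed
  qed measurable
  then have "(\<lambda>n. L2_norm M (\<lambda>x. g x - h n x)) \<longlonglongrightarrow> sqrt 0"
    unfolding L2_norm_def by (intro tendsto_real_sqrt) simp
  then have conv: "(\<lambda>n. L2_norm M (\<lambda>x. g x - h n x)) \<longlonglongrightarrow> 0" by simp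
  fix \<epsilon> :: real assume "\<epsilon> > 0"
  with conv have "\<forall>\<^sub>F n in sequentially. L2_norm M (\<lambda>x. g x - h n x) < \<epsilon>"
    by (rule order_tendstoD(2))
  then obtain n where "L2_norm M (\<lambda>x. g x - h n x) < \<epsilon>"
    by (auto simp: eventually_sequentially)
  then show "\<exists>h\<in>closure_E. L2_norm M (\<lambda>x. g x - h x) < \<epsilon>"
    using h by blast
qed

definition multiplier :: "(real \<Rightarrow> complex) \<Rightarrow> bool" where
  "multiplier \<phi> \<longleftrightarrow> \<phi> \<in> borel_measurable borel \<and> (\<forall>g\<in>closure_E. (\<lambda>x. \<phi> x * g x) \<in> closure_E)"

lemma multiplierD: "multiplier \<phi> \<Longrightarrow> \<phi> \<in> borel_measurable borel"
  "multiplier \<phi> \<Longrightarrow> g \<in> closure_E \<Longrightarrow> (\<lambda>x. \<phi> x * g x) \<in> closure_E"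
  by (auto simp: multiplier_def)

lemma multiplier_const: "multiplier (\<lambda>x. c)"
  by (simp add: multiplier_def closure_E_cmult)

lemma multiplier_add: "multiplier \<phi> \<Longrightarrow> multiplier \<psi> \<Longrightarrow> multiplier (\<lambda>x. \<phi> x + \<psi> x)"
  by (auto simp: multiplier_def distrib_right intro!: closure_E_add)

lemma multiplier_mult: "multiplier \<phi> \<Longrightarrow> multiplier \<psi> \<Longrightarrow> multiplier (\<lambda>x. \<phi> x * \<psi> x)"
  by (auto simp: multiplier_def mult.assoc)

lemma bounded_multiplication_L2:
  assumes "g \<in> L2_functions M" "\<phi> \<in> borel_measurable borel" "\<And>x. cmod (\<phi> x) \<le> C"
  shows "(\<lambda>x. \<phi> x * g x) \<in> L2_functions M" and "L2_norm M (\<lambda>x. \<phi> x * g x) \<le> C * L2_norm M g"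
proof -
  have [measurable]: "g \<in> borel_measurable borel"
    using L2_functionsD(1)[OF assms(1)] by (simp add: measurable_cong_sets[OF sets_M refl])
  have m: "(\<lambda>x. \<phi> x * g x) \<in> borel_measurable M"
    using assms(2) by (simp add: measurable_cong_sets[OF sets_M refl])
  have le: "cmod (\<phi> x * g x) \<le> C * cmod (g x)" for x
    using assms(3)[of x] by (simp add: norm_mult mult_right_mono)
  have "0 \<le> cmod (\<phi> 0)" by simp
  then have "0 \<le> C" using assms(3)[of 0] by linarith
  then show "(\<lambda>x. \<phi> x * g x) \<in> L2_functions M" "L2_norm M (\<lambda>x. \<phi> x * g x) \<le> C * L2_norm M g"
    using L2_functions_dominated[OF assms(1) m le] L2_norm_dominated[OF assms(1) m le] by auto
qed

text \<open>
  Together with the algebraic rules above, closure under bounded pointwise limits lets the class of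
  multipliers grow from one function to all bounded Borel functions.
\<close>

lemma multiplier_limit:
  assumes mult: "\<And>n::nat. multiplier (\<phi> n)" and bound: "\<And>n x. cmod (\<phi> n x) \<le> C"
    and lim: "\<And>x. (\<lambda>n. \<phi> n x) \<longlonglongrightarrow> \<psi> x"
  shows "multiplier \<psi>"
  unfolding multiplier_def
proof (intro conjI ballI)
  have m [measurable]: "\<phi> n \<in> borel_measurable borel" for n by (rule multiplierD(1)[OF mult])
  show psi [measurable]: "\<psi> \<in> borel_measurable borel"
    by (rule borel_measurable_LIMSEQ_metric[OF m lim])
  have b\<psi>: "cmod (\<psi> x) \<le> C" for x
    by (rule LIMSEQ_le_const2[OF tendsto_norm[OF lim]]) (use bound in auto)
  fix g assume g: "g \<in> closure_E"
  show "(\<lambda>x. \<psi> x * g x) \<in> closure_E"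
  proof (rule closure_E_dominated_limit[where h = "\<lambda>n x. \<phi> n x * g x" and C = "2 * C"])
    show "(\<lambda>x. \<phi> n x * g x) \<in> closure_E" for n by (rule multiplierD(2)[OF mult g])
    show "g \<in> L2_functions M" by (rule closure_E_L2[OF g])
    then show "(\<lambda>x. \<psi> x * g x) \<in> L2_functions M" by (rule bounded_multiplication_L2(1)[OF _ psi b\<psi>])
    show "(\<lambda>n. \<phi> n x * g x) \<longlonglongrightarrow> \<psi> x * g x" for x by (intro tendsto_intros lim)
    fix n x
    have "cmod (\<psi> x - \<phi> n x) \<le> 2 * C"
      using norm_triangle_ineq4[of "\<psi> x" "\<phi> n x"] b\<psi>[of x] bound[of n x] by linarith
    then show "cmod (\<psi> x * g x - \<phi> n x * g x) \<le> 2 * C * cmod (g x)"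
      unfolding left_diff_distrib[symmetric] norm_mult by (rule mult_right_mono) simp
  qed
qed

text \<open>
  If evaluation at \<open>w\<close> is unbounded, then an \<open>F\<close> in the space may be changed by a function of small norm so
  as to vanish at \<open>w\<close>. After that it can be divided by \<open>z - w\<close> without leaving the space.
\<close>

lemma multiplier_resolvent:
  assumes small: "\<And>\<epsilon>. \<epsilon> > 0 \<Longrightarrow> \<exists>G\<in>E. G w = 1 \<and> norm_E G < \<epsilon>" and w: "\<bar>Im w\<bar> = 1"
  shows "multiplier (\<lambda>x. 1 / (of_real x - w))"
  unfolding multiplier_def
proof (intro conjI ballI)
  have ne: "of_real x - w \<noteq> 0" for x using w by (auto simp: complex_eq_iff)
  have "continuous_on UNIV (\<lambda>x. 1 / (complex_of_real x - w))"
    using ne by (intro continuous_intros) auto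
  then show m: "(\<lambda>x. 1 / (complex_of_real x - w)) \<in> borel_measurable borel"
    by (rule borel_measurable_continuous_onI)
  have ge: "1 \<le> cmod (of_real x - w)" for x
    using abs_Im_le_cmod[of "of_real x - w"] w by simp
  then have le: "cmod (1 / (of_real x - w)) \<le> 1" for x
    by (simp add: norm_divide divide_le_eq_1)
  fix g assume g: "g \<in> closure_E"
  show "(\<lambda>x. 1 / (of_real x - w) * g x) \<in> closure_E"
  proof (rule closure_E_limit)
    show "(\<lambda>x. 1 / (of_real x - w) * g x) \<in> L2_functions M"
      by (rule bounded_multiplication_L2(1)[OF closure_E_L2[OF g] m le])
    fix \<epsilon> :: real assume \<epsilon>: "\<epsilon> > 0"
    then have half: "\<epsilon> / 2 > 0" by simp
    obtain F where F: "F \<in> E" "L2_norm M (\<lambda>x. g x - F (of_real x)) < \<epsilon> / 2"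
      using closure_E_approx[OF g half] by blast
    define K where "K = cmod (F w) + 1"
    have K: "K > 0" "cmod (F w) \<le> K" by (simp_all add: K_def add_nonneg_pos)
    define \<eta> where "\<eta> = \<epsilon> / (2 * K)"
    have \<eta>: "\<eta> > 0" using \<epsilon> K by (simp add: \<eta>_def)
    obtain G where G: "G \<in> E" "G w = 1" "norm_E G < \<eta>" using small[OF \<eta>] by blast
    have "(\<lambda>z. F z - F w * G z) \<in> E" by (intro diff cmult F G)
    moreover have "F w - F w * G w = 0" using G by simp
    ultimately obtain H where H: "H \<in> E" "\<And>z. F z - F w * G z = (z - w) * H z"
      using divide[of "\<lambda>z. F z - F w * G z" w] by auto
    have H': "H (of_real x) = 1 / (of_real x - w) * (F (of_real x) - F w * G (of_real x))" for x
      using ne by (simp add: H(2))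
    have e: "1 / (of_real x - w) * g x - H (of_real x) =
        1 / (of_real x - w) * ((g x - F (of_real x)) + F w * G (of_real x))" for x
      unfolding H' by (simp only: right_diff_distrib distrib_left) simp
    have L: "(\<lambda>x. g x - F (of_real x)) \<in> L2_functions M" "(\<lambda>x. F w * G (of_real x)) \<in> L2_functions M"
      by (intro L2_functions_diff L2_functions_cmult closure_E_L2[OF g] square_integrable F G)+
    have "L2_norm M (\<lambda>x. 1 / (of_real x - w) * g x - H (of_real x)) \<le>
        1 * L2_norm M (\<lambda>x. (g x - F (of_real x)) + F w * G (of_real x))"
      unfolding e by (rule bounded_multiplication_L2(2)[OF L2_functions_add[OF L] m le])
    also have "\<dots> \<le> L2_norm M (\<lambda>x. g x - F (of_real x)) + cmod (F w) * norm_E G"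
      using L2_norm_triangle[OF L] by (simp add: L2_norm_cmult)
    also have "cmod (F w) * norm_E G \<le> K * \<eta>"
      using G K by (intro mult_mono) auto
    also have "K * \<eta> = \<epsilon> / 2"
      using K by (simp add: \<eta>_def)
    finally have "L2_norm M (\<lambda>x. 1 / (of_real x - w) * g x - H (of_real x)) < \<epsilon>" using F(2) by simp
    then show "\<exists>h\<in>closure_E. L2_norm M (\<lambda>x. 1 / (of_real x - w) * g x - h x) < \<epsilon>"
      using subset_closure_E[OF H(1)] by (intro bexI[of _ "\<lambda>x. H (of_real x)"])
  qed
qed

definition cayley :: "real \<Rightarrow> complex" where
  "cayley x = (of_real x - \<i>) / (of_real x + \<i>)"

lemma x_plus_i_nonzero: "of_real x + \<i> \<noteq> 0" "of_real x - \<i> \<noteq> 0"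
  by (auto simp: complex_eq_iff)

lemma cayley_sphere: "cayley x \<in> sphere 0 1"
proof -
  have "cmod (of_real x - \<i>) = cmod (of_real x + \<i>)"
    by (simp add: cmod_def)
  then show ?thesis using x_plus_i_nonzero[of x] by (simp add: cayley_def norm_divide)
qed

context
  assumes small: "\<And>\<epsilon>. \<epsilon> > 0 \<Longrightarrow> \<exists>G\<in>E. G \<i> = 1 \<and> norm_E G < \<epsilon>"
begin

text \<open>
  On the real line \<open>(x - \<i>) / (x + \<i>)\<close> and its conjugate are affine functions of the resolvents \<open>1 / (x + \<i>)\<close>
  and \<open>1 / (x - \<i>)\<close>. Evaluation at \<open>-\<i>\<close> is unbounded along with that at \<open>\<i>\<close>, by reflection.
\<close>

lemma multiplier_cayley: "multiplier cayley" "multiplier (\<lambda>x. cnj (cayley x))"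
proof -
  have small': "\<exists>G\<in>E. G (- \<i>) = 1 \<and> norm_E G < \<epsilon>" if e: "\<epsilon> > 0" for \<epsilon>
  proof -
    obtain G where "G \<in> E" "G \<i> = 1" "norm_E G < \<epsilon>" using small[OF e] by blast
    then show ?thesis
      using cnj[of G] norm_E_reflect[of G] by (intro bexI[of _ "\<lambda>z. cnj (G (cnj z))"]) auto
  qed
  have "multiplier (\<lambda>x. 1 / (of_real x - (- \<i>)))" "multiplier (\<lambda>x. 1 / (of_real x - \<i>))"
    by (intro multiplier_resolvent small small'; simp)+
  then have "multiplier (\<lambda>x. 1 + - 2 * \<i> * (1 / (of_real x - (- \<i>))))"
    and "multiplier (\<lambda>x. 1 + 2 * \<i> * (1 / (of_real x - \<i>)))"
    using multiplier_add[OF multiplier_const[of 1] multiplier_mult[OF multiplier_const]] by blast+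
  moreover have "1 + - 2 * \<i> * (1 / (of_real x - (- \<i>))) = cayley x" for x
    using x_plus_i_nonzero[of x] by (simp add: cayley_def field_simps)
  moreover have "1 + 2 * \<i> * (1 / (of_real x - \<i>)) = cnj (cayley x)" for x
    using x_plus_i_nonzero[of x] by (simp add: cayley_def field_simps)
  ultimately show "multiplier cayley" "multiplier (\<lambda>x. cnj (cayley x))" by simp_all
qed

lemma multiplier_polynomial:
  "real_polynomial_function p \<Longrightarrow> multiplier (\<lambda>x. of_real (p (cayley x)))"
proof (induction rule: real_polynomial_function.induct)
  case (linear f)
  have f: "f u = Re u * f 1 + Im u * f \<i>" for u
  proof -
    have "u = Re u *\<^sub>R 1 + Im u *\<^sub>R \<i>" by (simp add: complex_eq_iff)
    then have "f u = f (Re u *\<^sub>R 1 + Im u *\<^sub>R \<i>)" by simp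
    also have "\<dots> = Re u * f 1 + Im u * f \<i>"
      by (simp only: linear_add[OF bounded_linear.linear[OF linear]]
          linear_scale[OF bounded_linear.linear[OF linear]] real_scaleR_def)
    finally show ?thesis .
  qed
  have "multiplier (\<lambda>x. (1/2) * (cayley x + cnj (cayley x)) * of_real (f 1) +
      (- \<i> / 2) * (cayley x + (- 1) * cnj (cayley x)) * of_real (f \<i>))"
    by (intro multiplier_add multiplier_mult multiplier_const multiplier_cayley)
  moreover have "(1/2) * (u + cnj u) * of_real (f 1) + (- \<i> / 2) * (u + (- 1) * cnj u) * of_real (f \<i>)
      = of_real (f u)" for u
    by (subst f[of u]) (simp add: complex_eq_iff)
  ultimately show ?case by simp
next
  case (const c)
  show ?case by (rule multiplier_const)
next
  case (add f g)
  then show ?case using multiplier_add by simp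
next
  case (mult f g)
  then show ?case using multiplier_mult by simp
qed

text \<open>
  The Cayley transform maps the line into the unit circle, which is compact, so the Weierstrass theorem
  applies with polynomials in the real and imaginary part.
\<close>

lemma multiplier_continuous:
  assumes f: "continuous_on UNIV (f :: complex \<Rightarrow> real)"
  shows "multiplier (\<lambda>x. of_real (f (cayley x)))"
proof -
  have comp: "compact (sphere (0::complex) 1)" by simp
  have fs: "continuous_on (sphere 0 1) f" using f by (rule continuous_on_subset) simp
  have "\<exists>g. real_polynomial_function g \<and> (\<forall>u\<in>sphere 0 1. \<bar>f u - g u\<bar> < 1 / Suc n)" for n
    using Stone_Weierstrass_real_polynomial_function[OF comp fs, of "1 / Suc n"] by (metis of_nat_0_less_iff zero_less_Suc zero_less_divide_1_iff)
  then obtain g where g: "\<And>n. real_polynomial_function (g n)" "\<And>n u. u \<in> sphere 0 1 \<Longrightarrow> \<bar>f u - g n u\<bar> < 1 / Suc n"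
    by metis
  have "bounded (f ` sphere 0 1)" by (intro compact_imp_bounded compact_continuous_image fs comp)
  then obtain C where "\<forall>y\<in>f ` sphere 0 1. norm y \<le> C" unfolding bounded_iff ..
  then have C: "\<bar>f u\<bar> \<le> C" if "u \<in> sphere 0 1" for u
    using that by (metis image_eqI real_norm_def)
  show ?thesis
  proof (rule multiplier_limit[where C = "C + 1"])
    show "multiplier (\<lambda>x. of_real (g n (cayley x)))" for n by (rule multiplier_polynomial[OF g(1)])
    show "cmod (of_real (g n (cayley x))) \<le> C + 1" for n x
    proof -
      have "1 / real (Suc n) \<le> 1" by (simp add: divide_le_eq_1)
      then show ?thesis using g(2)[OF cayley_sphere, of x n] C[OF cayley_sphere, of x] unfolding norm_of_real by linarith
    qed
    show "(\<lambda>n. complex_of_real (g n (cayley x))) \<longlonglongrightarrow> of_real (f (cayley x))" for x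
    proof (rule tendsto_of_real)
      have "(\<lambda>n. g n (cayley x) - f (cayley x)) \<longlonglongrightarrow> 0"
      proof (rule Lim_null_comparison)
        show "\<forall>\<^sub>F n in sequentially. norm (g n (cayley x) - f (cayley x)) \<le> 1 / real (Suc n)"
          using g(2)[OF cayley_sphere, of x] by (intro always_eventually allI) (simp add: abs_minus_commute less_imp_le)
        show "(\<lambda>n. 1 / real (Suc n)) \<longlonglongrightarrow> 0" by (rule LIMSEQ_Suc[OF lim_1_over_n])
      qed
      then show "(\<lambda>n. g n (cayley x)) \<longlonglongrightarrow> f (cayley x)" by (simp add: LIM_zero_iff)
    qed
  qed
qed

lemma multiplier_indicator_closed:
  assumes B: "closed B"
  shows "multiplier (\<lambda>x. indicator B (cayley x))"
proof (cases "B = {}")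
  case True
  then show ?thesis using multiplier_const[of 0] by simp
next
  case False
  define f where "f n u = max 0 (1 - real n * infdist u B)" for n and u :: complex
  show ?thesis
  proof (rule multiplier_limit[where C = 1])
    show "multiplier (\<lambda>x. of_real (f n (cayley x)))" for n
      unfolding f_def by (intro multiplier_continuous continuous_intros)
    show "cmod (of_real (f n (cayley x))) \<le> 1" for n x
      using infdist_nonneg[of "cayley x" B] by (auto simp: f_def)
    show "(\<lambda>n. complex_of_real (f n (cayley x))) \<longlonglongrightarrow> indicator B (cayley x)" for x
    proof (cases "cayley x \<in> B")
      case True
      then show ?thesis by (simp add: f_def)
    next
      case F: False
      then have pos: "infdist (cayley x) B > 0"
        using in_closed_iff_infdist_zero[OF B False, of "cayley x"] infdist_nonneg[of "cayley x" B] by linarith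
      obtain N :: nat where "1 / infdist (cayley x) B < N" using reals_Archimedean2 by blast
      then have N: "1 < N * infdist (cayley x) B" using pos by (simp add: field_simps)
      have "complex_of_real (f n (cayley x)) = 0" if "N \<le> n" for n
      proof -
        have "N * infdist (cayley x) B \<le> n * infdist (cayley x) B" using that pos by (intro mult_right_mono) auto
        then show ?thesis using N by (simp add: f_def)
      qed
      then have "\<forall>\<^sub>F n in sequentially. complex_of_real (f n (cayley x)) = 0"
        unfolding eventually_sequentially by blast
      then show ?thesis using F by (simp add: tendsto_eventually)
    qed
  qed
qed

text \<open>
  Closed sets generate the Borel sets and are stable under intersection, so it suffices that
  the sets whose indicator is a multiplier are closed under complement and disjoint union.
\<close>

lemma multiplier_indicator_preimage:
  assumes "B \<in> sets borel"
  shows "multiplier (\<lambda>x. indicator B (cayley x))"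
proof -
  have "B \<in> sigma_sets UNIV (Collect closed)"
    using assms unfolding borel_eq_closed by (subst (asm) sets_measure_of) auto
  have int: "Int_stable (Collect (closed :: complex set \<Rightarrow> bool))" and sub: "Collect closed \<subseteq> Pow (UNIV :: complex set)"
    by (auto simp: Int_stable_def)
  from int sub \<open>B \<in> sigma_sets UNIV (Collect closed)\<close> show ?thesis
  proof (induction rule: sigma_sets_induct_disjoint)
    case (basic A)
    then show ?case by (intro multiplier_indicator_closed) simp
  next
    case empty
    show ?case using multiplier_const[of 0] by simp
  next
    case (compl A)
    have "multiplier (\<lambda>x. 1 + (- 1) * indicator A (cayley x))"
      by (intro multiplier_add multiplier_mult multiplier_const compl)
    moreover have "1 + (- 1) * indicator A u = (indicator (UNIV - A) u :: complex)" for u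
      by (simp add: indicator_def)
    ultimately show ?case by simp
  next
    case (union A)
    have fin: "multiplier (\<lambda>x. \<Sum>i<n. indicator (A i) (cayley x))" for n
      by (induction n) (use multiplier_const[of 0] multiplier_add union in auto)
    have s: "(\<Sum>i<n. indicator (A i) u) = (indicator (\<Union>i<n. A i) u :: complex)" for n u
    proof -
      have "disjoint_family_on A {..<n}"
        using union(1) by (auto simp: disjoint_family_on_def)
      then show ?thesis by (intro indicator_UN_disjoint[symmetric]) auto
    qed
    show ?case
    proof (rule multiplier_limit[where C = 1])
      show "multiplier (\<lambda>x. indicator (\<Union>i<n. A i) (cayley x))" for n
        using fin[of n] unfolding s .
      show "cmod (indicator (\<Union>i<n. A i) (cayley x)) \<le> 1" for n x
        by (simp add: indicator_def)
      show "(\<lambda>n. indicator (\<Union>i<n. A i) (cayley x) :: complex) \<longlonglongrightarrow> indicator (\<Union>i. A i) (cayley x)" for x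
        by (rule LIMSEQ_indicator_UN)
    qed
  qed
qed

text \<open>
  The Cayley transform has a Borel left inverse, so every Borel subset of the line is a preimage under it.
\<close>

lemma multiplier_indicator:
  assumes A: "A \<in> sets borel"
  shows "multiplier (indicator A)"
proof -
  define v where "v u = Re (\<i> * (1 + u) / (1 - u))" for u
  have v: "v (cayley x) = x" for x
  proof -
    have "1 + cayley x = 2 * of_real x / (of_real x + \<i>)" "1 - cayley x = 2 * \<i> / (of_real x + \<i>)"
      using x_plus_i_nonzero[of x] by (simp_all add: cayley_def field_simps)
    then have "\<i> * (1 + cayley x) / (1 - cayley x) = of_real x"
      using x_plus_i_nonzero[of x] by simp
    then show ?thesis by (simp add: v_def)
  qed
  have "v \<in> borel_measurable borel" unfolding v_def by measurable
  then have "v -` A \<in> sets borel" using A measurable_sets[of v borel borel A] by simp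
  then have "multiplier (\<lambda>x. indicator (v -` A) (cayley x))" by (rule multiplier_indicator_preimage)
  moreover have "indicator (v -` A) (cayley x) = (indicator A x :: complex)" for x
    by (simp add: indicator_def v)
  ultimately show ?thesis by simp
qed

lemma multiplier_bounded_measurable:
  assumes \<phi>: "\<phi> \<in> borel_measurable borel" and C: "\<And>x. cmod (\<phi> x) \<le> C"
  shows "multiplier \<phi>"
proof -
  obtain s where s: "\<And>i. simple_function borel (s i)" "\<And>x. (\<lambda>i. s i x) \<longlonglongrightarrow> \<phi> x"
    "\<And>i x. dist (s i x) 0 \<le> 2 * dist (\<phi> x) 0"
    using borel_measurable_implies_sequence_metric[OF \<phi>, of 0] by auto
  show ?thesis
  proof (rule multiplier_limit[where C = "2 * C"])
    show "multiplier (s i)" for i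
    proof -
      have fin: "finite (range (s i))" using simple_functionD(1)[OF s(1)[of i]] by simp
      have eq: "s i x = (\<Sum>c\<in>range (s i). c * indicator (s i -` {c}) x)" for x
      proof -
        have "(\<Sum>c\<in>range (s i). c * indicator (s i -` {c}) x) = (\<Sum>c\<in>range (s i). if s i x = c then c else 0)"
          by (intro sum.cong) (auto simp: indicator_def)
        also have "\<dots> = s i x" using fin by (simp add: sum.delta')
        finally show ?thesis ..
      qed
      have "multiplier (\<lambda>x. \<Sum>c\<in>A. c * indicator (s i -` {c}) x)" if "finite A" for A
        using that
      proof (induction A rule: finite_induct)
        case empty
        then show ?case using multiplier_const[of 0] by simp
      next
        case (insert c A)
        have "s i -` {c} \<in> sets borel" using simple_functionD(2)[OF s(1)[of i], of "{c}"] by simp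
        then have "multiplier (\<lambda>x. c * indicator (s i -` {c}) x + (\<Sum>c\<in>A. c * indicator (s i -` {c}) x))"
          by (intro multiplier_add multiplier_mult multiplier_const multiplier_indicator insert.IH)
        then show ?case unfolding sum.insert[OF insert.hyps] .
      qed
      from this[OF fin] show ?thesis by (simp flip: eq)
    qed
    show "cmod (s i x) \<le> 2 * C" for i x
      using s(3)[of i x] C[of x] by simp
  qed (rule s(2))
qed

text \<open>
  With all bounded Borel functions as multipliers, any \<open>g\<close> is reached from an \<open>F\<close> without zeros on \<open>[-R, R]\<close>:
  the quotient \<open>g / F\<close>, cut off to the part of \<open>[-R, R]\<close> where it is bounded by \<open>n\<close>, is a multiplier, and the
  product with \<open>F\<close> tends to \<open>g\<close> as \<open>n\<close> and then \<open>R\<close> tend to infinity.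
\<close>

lemma dense_if_evaluation_unbounded:
  assumes nonvanishing: "\<And>R. \<exists>F\<in>E. \<forall>x. \<bar>x\<bar> \<le> R \<longrightarrow> F (of_real x) \<noteq> 0"
  shows "dense_in_L2 E M"
proof -
  have "g \<in> closure_E" if g: "g \<in> L2_functions M" for g
  proof -
    have gm [measurable]: "g \<in> borel_measurable borel"
      using L2_functionsD(1)[OF g] by (simp add: measurable_cong_sets[OF sets_M refl])
    have approx: "\<psi> \<in> closure_E"
      if \<psi>: "\<psi> \<in> L2_functions M" and lim: "\<And>x. (\<lambda>n. indicator (A n) x * \<psi> x) \<longlonglongrightarrow> \<psi> x"
        and cl: "\<And>n. (\<lambda>x. indicator (A n) x * \<psi> x) \<in> closure_E"
      for \<psi> and A :: "nat \<Rightarrow> real set"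
      by (rule closure_E_dominated_limit[OF cl \<psi> \<psi> _ lim, of 1]) (auto simp: indicator_def)
    have indL2: "(\<lambda>x. indicator A x * g x) \<in> L2_functions M" if "A \<in> sets borel" for A
      by (rule bounded_multiplication_L2(1)[OF g, of _ 1]) (use that in \<open>auto simp: indicator_def\<close>)
    have loc: "(\<lambda>x. indicator {-R..R} x * g x) \<in> closure_E" for R :: real
    proof -
      obtain F where F: "F \<in> E" "\<And>x. \<bar>x\<bar> \<le> R \<Longrightarrow> F (of_real x) \<noteq> 0" using nonvanishing[of R] by auto
      have Fm [measurable]: "(\<lambda>x. F (of_real x)) \<in> borel_measurable borel"
        using L2_functionsD(1)[OF square_integrable[OF F(1)]] by (simp add: measurable_cong_sets[OF sets_M refl])
      define A where "A n = {x. cmod (g x) \<le> real n * cmod (F (of_real x))}" for n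
      have A [measurable]: "A n \<in> sets borel" for n unfolding A_def by measurable
      show ?thesis
      proof (rule approx[of _ A])
        show "(\<lambda>x. indicator {-R..R} x * g x) \<in> L2_functions M" by (rule indL2) simp
        show "(\<lambda>n. indicator (A n) x * (indicator {-R..R} x * g x)) \<longlonglongrightarrow> indicator {-R..R} x * g x" for x
        proof (cases "x \<in> {-R..R}")
          case True
          then have nz: "F (of_real x) \<noteq> 0" by (intro F(2)) auto
          obtain N :: nat where "cmod (g x) / cmod (F (of_real x)) \<le> N" using real_arch_simple by blast
          then have N: "cmod (g x) \<le> N * cmod (F (of_real x))" using nz by (simp add: field_simps)
          have "x \<in> A n" if "N \<le> n" for n
          proof -
            have "N * cmod (F (of_real x)) \<le> n * cmod (F (of_real x))" using that by (intro mult_right_mono) auto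
            then show ?thesis using N by (simp add: A_def)
          qed
          then have "\<forall>\<^sub>F n in sequentially. indicator (A n) x * (indicator {-R..R} x * g x) = indicator {-R..R} x * g x"
            unfolding eventually_sequentially by (intro exI[of _ N]) simp
          then show ?thesis by (rule tendsto_eventually)
        qed simp
        show "(\<lambda>x. indicator (A n) x * (indicator {-R..R} x * g x)) \<in> closure_E" for n
        proof -
          define \<phi> where "\<phi> x = indicator (A n) x * (indicator {-R..R} x * g x) / F (of_real x)" for x
          have "multiplier \<phi>"
          proof (rule multiplier_bounded_measurable[where C = "real n"])
            show "\<phi> \<in> borel_measurable borel" unfolding \<phi>_def by measurable
            fix x
            show "cmod (\<phi> x) \<le> n"
            proof (cases "x \<in> A n \<and> x \<in> {-R..R}")
              case True
              then have nz: "F (of_real x) \<noteq> 0" by (intro F(2)) auto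
              with True show ?thesis by (simp add: \<phi>_def A_def norm_divide pos_divide_le_eq)
            qed (auto simp: \<phi>_def)
          qed
          then have "(\<lambda>x. \<phi> x * F (of_real x)) \<in> closure_E" by (rule multiplierD(2)[OF _ subset_closure_E[OF F(1)]])
          moreover have "\<phi> x * F (of_real x) = indicator (A n) x * (indicator {-R..R} x * g x)" for x
          proof (cases "x \<in> {-R..R}")
            case True
            then have "F (of_real x) \<noteq> 0" by (intro F(2)) auto
            then show ?thesis by (simp add: \<phi>_def)
          qed (simp add: \<phi>_def)
          ultimately show ?thesis by simp
        qed
      qed
    qed
    show ?thesis
    proof (rule approx[of _ "\<lambda>n. {- real n..real n}"])
      show "(\<lambda>n. indicator {- real n..real n} x * g x) \<longlonglongrightarrow> g x" for x
      proof -
        obtain N :: nat where N: "\<bar>x\<bar> \<le> N" using real_arch_simple by blast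
        have "x \<in> {- real n..real n}" if "N \<le> n" for n
        proof -
          have "real N \<le> real n" using that by simp
          then show ?thesis using N by (auto simp: abs_le_iff)
        qed
        then have "\<forall>\<^sub>F n in sequentially. indicator {- real n..real n} x * g x = g x"
          unfolding eventually_sequentially by (intro exI[of _ N]) simp
        then show ?thesis by (rule tendsto_eventually)
      qed
    qed (use g loc in auto)
  qed
  then show ?thesis
    unfolding dense_in_L2_def using square_integrable closure_E_approx by blast
qed

end

end

section \<open>A holomorphic majorant when point evaluation is bounded\<close>

text \<open>
  The second bound expresses that, up to the term \<open>\<i>\<close>, \<open>(z + \<i>) * (x - \<i>) / (x - z)\<close> is the Herglotz kernel
  \<open>(1 + x * z) / (x - z)\<close>, whose imaginary part is positive for \<open>z\<close> in the upper half-plane.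
\<close>

lemma cayley_kernel_bounds:
  fixes x :: real
  assumes z: "0 < Im z"
  shows "cmod ((of_real x - \<i>) / (of_real x - z)) \<le> 1 + cmod (z - \<i>) / Im z"
    and "1 \<le> Im ((z + \<i>) * ((of_real x - \<i>) / (of_real x - z)))"
proof -
  have ne: "of_real x - z \<noteq> 0" using z by (auto simp: complex_eq_iff)
  have im: "Im z \<le> cmod (of_real x - z)"
    using abs_Im_le_cmod[of "of_real x - z"] z by simp
  have "(of_real x - \<i>) / (of_real x - z) = 1 + (z - \<i>) / (of_real x - z)"
    using ne by (simp add: field_simps)
  then have "cmod ((of_real x - \<i>) / (of_real x - z)) \<le> 1 + cmod ((z - \<i>) / (of_real x - z))"
    using norm_triangle_ineq[of 1 "(z - \<i>) / (of_real x - z)"] by simp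
  also have "cmod ((z - \<i>) / (of_real x - z)) \<le> cmod (z - \<i>) / Im z"
    unfolding norm_divide using im z by (intro divide_left_mono mult_pos_pos) auto
  finally show "cmod ((of_real x - \<i>) / (of_real x - z)) \<le> 1 + cmod (z - \<i>) / Im z" by simp
  have "(z + \<i>) * ((of_real x - \<i>) / (of_real x - z)) = (1 + of_real x * z) / (of_real x - z) + \<i>"
    using ne by (simp add: field_simps)
  moreover have "Im ((1 + of_real x * z) / (of_real x - z)) = (1 + x\<^sup>2) * Im z / (cmod (of_real x - z))\<^sup>2"
    unfolding Im_divide cmod_power2 by (simp add: power2_eq_square algebra_simps)
  moreover have "0 \<le> (1 + x\<^sup>2) * Im z / (cmod (of_real x - z))\<^sup>2" using z by simp
  ultimately show "1 \<le> Im ((z + \<i>) * ((of_real x - \<i>) / (of_real x - z)))" by simp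
qed

context division_space
begin

text \<open>
  An upper bound of \<open>\<bar>(x - \<i>) / (x - z)\<bar>\<close> for all real \<open>x\<close>.
\<close>

definition kernel_bound :: "complex \<Rightarrow> real" where
  "kernel_bound z = 1 + cmod (z - \<i>) / Im z"

text \<open>
  Let \<open>p\<close> nearly minimize the norm among functions with value \<open>1\<close> at \<open>\<i>\<close>; it is then almost orthogonal to
  all functions that vanish at \<open>\<i>\<close>. The function \<open>(w - \<i>) * (p z * F w - F z * p w) / (w - z)\<close> is one of them, and
  orthogonality solves for \<open>F z\<close> in terms of \<open>p z\<close>, because the coefficient of \<open>F z\<close> is bounded
  below by the positivity of the Herglotz kernel. The terms with \<open>\<sigma>\<close> are the error due to \<open>p\<close> not being an
  exact minimizer.
\<close>

lemma near_minimizer_majorizes: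
  assumes p: "p \<in> E" "p \<i> = 1" and min: "\<And>H. H \<in> E \<Longrightarrow> H \<i> = 1 \<Longrightarrow> d \<le> norm_E H" and d: "d \<ge> 0"
    and F: "F \<in> E" and z: "0 < Im z"
  defines "\<kappa> \<equiv> kernel_bound z" and "\<sigma> \<equiv> sqrt ((norm_E p)\<^sup>2 - d\<^sup>2)"
  shows "cmod (F z) * (norm_E p)\<^sup>2 \<le> cmod (z + \<i>) * \<kappa> *
     (cmod (p z) * norm_E F * norm_E p + \<sigma> * (cmod (p z) * norm_E F + cmod (F z) * norm_E p))"
proof -
  let ?r = "\<lambda>F x. F (complex_of_real x)"
  define q where "q x = (of_real x - \<i>) / (of_real x - z)" for x :: real
  have ne: "of_real x - z \<noteq> 0" for x using z by (auto simp: complex_eq_iff)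
  have q\<kappa>: "cmod (q x) \<le> \<kappa>" for x
    using cayley_kernel_bounds(1)[OF z] by (simp add: q_def \<kappa>_def kernel_bound_def)
  have \<kappa>: "\<kappa> \<ge> 1" using z by (simp add: \<kappa>_def kernel_bound_def)
  have "continuous_on UNIV q"
    unfolding q_def using ne by (intro continuous_intros) auto
  then have qm [measurable]: "q \<in> borel_measurable borel" by (rule borel_measurable_continuous_onI)
  have L2: "?r F \<in> L2_functions M" "?r p \<in> L2_functions M"
    by (intro square_integrable F p)+
  have meas: "(\<lambda>x. q x * g x) \<in> borel_measurable M" if "g \<in> L2_functions M" for g
    using L2_functionsD(1)[OF that] qm by (simp add: measurable_cong_sets[OF sets_M refl])
  have qle: "cmod (q x * u) \<le> \<kappa> * cmod u" for x u
    unfolding norm_mult by (intro mult_right_mono q\<kappa>) simp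
  have qL2: "(\<lambda>x. q x * g x) \<in> L2_functions M" "L2_norm M (\<lambda>x. q x * g x) \<le> \<kappa> * L2_norm M g"
    if "g \<in> L2_functions M" for g
    using L2_functions_dominated[OF that meas[OF that] qle] L2_norm_dominated[OF that meas[OF that] qle] \<kappa> by auto
  have "(\<lambda>w. p z * F w - F z * p w) \<in> E" by (intro diff cmult F p)
  moreover have "p z * F z - F z * p z = 0" by simp
  ultimately obtain G0 where G0: "G0 \<in> E" "\<And>w. p z * F w - F z * p w = (w - z) * G0 w"
    using divide[of "\<lambda>w. p z * F w - F z * p w" z] by auto
  define G where "G w = (w - \<i>) * G0 w" for w
  have G: "G \<in> E" "G \<i> = 0" unfolding G_def using mult_linear[OF G0(1)] by simp_all
  have Gr: "?r G x = q x * (p z * ?r F x - F z * ?r p x)" for x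
    using ne[of x] by (simp add: G_def G0(2) q_def)
  define IF Ip where "IF = (LINT x|M. (q x * ?r F x) * cnj (?r p x))"
    and "Ip = (LINT x|M. (q x * ?r p x) * cnj (?r p x))"
  have int: "integrable M (\<lambda>x. (q x * ?r F x) * cnj (?r p x))" "integrable M (\<lambda>x. (q x * ?r p x) * cnj (?r p x))"
    by (intro L2_integrable_mult(2) qL2 L2_functions_cnj L2)+
  have "(LINT x|M. ?r G x * cnj (?r p x)) =
      (LINT x|M. p z * ((q x * ?r F x) * cnj (?r p x)) - F z * ((q x * ?r p x) * cnj (?r p x)))"
    unfolding Gr by (simp add: algebra_simps)
  also have "\<dots> = p z * IF - F z * Ip"
    unfolding IF_def Ip_def using int by simp
  finally have GI: "(LINT x|M. ?r G x * cnj (?r p x)) = p z * IF - F z * Ip" .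
  have dp: "d\<^sup>2 \<le> (norm_E p)\<^sup>2" using min[OF p] d by (intro power_mono)
  have "(cmod (LINT x|M. ?r G x * cnj (?r p x)))\<^sup>2 \<le> ((norm_E p)\<^sup>2 - d\<^sup>2) * (norm_E G)\<^sup>2"
  proof (rule near_minimizer_almost_orthogonal)
    fix t
    have "(\<lambda>w. p w + t * G w) \<in> E" by (intro add cmult p G)
    then have "d \<le> norm_E (\<lambda>w. p w + t * G w)" using p G by (intro min) auto
    then show "d\<^sup>2 \<le> (norm_E (\<lambda>w. p w + t * G w))\<^sup>2" using d by (intro power_mono)
  qed (intro square_integrable p G)+
  then have "(cmod (p z * IF - F z * Ip))\<^sup>2 \<le> (\<sigma> * norm_E G)\<^sup>2"
    using dp by (simp add: GI \<sigma>_def power_mult_distrib)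
  moreover have \<sigma>: "\<sigma> \<ge> 0" using dp by (simp add: \<sigma>_def)
  ultimately have orth: "cmod (p z * IF - F z * Ip) \<le> \<sigma> * norm_E G"
    by (intro power2_le_imp_le[of "cmod (p z * IF - F z * Ip)"]) auto
  have normG: "norm_E G \<le> \<kappa> * (cmod (p z) * norm_E F + cmod (F z) * norm_E p)"
  proof -
    have L: "(\<lambda>x. p z * ?r F x) \<in> L2_functions M" "(\<lambda>x. - F z * ?r p x) \<in> L2_functions M"
      by (intro L2_functions_cmult L2)+
    have "norm_E G = L2_norm M (\<lambda>x. q x * (p z * ?r F x + - F z * ?r p x))" by (simp add: Gr)
    also have "\<dots> \<le> \<kappa> * L2_norm M (\<lambda>x. p z * ?r F x + - F z * ?r p x)"
      by (rule qL2(2)[OF L2_functions_add[OF L]])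
    also have "\<dots> \<le> \<kappa> * (cmod (p z) * norm_E F + cmod (F z) * norm_E p)"
      using L2_norm_triangle[OF L] \<kappa> unfolding L2_norm_cmult norm_minus_cancel by (intro mult_left_mono) auto
    finally show ?thesis .
  qed
  have IFle: "cmod IF \<le> \<kappa> * norm_E F * norm_E p"
  proof -
    have "cmod IF \<le> L2_norm M (\<lambda>x. q x * ?r F x) * L2_norm M (\<lambda>x. cnj (?r p x))"
      unfolding IF_def by (rule L2_Cauchy_Schwarz(2)[OF qL2(1)[OF L2(1)] L2_functions_cnj[OF L2(2)]])
    also have "L2_norm M (\<lambda>x. cnj (?r p x)) = norm_E p" by (simp add: L2_norm_def)
    also have "L2_norm M (\<lambda>x. q x * ?r F x) * norm_E p \<le> (\<kappa> * norm_E F) * norm_E p"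
      by (intro mult_right_mono qL2(2) L2) simp
    finally show ?thesis .
  qed
  have Ipge: "(norm_E p)\<^sup>2 \<le> cmod (z + \<i>) * cmod Ip"
  proof -
    have e: "(z + \<i>) * ((q x * ?r p x) * cnj (?r p x)) = ((z + \<i>) * q x) * of_real ((cmod (?r p x))\<^sup>2)" for x
      by (simp only: complex_norm_square mult.assoc)
    have int': "integrable M (\<lambda>x. (z + \<i>) * ((q x * ?r p x) * cnj (?r p x)))"
      by (intro integrable_mult_right int)
    have "(norm_E p)\<^sup>2 = (LINT x|M. (cmod (?r p x))\<^sup>2)" by (rule L2_norm_power2)
    also have "\<dots> \<le> (LINT x|M. Im ((z + \<i>) * ((q x * ?r p x) * cnj (?r p x))))"
    proof (intro integral_mono L2_functionsD(2) L2 integrable_Im int')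
      fix x
      have "1 * (cmod (?r p x))\<^sup>2 \<le> Im ((z + \<i>) * q x) * (cmod (?r p x))\<^sup>2"
        using cayley_kernel_bounds(2)[OF z, of x] unfolding q_def by (intro mult_right_mono) auto
      also have "\<dots> = Im ((z + \<i>) * ((q x * ?r p x) * cnj (?r p x)))"
        unfolding e by (simp only: times_complex.sel(2) Re_complex_of_real Im_complex_of_real)
      finally show "(cmod (?r p x))\<^sup>2 \<le> Im ((z + \<i>) * ((q x * ?r p x) * cnj (?r p x)))" by simp
    qed
    also have "\<dots> = Im ((z + \<i>) * Ip)"
      unfolding integral_Im[OF int'] Ip_def using int by simp
    also have "\<dots> \<le> cmod ((z + \<i>) * Ip)" using abs_Im_le_cmod[of "(z + \<i>) * Ip"] by linarith
    finally show ?thesis by (simp add: norm_mult)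
  qed
  have "cmod (F z * Ip) \<le> cmod (p z * IF) + cmod (p z * IF - F z * Ip)"
    using norm_triangle_ineq4[of "p z * IF" "p z * IF - F z * Ip"] by simp
  also have "\<dots> \<le> cmod (p z) * (\<kappa> * norm_E F * norm_E p) + \<sigma> * (\<kappa> * (cmod (p z) * norm_E F + cmod (F z) * norm_E p))"
    unfolding norm_mult using IFle orth normG \<sigma>
    by (intro add_mono mult_left_mono order_trans[OF orth] mult_left_mono[OF normG]) auto
  finally have "cmod (F z) * cmod Ip \<le> \<kappa> * (cmod (p z) * norm_E F * norm_E p + \<sigma> * (cmod (p z) * norm_E F + cmod (F z) * norm_E p))"
    by (simp add: norm_mult algebra_simps)
  then have "cmod (z + \<i>) * (cmod (F z) * cmod Ip) \<le> cmod (z + \<i>) *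
      (\<kappa> * (cmod (p z) * norm_E F * norm_E p + \<sigma> * (cmod (p z) * norm_E F + cmod (F z) * norm_E p)))"
    by (rule mult_left_mono) simp
  moreover have "cmod (F z) * (norm_E p)\<^sup>2 \<le> cmod (F z) * (cmod (z + \<i>) * cmod Ip)"
    by (rule mult_left_mono[OF Ipge]) simp
  ultimately show ?thesis by (simp add: mult_ac)
qed

text \<open>
  Near-minimizers form a Cauchy sequence, by the parallelogram law. The previous lemma, used with a single
  good near-minimizer, bounds all evaluations locally uniformly, so the sequence converges locally
  uniformly in the upper half-plane; its limit \<open>k\<close> inherits the estimate without error terms.
\<close>

lemma evaluation_majorant:
  assumes ev: "\<And>F. F \<in> E \<Longrightarrow> cmod (F \<i>) \<le> B * norm_E F"
    and nontrivial: "\<exists>F\<in>E. F \<i> \<noteq> 0"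
  obtains k C where "k holomorphic_on {z. 0 < Im z}" "C > 0"
    "\<And>F z. F \<in> E \<Longrightarrow> 0 < Im z \<Longrightarrow> cmod (F z) \<le> C * cmod (z + \<i>) * kernel_bound z * cmod (k z) * norm_E F"
proof -
  define A where "A = {norm_E H | H. H \<in> E \<and> H \<i> = 1}"
  obtain F0 where F0: "F0 \<in> E" "F0 \<i> \<noteq> 0" using nontrivial by blast
  have "(\<lambda>z. (1 / F0 \<i>) * F0 z) \<in> E" by (rule cmult[OF F0(1)])
  then have "norm_E (\<lambda>z. (1 / F0 \<i>) * F0 z) \<in> A" unfolding A_def using F0(2)
    by (intro CollectI exI[of _ "\<lambda>z. (1 / F0 \<i>) * F0 z"]) simp
  then have Ane: "A \<noteq> {}" by blast
  have bdd: "bdd_below A" unfolding bdd_below_def A_def by (intro exI[of _ 0]) auto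
  define d where "d = Inf A"
  have min: "d \<le> norm_E H" if "H \<in> E" "H \<i> = 1" for H
    unfolding d_def using that by (intro cInf_lower[OF _ bdd]) (auto simp: A_def)
  have Bd: "1 \<le> B * norm_E H" if "H \<in> E" "H \<i> = 1" for H using ev[OF that(1)] that(2) by simp
  have Bpos: "B > 0"
  proof -
    obtain H where "H \<in> E" "H \<i> = 1" using Ane by (auto simp: A_def)
    from Bd[OF this] show ?thesis using L2_norm_nonneg[of M "\<lambda>x. H (of_real x)"]
      by (meson linorder_not_le mult_nonpos_nonneg not_one_le_zero order_trans)
  qed
  have "1 / B \<le> d" unfolding d_def
  proof (rule cInf_greatest[OF Ane])
    fix a assume "a \<in> A"
    then obtain H where "H \<in> E" "H \<i> = 1" "a = norm_E H" by (auto simp: A_def)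
    then show "1 / B \<le> a" using Bd[of H] Bpos by (simp add: field_simps)
  qed
  then have d: "d > 0" using Bpos by (meson less_le_trans zero_less_divide_1_iff)
  have "\<exists>p. p \<in> E \<and> p \<i> = 1 \<and> (norm_E p)\<^sup>2 < d\<^sup>2 + 1 / Suc n" for n
  proof -
    have "d < sqrt (d\<^sup>2 + 1 / Suc n)" using d by (intro real_less_rsqrt) simp
    then obtain a where "a \<in> A" "a < sqrt (d\<^sup>2 + 1 / Suc n)"
      unfolding d_def using cInf_less_iff[OF Ane bdd] by blast
    then obtain H where H: "H \<in> E" "H \<i> = 1" "norm_E H < sqrt (d\<^sup>2 + 1 / Suc n)" by (auto simp: A_def)
    then have "(norm_E H)\<^sup>2 < (sqrt (d\<^sup>2 + 1 / Suc n))\<^sup>2" by (intro power_strict_mono) auto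
    then have "(norm_E H)\<^sup>2 < d\<^sup>2 + 1 / Suc n" by (simp add: add_nonneg_nonneg)
    with H show ?thesis by blast
  qed
  then obtain p where p: "\<And>n. p n \<in> E" "\<And>n. p n \<i> = 1" "\<And>n. (norm_E (p n))\<^sup>2 < d\<^sup>2 + 1 / Suc n"
    by metis
  have pd: "d \<le> norm_E (p n)" for n by (rule min[OF p(1,2)])
  define \<sigma> where "\<sigma> n = sqrt ((norm_E (p n))\<^sup>2 - d\<^sup>2)" for n
  have pd2: "d\<^sup>2 \<le> (norm_E (p n))\<^sup>2" for n using pd[of n] d by (intro power_mono) auto
  have \<sigma>0: "\<sigma> n \<ge> 0" for n using pd2[of n] by (simp add: \<sigma>_def)
  have \<sigma>sq: "(norm_E (p n))\<^sup>2 - d\<^sup>2 \<le> 1 / Suc n" for n using p(3)[of n] by simp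
  have lim2: "(\<lambda>n. (norm_E (p n))\<^sup>2 - d\<^sup>2) \<longlonglongrightarrow> 0"
    by (rule Lim_null_comparison[OF always_eventually LIMSEQ_Suc[OF lim_1_over_n]]) (use \<sigma>sq pd2 in auto)
  have \<sigma>lim: "\<sigma> \<longlonglongrightarrow> 0"
    using tendsto_real_sqrt[OF lim2] unfolding \<sigma>_def[abs_def] by simp
  have nlim: "(\<lambda>n. norm_E (p n)) \<longlonglongrightarrow> d"
  proof -
    have "(\<lambda>n. (norm_E (p n))\<^sup>2) \<longlonglongrightarrow> d\<^sup>2" using lim2 by (simp add: LIM_zero_iff)
    from tendsto_real_sqrt[OF this] show ?thesis using d by simp
  qed
  have key: "cmod (F z) * (norm_E (p n))\<^sup>2 \<le> cmod (z + \<i>) * kernel_bound z *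
     (cmod (p n z) * norm_E F * norm_E (p n) + \<sigma> n * (cmod (p n z) * norm_E F + cmod (F z) * norm_E (p n)))"
    if "F \<in> E" "0 < Im z" for F z n
    unfolding \<sigma>_def by (rule near_minimizer_majorizes[OF p(1,2) min less_imp_le[OF d] that])
  \<comment> \<open>For large \<open>n\<close> the factor \<open>\<sigma> n\<close> is so small on \<open>K\<close> that the term with \<open>F z\<close> on the right of \<open>key\<close> can be absorbed.\<close>
  have locbdd: "\<exists>C. \<forall>F\<in>E. \<forall>z\<in>K. cmod (F z) \<le> C * norm_E F" if K: "compact K" "K \<subseteq> {z. 0 < Im z}" for K
  proof -
    have "continuous_on K (\<lambda>z. cmod (z + \<i>) * kernel_bound z)"
      unfolding kernel_bound_def using K(2) by (intro continuous_intros) auto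
    then have "bounded ((\<lambda>z. cmod (z + \<i>) * kernel_bound z) ` K)"
      by (intro compact_imp_bounded compact_continuous_image K(1))
    then obtain c where c: "\<forall>y\<in>(\<lambda>z. cmod (z + \<i>) * kernel_bound z) ` K. norm y \<le> c" unfolding bounded_iff ..
    define c' where "c' = max c 1"
    have c': "cmod (z + \<i>) * kernel_bound z \<le> c'" if "z \<in> K" for z using c that by (force simp: c'_def)
    have c'1: "c' \<ge> 1" by (simp add: c'_def)
    have "\<forall>\<^sub>F n in sequentially. \<sigma> n < d / (2 * c')"
      using d c'1 by (intro order_tendstoD(2)[OF \<sigma>lim]) auto
    then obtain n where "\<forall>m\<ge>n. \<sigma> m < d / (2 * c')" unfolding eventually_sequentially ..
    then have \<sigma>n: "\<sigma> n < d / (2 * c')" by simp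
    have "continuous_on K (p n)"
      using entire[OF p(1)] by (meson continuous_on_subset holomorphic_on_imp_continuous_on subset_UNIV)
    then have "bounded (p n ` K)" by (intro compact_imp_bounded compact_continuous_image K(1))
    then obtain P where P: "\<forall>y\<in>p n ` K. norm y \<le> P" unfolding bounded_iff ..
    define N where "N = norm_E (p n)"
    have N: "N \<ge> d" "N > 0" using pd[of n] d by (auto simp: N_def)
    have "cmod (F z) \<le> (2 * c' * P * (N + \<sigma> n) / N\<^sup>2) * norm_E F" if F: "F \<in> E" and z: "z \<in> K" for F z
    proof -
      define t where "t = cmod (z + \<i>) * kernel_bound z"
      have t: "0 \<le> t" "t \<le> c'" using c'[OF z] K(2) z by (auto simp: t_def kernel_bound_def)
      have "0 < Im z" using K(2) z by auto
      from key[OF F this, of n]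
      have "cmod (F z) * N\<^sup>2 \<le> t * (cmod (p n z) * norm_E F * N + \<sigma> n * (cmod (p n z) * norm_E F + cmod (F z) * N))"
        by (simp add: t_def N_def)
      also have "\<dots> \<le> c' * (cmod (p n z) * norm_E F * N + \<sigma> n * (cmod (p n z) * norm_E F + cmod (F z) * N))"
        using t N \<sigma>0[of n] by (intro mult_right_mono) auto
      also have "\<dots> = c' * cmod (p n z) * norm_E F * (N + \<sigma> n) + c' * \<sigma> n * (cmod (F z) * N)"
        by (simp add: algebra_simps)
      also have "c' * \<sigma> n * (cmod (F z) * N) \<le> N / 2 * (cmod (F z) * N)"
      proof (rule mult_right_mono)
        have "c' * \<sigma> n \<le> c' * (d / (2 * c'))" using \<sigma>n c'1 by (intro mult_left_mono) auto
        also have "\<dots> = d / 2" using c'1 by simp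
        finally show "c' * \<sigma> n \<le> N / 2" using N by simp
      qed (use N in auto)
      also have "c' * cmod (p n z) * norm_E F * (N + \<sigma> n) \<le> c' * P * norm_E F * (N + \<sigma> n)"
        using P z c'1 N \<sigma>0[of n] by (intro mult_right_mono mult_left_mono) auto
      finally have "cmod (F z) * N\<^sup>2 \<le> 2 * (c' * P * norm_E F * (N + \<sigma> n))"
        by (simp add: power2_eq_square mult_ac)
      then show ?thesis using N by (simp add: field_simps)
    qed
    then show ?thesis by blast
  qed
  \<comment> \<open>The mean of two near-minimizers competes in the same minimization, so their sum has norm at least \<open>2 * d\<close>.\<close>
  have cauchy: "(norm_E (\<lambda>z. p m z - p n z))\<^sup>2 \<le> 4 / Suc N" if "m \<ge> N" "n \<ge> N" for m n N
  proof -
    have "(norm_E (\<lambda>z. p m z - p n z))\<^sup>2 + (norm_E (\<lambda>z. p m z + p n z))\<^sup>2 = 2 * (norm_E (p m))\<^sup>2 + 2 * (norm_E (p n))\<^sup>2"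
      by (rule L2_parallelogram[OF square_integrable square_integrable, OF p(1) p(1)])
    moreover have "(2 * d)\<^sup>2 \<le> (norm_E (\<lambda>z. p m z + p n z))\<^sup>2"
    proof (rule power_mono)
      have "(\<lambda>z. (1/2) * (p m z + p n z)) \<in> E" by (intro cmult add p(1))
      then have "d \<le> norm_E (\<lambda>z. (1/2) * (p m z + p n z))" by (rule min) (simp add: p(2))
      then show "2 * d \<le> norm_E (\<lambda>z. p m z + p n z)" unfolding L2_norm_cmult by simp
    qed (use d in auto)
    moreover have "4 * d\<^sup>2 = (2 * d)\<^sup>2" by (simp add: power_mult_distrib)
    moreover have "1 / real (Suc m) \<le> 1 / real (Suc N)" "1 / real (Suc n) \<le> 1 / real (Suc N)"
      using that by (auto intro!: divide_left_mono)
    moreover have "4 / real (Suc N) = 4 * (1 / real (Suc N))" by simp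
    ultimately show ?thesis using p(3)[of m] p(3)[of n] by linarith
  qed
  define k where "k z = lim (\<lambda>n. p n z)" for z
  have ulim: "uniform_limit K p k sequentially" if K: "compact K" "K \<subseteq> {z. 0 < Im z}" for K
  proof -
    obtain C where C: "\<forall>F\<in>E. \<forall>z\<in>K. cmod (F z) \<le> C * norm_E F" using locbdd[OF K] ..
    have "uniformly_Cauchy_on K p"
      unfolding uniformly_Cauchy_on_def
    proof (intro allI impI)
      fix e :: real assume e: "e > 0"
      obtain N :: nat where N: "4 * (\<bar>C\<bar> + 1)\<^sup>2 / e\<^sup>2 < N" using reals_Archimedean2 by blast
      have "dist (p m z) (p n z) < e" if "z \<in> K" "m \<ge> N" "n \<ge> N" for z m n
      proof -
        have "cmod (p m z - p n z) \<le> C * norm_E (\<lambda>z. p m z - p n z)"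
          using C diff[OF p(1) p(1), of m n] that(1) by (auto dest!: bspec)
        also have "\<dots> \<le> (\<bar>C\<bar> + 1) * norm_E (\<lambda>z. p m z - p n z)" by (intro mult_right_mono) auto
        finally have "(cmod (p m z - p n z))\<^sup>2 \<le> ((\<bar>C\<bar> + 1) * norm_E (\<lambda>z. p m z - p n z))\<^sup>2"
          by (intro power_mono) auto
        also have "\<dots> \<le> (\<bar>C\<bar> + 1)\<^sup>2 * (4 / Suc N)"
          unfolding power_mult_distrib by (intro mult_left_mono cauchy that(2,3)) auto
        also have "\<dots> < e\<^sup>2"
        proof -
          have "4 * (\<bar>C\<bar> + 1)\<^sup>2 < N * e\<^sup>2" using N e by (simp add: field_simps)
          also have "\<dots> \<le> Suc N * e\<^sup>2" by (intro mult_right_mono) auto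
          finally show ?thesis by (simp add: field_simps)
        qed
        finally have "cmod (p m z - p n z) < e" using e by (intro power2_less_imp_less[of _ e]) auto
        then show ?thesis by (simp add: dist_norm)
      qed
      then show "\<exists>M. \<forall>x\<in>K. \<forall>m\<ge>M. \<forall>n\<ge>M. dist (p m x) (p n x) < e" by blast
    qed
    then have "uniformly_convergent_on K p" by (rule Cauchy_uniformly_convergent)
    then show ?thesis unfolding k_def[abs_def] by (simp add: uniformly_convergent_uniform_limit_iff)
  qed
  have op: "open {z. 0 < Im z}" by (rule open_halfspace_Im_gt)
  have hol: "k holomorphic_on {z. 0 < Im z}"
  proof (rule holomorphic_uniform_sequence[OF op])
    show "p n holomorphic_on {z. 0 < Im z}" for n by (rule holomorphic_on_subset[OF entire[OF p(1)]]) simp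
    show "\<exists>e>0. cball z e \<subseteq> {z. 0 < Im z} \<and> uniform_limit (cball z e) p k sequentially"
      if z: "z \<in> {z. 0 < Im z}" for z
    proof -
      obtain e where "e > 0" "cball z e \<subseteq> {z. 0 < Im z}" using op z by (meson open_contains_cball)
      then show ?thesis using ulim[of "cball z e"] by auto
    qed
  qed
  have "cmod (F z) \<le> (1 / d) * cmod (z + \<i>) * kernel_bound z * cmod (k z) * norm_E F"
    if F: "F \<in> E" and z: "0 < Im z" for F z
  proof -
    have "uniform_limit {z} p k sequentially" using z by (intro ulim) auto
    then have plim: "(\<lambda>n. p n z) \<longlonglongrightarrow> k z" by (simp add: tendsto_uniform_limitI)
    define t where "t = cmod (z + \<i>) * kernel_bound z"
    have "cmod (F z) * d\<^sup>2 \<le> t * (cmod (k z) * norm_E F * d + 0 * (cmod (k z) * norm_E F + cmod (F z) * d))"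
    proof (rule LIMSEQ_le)
      show "(\<lambda>n. cmod (F z) * (norm_E (p n))\<^sup>2) \<longlonglongrightarrow> cmod (F z) * d\<^sup>2"
        by (intro tendsto_intros nlim)
      show "(\<lambda>n. t * (cmod (p n z) * norm_E F * norm_E (p n) + \<sigma> n * (cmod (p n z) * norm_E F + cmod (F z) * norm_E (p n))))
          \<longlonglongrightarrow> t * (cmod (k z) * norm_E F * d + 0 * (cmod (k z) * norm_E F + cmod (F z) * d))"
        by (intro tendsto_intros nlim plim \<sigma>lim)
      show "\<exists>N. \<forall>n\<ge>N. cmod (F z) * (norm_E (p n))\<^sup>2 \<le>
          t * (cmod (p n z) * norm_E F * norm_E (p n) + \<sigma> n * (cmod (p n z) * norm_E F + cmod (F z) * norm_E (p n)))"
        using key[OF F z] by (auto simp: t_def)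
    qed
    then have "cmod (F z) * d * d \<le> (t * cmod (k z) * norm_E F) * d" by (simp add: power2_eq_square mult_ac)
    then have "cmod (F z) * d \<le> t * cmod (k z) * norm_E F" using d by (simp only: mult_le_cancel_right_pos)
    then show ?thesis using d by (simp add: t_def field_simps)
  qed
  with hol d show ?thesis by (intro that[of k "1 / d"]) auto
qed

end

section \<open>Integrals with respect to dominated measures\<close>

lemma mem_exp_interval: "y \<in> exp_interval r x \<delta> \<longleftrightarrow> \<bar>y - x\<bar> \<le> r * exp (- \<delta> * \<bar>x\<bar>)"
  by (auto simp: exp_interval_def abs_le_iff)

lemma exp_interval_bounded:
  assumes "y \<in> exp_interval r x \<delta>" "\<delta> > 0" "r \<ge> 0"
  shows "\<bar>y - x\<bar> \<le> r" and "\<bar>y\<bar> \<le> \<bar>x\<bar> + r" and "\<bar>x\<bar> \<le> \<bar>y\<bar> + r"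
proof -
  have "r * exp (- \<delta> * \<bar>x\<bar>) \<le> r" using assms(2,3) by (intro mult_left_le) auto
  then show "\<bar>y - x\<bar> \<le> r" using assms(1) by (simp add: mem_exp_interval)
  then show "\<bar>y\<bar> \<le> \<bar>x\<bar> + r" "\<bar>x\<bar> \<le> \<bar>y\<bar> + r" by linarith+
qed

text \<open>
  The distance \<open>2\<close> is the largest radius of an interval \<open>exp_interval 2 x \<delta>\<close>. Size and Lipschitz constant near
  \<open>x\<close> are bounded by the same quantity, as Cauchy's inequality provides for functions that are analytic in a strip.
\<close>

definition controlled_growth :: "real \<Rightarrow> real \<Rightarrow> (real \<Rightarrow> complex) \<Rightarrow> bool" where
  "controlled_growth \<epsilon> m F \<longleftrightarrow> F \<in> borel_measurable borel \<and> 0 \<le> m \<and>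
     (\<forall>x y. \<bar>y - x\<bar> \<le> 2 \<longrightarrow> cmod (F y) \<le> m * exp (\<epsilon> * \<bar>x\<bar>)) \<and>
     (\<forall>x y y'. \<bar>y - x\<bar> \<le> 2 \<longrightarrow> \<bar>y' - x\<bar> \<le> 2 \<longrightarrow> cmod (F y - F y') \<le> \<bar>y - y'\<bar> * (m * exp (\<epsilon> * \<bar>x\<bar>)))"

lemma powr_le_exp:
  fixes s \<epsilon> :: real
  assumes s: "s \<ge> 0" and \<epsilon>: "\<epsilon> > 0"
  obtains K where "K \<ge> 0" "\<And>x. (1 + \<bar>x\<bar>) powr s \<le> K * exp (\<epsilon> * \<bar>x\<bar>)"
proof -
  define \<eta> where "\<eta> = \<epsilon> / (s + 1)"
  have \<eta>: "\<eta> > 0" "\<eta> * s \<le> \<epsilon>"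
    using s \<epsilon> by (auto simp: \<eta>_def pos_divide_le_eq)
  have "(1 + \<bar>x\<bar>) powr s \<le> (1 + 1 / \<eta>) powr s * exp (\<epsilon> * \<bar>x\<bar>)" for x
  proof -
    have "1 + \<bar>x\<bar> \<le> (1 + 1 / \<eta>) * (1 + \<eta> * \<bar>x\<bar>)" using \<eta> by (simp add: field_simps)
    also have "\<dots> \<le> (1 + 1 / \<eta>) * exp (\<eta> * \<bar>x\<bar>)" using \<eta> by (intro mult_left_mono exp_ge_add_one_self) auto
    finally have "(1 + \<bar>x\<bar>) powr s \<le> ((1 + 1 / \<eta>) * exp (\<eta> * \<bar>x\<bar>)) powr s" using s by (intro powr_mono2) auto
    also have "\<dots> = (1 + 1 / \<eta>) powr s * exp (\<eta> * s * \<bar>x\<bar>)"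
      using \<eta> by (simp add: powr_mult exp_powr_real mult_ac)
    also have "\<dots> \<le> (1 + 1 / \<eta>) powr s * exp (\<epsilon> * \<bar>x\<bar>)"
      using \<eta> by (intro mult_left_mono) (auto intro!: mult_right_mono)
    finally show ?thesis .
  qed
  then show ?thesis by (intro that[of "(1 + 1 / \<eta>) powr s"]) auto
qed

lemma nn_integral_exp_abs_finite:
  assumes c: "(c::real) > 0"
  shows "(\<integral>\<^sup>+x. ennreal (exp (- c * \<bar>x\<bar>)) \<partial>lborel) < \<infinity>"
proof -
  have half: "(\<integral>\<^sup>+x. ennreal (exp (- c * x)) * indicator {0..} x \<partial>lborel) < \<infinity>"
  proof -
    have "(\<integral>\<^sup>+x. ennreal (exp (- c * x)) * indicator {0..} x \<partial>lborel) = ennreal (0 - (- exp (- c * 0) / c))"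
    proof (rule nn_integral_FTC_atLeast)
      show "((\<lambda>x. - exp (- c * x) / c) has_real_derivative exp (- c * x)) (at x)" for x
        using c by (auto intro!: derivative_eq_intros)
      have "filterlim (\<lambda>x. - c * x) at_bot at_top"
        using c by (intro filterlim_tendsto_neg_mult_at_bot[OF tendsto_const]) (auto simp: filterlim_ident)
      then have "((\<lambda>x. exp (- c * x)) \<longlongrightarrow> 0) at_top"
        by (rule filterlim_compose[OF exp_at_bot])
      then have "((\<lambda>x. - exp (- c * x) / c) \<longlongrightarrow> - 0 / c) at_top" by (intro tendsto_intros) (use c in auto)
      then show "((\<lambda>x. - exp (- c * x) / c) \<longlongrightarrow> 0) at_top" by simp
    qed auto
    then show ?thesis by simp
  qed
  have "(\<integral>\<^sup>+x. ennreal (exp (- c * \<bar>x\<bar>)) \<partial>lborel) \<le>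
     (\<integral>\<^sup>+x. ennreal (exp (- c * x)) * indicator {0..} x + ennreal (exp (- c * - x)) * indicator {0..} (- x) \<partial>lborel)"
    by (intro nn_integral_mono) (auto simp: indicator_def abs_if)
  also have "\<dots> = (\<integral>\<^sup>+x. ennreal (exp (- c * x)) * indicator {0..} x \<partial>lborel) +
      (\<integral>\<^sup>+x. ennreal (exp (- c * - x)) * indicator {0..} (- x) \<partial>lborel)"
    by (intro nn_integral_add) measurable
  also have "(\<integral>\<^sup>+x. ennreal (exp (- c * - x)) * indicator {0..} (- x) \<partial>lborel) =
      (\<integral>\<^sup>+x. ennreal (exp (- c * x)) * indicator {0..} x \<partial>lborel)"
    using nn_integral_real_affine[of "\<lambda>x. ennreal (exp (- c * x)) * indicator {0..} x" "-1" 0] by simp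
  also have "(\<integral>\<^sup>+x. ennreal (exp (- c * x)) * indicator {0..} x \<partial>lborel) +
      (\<integral>\<^sup>+x. ennreal (exp (- c * x)) * indicator {0..} x \<partial>lborel) < \<infinity>"
    using half unfolding infinity_ennreal_def less_top[symmetric] ennreal_add_eq_top by blast
  finally show ?thesis .
qed

context
  fixes M N :: "real measure" and \<delta> C n :: real
  assumes sets_M: "sets M = sets borel" and sets_N: "sets N = sets borel"
    and \<delta>: "\<delta> > 0" and C: "C > 0" and n: "n \<ge> 0"
    and locfin: "\<And>R::real. emeasure N {-R..R} < \<infinity>"
    and dom: "\<And>x. emeasure M (exp_interval 1 x \<delta>)
          \<le> ennreal (C * (1 + \<bar>x\<bar>) powr n) * (emeasure N (exp_interval 2 x \<delta>) + ennreal (exp (- 2 * \<delta> * \<bar>x\<bar>)))"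
begin

lemma sigma_finite_N: "sigma_finite_measure N"
proof
  show "\<exists>A. countable A \<and> A \<subseteq> sets N \<and> \<Union> A = space N \<and> (\<forall>a\<in>A. emeasure N a \<noteq> \<infinity>)"
  proof (intro exI[of _ "range (\<lambda>k::nat. {- real k..real k})"] conjI ballI)
    have "x \<in> (\<Union>k::nat. {- real k..real k})" for x :: real
    proof -
      obtain k :: nat where "\<bar>x\<bar> \<le> k" using real_arch_simple by blast
      then show ?thesis by (auto simp: abs_le_iff intro!: exI[of _ k])
    qed
    then show "\<Union> (range (\<lambda>k::nat. {- real k..real k})) = space N"
      using sets_eq_imp_space_eq[OF sets_N] by auto
  qed (use sets_N locfin in \<open>auto simp: less_top\<close>)
qed

lemma emeasure_exp_interval_finite:
  "emeasure N (exp_interval 2 x \<delta>) < \<infinity>" "emeasure M (exp_interval 1 x \<delta>) < \<infinity>"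
proof -
  have "exp_interval 2 x \<delta> \<subseteq> {- (\<bar>x\<bar> + 2)..\<bar>x\<bar> + 2}"
  proof
    fix y assume "y \<in> exp_interval 2 x \<delta>"
    then have "\<bar>y\<bar> \<le> \<bar>x\<bar> + 2" using exp_interval_bounded(2)[of y 2 x \<delta>] \<delta> by simp
    then show "y \<in> {- (\<bar>x\<bar> + 2)..\<bar>x\<bar> + 2}" by (auto simp: abs_le_iff)
  qed
  then have "emeasure N (exp_interval 2 x \<delta>) \<le> emeasure N {- (\<bar>x\<bar> + 2)..\<bar>x\<bar> + 2}"
    by (intro emeasure_mono) (simp_all add: sets_N)
  then show 1: "emeasure N (exp_interval 2 x \<delta>) < \<infinity>" using locfin by (rule le_less_trans)
  show "emeasure M (exp_interval 1 x \<delta>) < \<infinity>"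
    by (rule le_less_trans[OF dom]) (use 1 in \<open>auto simp: ennreal_mult_less_top less_top\<close>)
qed

lemma sigma_finite_M: "sigma_finite_measure M"
proof
  show "\<exists>A. countable A \<and> A \<subseteq> sets M \<and> \<Union> A = space M \<and> (\<forall>a\<in>A. emeasure M a \<noteq> \<infinity>)"
  proof (intro exI[of _ "(\<lambda>q::rat. exp_interval 1 (of_rat q) \<delta>) ` UNIV"] conjI ballI)
    have "y \<in> (\<Union>q::rat. exp_interval 1 (of_rat q) \<delta>)" for y :: real
    proof -
      define r where "r = exp (- \<delta> * (\<bar>y\<bar> + 1))"
      have r: "0 < r" "r \<le> 1" using \<delta> by (auto simp: r_def)
      obtain q :: rat where q: "y - r < of_rat q" "of_rat q < y + r" using of_rat_dense[of "y - r" "y + r"] r by auto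
      then have "\<bar>of_rat q\<bar> \<le> \<bar>y\<bar> + 1" using r by linarith
      then have "r \<le> exp (- \<delta> * \<bar>of_rat q\<bar>)" using \<delta> by (simp add: r_def)
      then have "y \<in> exp_interval 1 (of_rat q) \<delta>" using q by (auto simp: mem_exp_interval abs_if)
      then show ?thesis by blast
    qed
    then show "\<Union> ((\<lambda>q::rat. exp_interval 1 (of_rat q) \<delta>) ` UNIV) = space M"
      using sets_eq_imp_space_eq[OF sets_M] by auto
    fix a assume "a \<in> (\<lambda>q::rat. exp_interval 1 (of_rat q) \<delta>) ` UNIV"
    then show "emeasure M a \<noteq> \<infinity>"
    proof -
      assume "a \<in> (\<lambda>q::rat. exp_interval 1 (of_rat q) \<delta>) ` UNIV"
      then obtain q :: rat where "a = exp_interval 1 (of_rat q) \<delta>" by blast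
      then show ?thesis using emeasure_exp_interval_finite(2)[of "of_rat q"] by (simp add: less_top)
    qed
  qed (auto simp: sets_M exp_interval_def)
qed

lemma measurable_exp_interval [measurable]:
  "(\<lambda>(y, x). indicator (exp_interval r x \<delta>) y :: ennreal) \<in> borel_measurable (borel \<Otimes>\<^sub>M borel)"
proof -
  have eq: "(\<lambda>(y, x). indicator (exp_interval r x \<delta>) y :: ennreal) =
     indicator {p. \<bar>fst p - snd p\<bar> \<le> r * exp (- \<delta> * \<bar>snd p\<bar>)}"
    by (auto simp: fun_eq_iff indicator_def mem_exp_interval)
  have "{p \<in> space (borel \<Otimes>\<^sub>M borel). \<bar>fst p - snd p\<bar> \<le> r * exp (- \<delta> * \<bar>snd p\<bar>)} \<in> sets (borel \<Otimes>\<^sub>M borel)"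
    by measurable
  then show ?thesis unfolding eq by (simp add: space_pair_measure)
qed

text \<open>
  The centres \<open>x\<close> whose interval contains \<open>y\<close> fill an interval of length comparable to \<open>exp (- \<delta> * \<bar>y\<bar>)\<close>.
  So the weight \<open>exp (\<delta> * \<bar>x\<bar>)\<close> gives each \<open>y\<close> a total mass bounded below, and, in the next lemma, above.
  Integration over the centres thereby takes the place of a covering with bounded overlap.
\<close>

lemma weight_lower:
  "1 \<le> ennreal (exp (2 * \<delta>) / 2) * (\<integral>\<^sup>+x. ennreal (exp (\<delta> * \<bar>x\<bar>)) * indicator (exp_interval 1 x \<delta>) y \<partial>lborel)"
proof -
  define r where "r = exp (- \<delta>) * exp (- \<delta> * \<bar>y\<bar>)"
  have r: "r > 0" "r \<le> 1" using \<delta> by (auto simp: r_def mult_le_one)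
  have pt: "ennreal (exp (\<delta> * \<bar>y\<bar> - \<delta>)) * indicator {y - r..y + r} x \<le>
      ennreal (exp (\<delta> * \<bar>x\<bar>)) * indicator (exp_interval 1 x \<delta>) y" for x
  proof (cases "x \<in> {y - r..y + r}")
    case True
    then have yx: "\<bar>y - x\<bar> \<le> r" by (auto simp: abs_le_iff)
    then have x: "\<bar>x\<bar> \<le> \<bar>y\<bar> + 1" "\<bar>y\<bar> - 1 \<le> \<bar>x\<bar>" using r by linarith+
    \<comment> \<open>The radius \<open>r\<close> is that of the interval around a centre at distance \<open>1\<close> further out than \<open>y\<close>.\<close>
    have "r = exp (- \<delta> * (\<bar>y\<bar> + 1))" by (simp add: r_def algebra_simps flip: exp_add)
    also have "\<dots> \<le> exp (- \<delta> * \<bar>x\<bar>)" using x \<delta> by simp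
    finally have "r \<le> exp (- \<delta> * \<bar>x\<bar>)" .
    with yx have "y \<in> exp_interval 1 x \<delta>" by (simp add: mem_exp_interval)
    moreover have "\<delta> * (\<bar>y\<bar> - 1) \<le> \<delta> * \<bar>x\<bar>" using x \<delta> by (intro mult_left_mono) auto
    ultimately show ?thesis using True by (simp add: right_diff_distrib ennreal_leI)
  qed simp
  have "ennreal (exp (\<delta> * \<bar>y\<bar> - \<delta>) * (2 * r)) = (\<integral>\<^sup>+x. ennreal (exp (\<delta> * \<bar>y\<bar> - \<delta>)) * indicator {y - r..y + r} x \<partial>lborel)"
    using r by (simp add: nn_integral_cmult_indicator ennreal_mult)
  also have "\<dots> \<le> (\<integral>\<^sup>+x. ennreal (exp (\<delta> * \<bar>x\<bar>)) * indicator (exp_interval 1 x \<delta>) y \<partial>lborel)"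
    by (rule nn_integral_mono) (rule pt)
  finally have le: "ennreal (exp (\<delta> * \<bar>y\<bar> - \<delta>) * (2 * r)) \<le>
     (\<integral>\<^sup>+x. ennreal (exp (\<delta> * \<bar>x\<bar>)) * indicator (exp_interval 1 x \<delta>) y \<partial>lborel)" .
  have "exp (2 * \<delta>) / 2 * (exp (\<delta> * \<bar>y\<bar> - \<delta>) * (2 * r)) = 1"
    by (simp add: r_def algebra_simps flip: exp_add)
  then have "1 = ennreal (exp (2 * \<delta>) / 2) * ennreal (exp (\<delta> * \<bar>y\<bar> - \<delta>) * (2 * r))"
    using r by (subst ennreal_mult[symmetric]) auto
  also have "\<dots> \<le> ennreal (exp (2 * \<delta>) / 2) * (\<integral>\<^sup>+x. ennreal (exp (\<delta> * \<bar>x\<bar>)) * indicator (exp_interval 1 x \<delta>) y \<partial>lborel)"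
    by (rule mult_left_mono[OF le]) simp
  finally show ?thesis .
qed

lemma weight_upper:
  "(\<integral>\<^sup>+x. ennreal ((1 + \<bar>x\<bar>) powr n * exp (\<delta> * \<bar>x\<bar>)) * indicator (exp_interval 2 x \<delta>) y \<partial>lborel)
    \<le> ennreal (4 * exp (4 * \<delta>) * 3 powr n * (1 + \<bar>y\<bar>) powr n)"
proof -
  define r where "r = 2 * exp (2 * \<delta>) * exp (- \<delta> * \<bar>y\<bar>)"
  define w where "w = (3 * (1 + \<bar>y\<bar>)) powr n * exp (\<delta> * (\<bar>y\<bar> + 2))"
  have r: "r > 0" by (simp add: r_def)
  have pt: "ennreal ((1 + \<bar>x\<bar>) powr n * exp (\<delta> * \<bar>x\<bar>)) * indicator (exp_interval 2 x \<delta>) y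
      \<le> ennreal w * indicator {y - r..y + r} x" for x
  proof (cases "y \<in> exp_interval 2 x \<delta>")
    case True
    have x: "\<bar>x\<bar> \<le> \<bar>y\<bar> + 2" "\<bar>y\<bar> - 2 \<le> \<bar>x\<bar>"
      using exp_interval_bounded(2,3)[OF True \<delta>] by auto
    have "\<delta> * (\<bar>y\<bar> - 2) \<le> \<delta> * \<bar>x\<bar>" using x \<delta> by (intro mult_left_mono) auto
    then have "exp (- \<delta> * \<bar>x\<bar>) \<le> exp (2 * \<delta> + - \<delta> * \<bar>y\<bar>)"
      by (subst exp_le_cancel_iff) (simp add: algebra_simps)
    then have "2 * exp (- \<delta> * \<bar>x\<bar>) \<le> r" unfolding exp_add r_def by simp
    then have "\<bar>y - x\<bar> \<le> r" using True by (simp add: mem_exp_interval)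
    then have mem: "x \<in> {y - r..y + r}" by (auto simp: abs_le_iff)
    have "(1 + \<bar>x\<bar>) powr n * exp (\<delta> * \<bar>x\<bar>) \<le> w"
      unfolding w_def using x \<delta> n by (intro mult_mono powr_mono2) auto
    then show ?thesis using True mem by (simp add: ennreal_leI)
  qed simp
  have "(\<integral>\<^sup>+x. ennreal ((1 + \<bar>x\<bar>) powr n * exp (\<delta> * \<bar>x\<bar>)) * indicator (exp_interval 2 x \<delta>) y \<partial>lborel) \<le>
    (\<integral>\<^sup>+x. ennreal w * indicator {y - r..y + r} x \<partial>lborel)"
    by (rule nn_integral_mono) (rule pt)
  also have "\<dots> = ennreal (w * (2 * r))"
    using r by (simp add: nn_integral_cmult_indicator ennreal_mult w_def)
  also have "w * (2 * r) = 4 * exp (4 * \<delta>) * 3 powr n * (1 + \<bar>y\<bar>) powr n"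
  proof -
    have "exp (\<delta> * (\<bar>y\<bar> + 2)) * (exp (2 * \<delta>) * exp (- \<delta> * \<bar>y\<bar>)) = exp (4 * \<delta>)"
      by (simp add: algebra_simps flip: exp_add)
    moreover have "w * (2 * r) = 4 * (3 * (1 + \<bar>y\<bar>)) powr n *
        (exp (\<delta> * (\<bar>y\<bar> + 2)) * (exp (2 * \<delta>) * exp (- \<delta> * \<bar>y\<bar>)))"
      unfolding w_def r_def by simp
    ultimately have "w * (2 * r) = 4 * (3 * (1 + \<bar>y\<bar>)) powr n * exp (4 * \<delta>)" by (simp only:)
    also have "(3 * (1 + \<bar>y\<bar>)) powr n = 3 powr n * (1 + \<bar>y\<bar>) powr n" by (rule powr_mult)
    finally show ?thesis by (simp only: mult_ac)
  qed
  finally show ?thesis .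
qed

text \<open>
  Both errors come from the supremum \<open>s\<close> of \<open>\<phi>\<close> on the short interval: against the first term of the
  domination \<open>s\<close> is compared with \<open>P\<close> on the doubled interval, against the exponentially small second term
  it is estimated by \<open>q\<close>.
\<close>

lemma integral_over_short_interval:
  assumes \<phi>P: "\<And>y y'. y \<in> exp_interval 1 x \<delta> \<Longrightarrow> y' \<in> exp_interval 2 x \<delta> \<Longrightarrow> \<phi> y \<le> P y' + p"
    and \<phi>q: "\<And>y. y \<in> exp_interval 1 x \<delta> \<Longrightarrow> \<phi> y \<le> q"
    and P [measurable]: "P \<in> borel_measurable borel"
  shows "(\<integral>\<^sup>+y. \<phi> y * indicator (exp_interval 1 x \<delta>) y \<partial>M) \<le>
     ennreal (C * (1 + \<bar>x\<bar>) powr n) *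
       ((\<integral>\<^sup>+y. P y * indicator (exp_interval 2 x \<delta>) y \<partial>N)
        + (p * emeasure N (exp_interval 2 x \<delta>) + ennreal (exp (- 2 * \<delta> * \<bar>x\<bar>)) * q))"
proof -
  have [measurable_cong]: "sets N = sets borel" "sets M = sets borel" by (rule sets_N, rule sets_M)
  have I [measurable]: "exp_interval r x \<delta> \<in> sets borel" for r by (simp add: exp_interval_def)
  define s where "s = (SUP y\<in>exp_interval 1 x \<delta>. \<phi> y)"
  have "(\<integral>\<^sup>+y. \<phi> y * indicator (exp_interval 1 x \<delta>) y \<partial>M) \<le> (\<integral>\<^sup>+y. s * indicator (exp_interval 1 x \<delta>) y \<partial>M)"
    by (intro nn_integral_mono) (auto simp: indicator_def s_def intro: SUP_upper)
  also have "\<dots> = s * emeasure M (exp_interval 1 x \<delta>)"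
    by (rule nn_integral_cmult_indicator) measurable
  also have "\<dots> \<le> s * (ennreal (C * (1 + \<bar>x\<bar>) powr n) * (emeasure N (exp_interval 2 x \<delta>) + ennreal (exp (- 2 * \<delta> * \<bar>x\<bar>))))"
    by (intro mult_left_mono dom) simp
  also have "\<dots> = ennreal (C * (1 + \<bar>x\<bar>) powr n) * (s * emeasure N (exp_interval 2 x \<delta>) + ennreal (exp (- 2 * \<delta> * \<bar>x\<bar>)) * s)"
    by (simp add: distrib_left mult_ac)
  also have "\<dots> \<le> ennreal (C * (1 + \<bar>x\<bar>) powr n) *
       ((\<integral>\<^sup>+y. P y * indicator (exp_interval 2 x \<delta>) y \<partial>N)
        + (p * emeasure N (exp_interval 2 x \<delta>) + ennreal (exp (- 2 * \<delta> * \<bar>x\<bar>)) * q))"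
  proof (intro mult_left_mono)
    have "s * emeasure N (exp_interval 2 x \<delta>) = (\<integral>\<^sup>+y. s * indicator (exp_interval 2 x \<delta>) y \<partial>N)"
      by (rule nn_integral_cmult_indicator[symmetric]) measurable
    also have "\<dots> \<le> (\<integral>\<^sup>+y. P y * indicator (exp_interval 2 x \<delta>) y + p * indicator (exp_interval 2 x \<delta>) y \<partial>N)"
      by (intro nn_integral_mono) (auto simp: indicator_def s_def intro!: SUP_least \<phi>P)
    also have "\<dots> = (\<integral>\<^sup>+y. P y * indicator (exp_interval 2 x \<delta>) y \<partial>N) + (\<integral>\<^sup>+y. p * indicator (exp_interval 2 x \<delta>) y \<partial>N)"
      by (intro nn_integral_add) measurable
    also have "(\<integral>\<^sup>+y. p * indicator (exp_interval 2 x \<delta>) y \<partial>N) = p * emeasure N (exp_interval 2 x \<delta>)"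
      by (rule nn_integral_cmult_indicator) measurable
    finally have 1: "s * emeasure N (exp_interval 2 x \<delta>) \<le>
      (\<integral>\<^sup>+y. P y * indicator (exp_interval 2 x \<delta>) y \<partial>N) + p * emeasure N (exp_interval 2 x \<delta>)" .
    have "s \<le> q" unfolding s_def by (intro SUP_least \<phi>q)
    then have 2: "ennreal (exp (- 2 * \<delta> * \<bar>x\<bar>)) * s \<le> ennreal (exp (- 2 * \<delta> * \<bar>x\<bar>)) * q" by (intro mult_left_mono) auto
    show "s * emeasure N (exp_interval 2 x \<delta>) + ennreal (exp (- 2 * \<delta> * \<bar>x\<bar>)) * s \<le>
       (\<integral>\<^sup>+y. P y * indicator (exp_interval 2 x \<delta>) y \<partial>N)
        + (p * emeasure N (exp_interval 2 x \<delta>) + ennreal (exp (- 2 * \<delta> * \<bar>x\<bar>)) * q)"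
      using add_mono[OF 1 2] by (simp add: add.assoc)
  qed simp
  finally show ?thesis .
qed

text \<open>
  The estimate on short intervals is integrated over their centres with weight \<open>exp (\<delta> * \<bar>x\<bar>)\<close> and the
  order of integration is exchanged. In the applications \<open>\<phi>\<close> varies slowly apart from a cutoff, \<open>P\<close> is a multiple of the uncut function, and
  the error terms with \<open>p\<close> and \<open>q\<close> are integrable against that weight.
\<close>

lemma nn_integral_transfer:
  assumes \<phi>P: "\<And>x y y'. y \<in> exp_interval 1 x \<delta> \<Longrightarrow> y' \<in> exp_interval 2 x \<delta> \<Longrightarrow> \<phi> y \<le> P y' + p x"
    and \<phi>q: "\<And>x y. y \<in> exp_interval 1 x \<delta> \<Longrightarrow> \<phi> y \<le> q x"
    and [measurable]: "\<phi> \<in> borel_measurable borel" "P \<in> borel_measurable borel"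
      "p \<in> borel_measurable borel" "q \<in> borel_measurable borel"
  shows "(\<integral>\<^sup>+y. \<phi> y \<partial>M) \<le> ennreal (exp (2 * \<delta>) / 2) * (ennreal C *
     (ennreal (4 * exp (4 * \<delta>) * 3 powr n) * (\<integral>\<^sup>+y. P y * ennreal ((1 + \<bar>y\<bar>) powr n) \<partial>N)
      + (\<integral>\<^sup>+x. ennreal ((1 + \<bar>x\<bar>) powr n * exp (\<delta> * \<bar>x\<bar>)) *
           (p x * emeasure N (exp_interval 2 x \<delta>) + ennreal (exp (- 2 * \<delta> * \<bar>x\<bar>)) * q x) \<partial>lborel)))"
proof -
  interpret M: sigma_finite_measure M by (rule sigma_finite_M)
  interpret N: sigma_finite_measure N by (rule sigma_finite_N)
  interpret PM: pair_sigma_finite M lborel by standard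
  interpret PN: pair_sigma_finite N lborel by standard
  have [measurable_cong]: "sets N = sets borel" "sets M = sets borel" by (rule sets_N, rule sets_M)
  let ?I = "\<lambda>r x. indicator (exp_interval r x \<delta>) :: real \<Rightarrow> ennreal"
  let ?e = "\<lambda>x. ennreal (exp (\<delta> * \<bar>x\<bar>))"
  let ?w = "\<lambda>x. ennreal ((1 + \<bar>x\<bar>) powr n * exp (\<delta> * \<bar>x\<bar>))"
  let ?a = "ennreal (exp (2 * \<delta>) / 2)"
  have I1 [measurable]: "(\<lambda>z. ?I r (snd z) (fst z)) \<in> borel_measurable (borel \<Otimes>\<^sub>M borel)" for r
    using measurable_exp_interval[of r] by (simp add: case_prod_beta)
  have I2 [measurable]: "(\<lambda>x. ?I r x y) \<in> borel_measurable borel" for r y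
  proof -
    have "(\<lambda>x. (y, x)) \<in> borel \<rightarrow>\<^sub>M (borel \<Otimes>\<^sub>M borel)" by measurable
    from measurable_compose[OF this I1] show ?thesis by simp
  qed
  have "(\<integral>\<^sup>+y. \<phi> y \<partial>M) \<le> (\<integral>\<^sup>+y. ?a * (\<integral>\<^sup>+x. \<phi> y * (?e x * ?I 1 x y) \<partial>lborel) \<partial>M)"
  proof (rule nn_integral_mono)
    fix y
    have "\<phi> y * 1 \<le> \<phi> y * (?a * (\<integral>\<^sup>+x. ?e x * ?I 1 x y \<partial>lborel))"
      by (intro mult_left_mono weight_lower) simp
    also have "\<dots> = ?a * (\<phi> y * (\<integral>\<^sup>+x. ?e x * ?I 1 x y \<partial>lborel))" by (simp add: mult_ac)
    also have "\<phi> y * (\<integral>\<^sup>+x. ?e x * ?I 1 x y \<partial>lborel) = (\<integral>\<^sup>+x. \<phi> y * (?e x * ?I 1 x y) \<partial>lborel)"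
      by (intro nn_integral_cmult[symmetric]) measurable
    finally show "\<phi> y \<le> ?a * (\<integral>\<^sup>+x. \<phi> y * (?e x * ?I 1 x y) \<partial>lborel)" by simp
  qed
  also have "\<dots> = ?a * (\<integral>\<^sup>+y. (\<integral>\<^sup>+x. \<phi> y * (?e x * ?I 1 x y) \<partial>lborel) \<partial>M)"
    by (intro nn_integral_cmult) measurable
  also have "(\<integral>\<^sup>+y. (\<integral>\<^sup>+x. \<phi> y * (?e x * ?I 1 x y) \<partial>lborel) \<partial>M) =
      (\<integral>\<^sup>+x. (\<integral>\<^sup>+y. \<phi> y * (?e x * ?I 1 x y) \<partial>M) \<partial>lborel)"
    by (rule PM.Fubini'[symmetric]) measurable
  also have "\<dots> = (\<integral>\<^sup>+x. ?e x * (\<integral>\<^sup>+y. \<phi> y * ?I 1 x y \<partial>M) \<partial>lborel)"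
  proof (rule nn_integral_cong)
    fix x
    have [measurable]: "exp_interval 1 x \<delta> \<in> sets borel" by (simp add: exp_interval_def)
    have "(\<integral>\<^sup>+y. \<phi> y * (?e x * ?I 1 x y) \<partial>M) = (\<integral>\<^sup>+y. ?e x * (\<phi> y * ?I 1 x y) \<partial>M)"
      by (simp add: mult_ac)
    also have "\<dots> = ?e x * (\<integral>\<^sup>+y. \<phi> y * ?I 1 x y \<partial>M)" by (intro nn_integral_cmult) measurable
    finally show "(\<integral>\<^sup>+y. \<phi> y * (?e x * ?I 1 x y) \<partial>M) = ?e x * (\<integral>\<^sup>+y. \<phi> y * ?I 1 x y \<partial>M)" .
  qed
  also have "\<dots> \<le> (\<integral>\<^sup>+x. ennreal C * (?w x * (\<integral>\<^sup>+y. P y * ?I 2 x y \<partial>N)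
     + ?w x * (p x * emeasure N (exp_interval 2 x \<delta>) + ennreal (exp (- 2 * \<delta> * \<bar>x\<bar>)) * q x)) \<partial>lborel)"
  proof (rule nn_integral_mono)
    fix x
    have "?e x * (\<integral>\<^sup>+y. \<phi> y * ?I 1 x y \<partial>M) \<le> ?e x * (ennreal (C * (1 + \<bar>x\<bar>) powr n) *
       ((\<integral>\<^sup>+y. P y * ?I 2 x y \<partial>N) + (p x * emeasure N (exp_interval 2 x \<delta>) + ennreal (exp (- 2 * \<delta> * \<bar>x\<bar>)) * q x)))"
      by (intro mult_left_mono integral_over_short_interval \<phi>P \<phi>q) auto
    also have "\<dots> = ennreal C * (?w x * ((\<integral>\<^sup>+y. P y * ?I 2 x y \<partial>N) + (p x * emeasure N (exp_interval 2 x \<delta>) + ennreal (exp (- 2 * \<delta> * \<bar>x\<bar>)) * q x)))"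
      using C by (simp add: ennreal_mult mult_ac)
    finally show "?e x * (\<integral>\<^sup>+y. \<phi> y * ?I 1 x y \<partial>M) \<le> ennreal C * (?w x * (\<integral>\<^sup>+y. P y * ?I 2 x y \<partial>N)
     + ?w x * (p x * emeasure N (exp_interval 2 x \<delta>) + ennreal (exp (- 2 * \<delta> * \<bar>x\<bar>)) * q x))"
      by (simp add: distrib_left)
  qed
  also have "\<dots> = ennreal C * ((\<integral>\<^sup>+x. ?w x * (\<integral>\<^sup>+y. P y * ?I 2 x y \<partial>N) \<partial>lborel)
     + (\<integral>\<^sup>+x. ?w x * (p x * emeasure N (exp_interval 2 x \<delta>) + ennreal (exp (- 2 * \<delta> * \<bar>x\<bar>)) * q x) \<partial>lborel))"
  proof -
    have PI [measurable]: "(\<lambda>x. \<integral>\<^sup>+y. P y * ?I 2 x y \<partial>N) \<in> borel_measurable borel"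
      by (rule N.borel_measurable_nn_integral) measurable
    have "(\<lambda>x. \<integral>\<^sup>+y. ?I 2 x y \<partial>N) \<in> borel_measurable borel"
      by (rule N.borel_measurable_nn_integral) measurable
    moreover have "(\<integral>\<^sup>+y. ?I 2 x y \<partial>N) = emeasure N (exp_interval 2 x \<delta>)" for x
      by (rule nn_integral_indicator) (simp add: sets_N exp_interval_def)
    ultimately have [measurable]: "(\<lambda>x. emeasure N (exp_interval 2 x \<delta>)) \<in> borel_measurable borel" by simp
    show ?thesis
      by (subst nn_integral_cmult, measurable, subst nn_integral_add, measurable)
  qed
  also have "(\<integral>\<^sup>+x. ?w x * (\<integral>\<^sup>+y. P y * ?I 2 x y \<partial>N) \<partial>lborel) \<le>
      ennreal (4 * exp (4 * \<delta>) * 3 powr n) * (\<integral>\<^sup>+y. P y * ennreal ((1 + \<bar>y\<bar>) powr n) \<partial>N)"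
  proof -
    have "(\<integral>\<^sup>+x. ?w x * (\<integral>\<^sup>+y. P y * ?I 2 x y \<partial>N) \<partial>lborel) = (\<integral>\<^sup>+x. (\<integral>\<^sup>+y. P y * (?w x * ?I 2 x y) \<partial>N) \<partial>lborel)"
    proof (rule nn_integral_cong)
      fix x
      have [measurable]: "exp_interval 2 x \<delta> \<in> sets borel" by (simp add: exp_interval_def)
      have "?w x * (\<integral>\<^sup>+y. P y * ?I 2 x y \<partial>N) = (\<integral>\<^sup>+y. ?w x * (P y * ?I 2 x y) \<partial>N)"
        by (intro nn_integral_cmult[symmetric]) measurable
      then show "?w x * (\<integral>\<^sup>+y. P y * ?I 2 x y \<partial>N) = (\<integral>\<^sup>+y. P y * (?w x * ?I 2 x y) \<partial>N)"
        by (simp add: mult_ac)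
    qed
    also have "\<dots> = (\<integral>\<^sup>+y. (\<integral>\<^sup>+x. P y * (?w x * ?I 2 x y) \<partial>lborel) \<partial>N)"
      by (rule PN.Fubini') measurable
    also have "\<dots> \<le> (\<integral>\<^sup>+y. ennreal (4 * exp (4 * \<delta>) * 3 powr n) * (P y * ennreal ((1 + \<bar>y\<bar>) powr n)) \<partial>N)"
    proof (rule nn_integral_mono)
      fix y
      have "(\<integral>\<^sup>+x. P y * (?w x * ?I 2 x y) \<partial>lborel) = P y * (\<integral>\<^sup>+x. ?w x * ?I 2 x y \<partial>lborel)"
        by (intro nn_integral_cmult) measurable
      also have "\<dots> \<le> P y * ennreal (4 * exp (4 * \<delta>) * 3 powr n * (1 + \<bar>y\<bar>) powr n)"
        by (intro mult_left_mono weight_upper) simp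
      also have "\<dots> = ennreal (4 * exp (4 * \<delta>) * 3 powr n) * (P y * ennreal ((1 + \<bar>y\<bar>) powr n))"
        by (simp add: ennreal_mult mult_ac)
      finally show "(\<integral>\<^sup>+x. P y * (?w x * ?I 2 x y) \<partial>lborel) \<le>
        ennreal (4 * exp (4 * \<delta>) * 3 powr n) * (P y * ennreal ((1 + \<bar>y\<bar>) powr n))" .
    qed
    also have "\<dots> = ennreal (4 * exp (4 * \<delta>) * 3 powr n) * (\<integral>\<^sup>+y. P y * ennreal ((1 + \<bar>y\<bar>) powr n) \<partial>N)"
      by (intro nn_integral_cmult) measurable
    finally show ?thesis .
  qed
  finally show ?thesis by (simp add: mult_left_mono add_mono)
qed

context
  fixes k :: real
  assumes k: "k \<ge> 0" and growth: "(\<integral>\<^sup>+x. ennreal ((1 + \<bar>x\<bar>) powr (- k)) \<partial>N) < \<infinity>"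
begin

lemma emeasure_interval_polynomial:
  obtains g where "g \<ge> 0" "\<And>x. emeasure N (exp_interval 2 x \<delta>) \<le> ennreal (g * (1 + \<bar>x\<bar>) powr k)"
proof -
  have [measurable_cong]: "sets N = sets borel" by (rule sets_N)
  obtain G where G: "G \<ge> 0" "(\<integral>\<^sup>+x. ennreal ((1 + \<bar>x\<bar>) powr (- k)) \<partial>N) = ennreal G"
    using growth by (cases "\<integral>\<^sup>+x. ennreal ((1 + \<bar>x\<bar>) powr (- k)) \<partial>N") auto
  have "emeasure N (exp_interval 2 x \<delta>) \<le> ennreal (3 powr k * G * (1 + \<bar>x\<bar>) powr k)" for x
  proof -
    have [measurable]: "exp_interval 2 x \<delta> \<in> sets borel" by (simp add: exp_interval_def)
    have "emeasure N (exp_interval 2 x \<delta>) = (\<integral>\<^sup>+y. indicator (exp_interval 2 x \<delta>) y \<partial>N)"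
      by (rule nn_integral_indicator[symmetric]) measurable
    also have "\<dots> \<le> (\<integral>\<^sup>+y. ennreal ((3 * (1 + \<bar>x\<bar>)) powr k) * ennreal ((1 + \<bar>y\<bar>) powr (- k)) \<partial>N)"
    proof (rule nn_integral_mono)
      fix y
      show "indicator (exp_interval 2 x \<delta>) y \<le> ennreal ((3 * (1 + \<bar>x\<bar>)) powr k) * ennreal ((1 + \<bar>y\<bar>) powr (- k))"
      proof (cases "y \<in> exp_interval 2 x \<delta>")
        case True
        then have "1 + \<bar>y\<bar> \<le> 3 * (1 + \<bar>x\<bar>)" using exp_interval_bounded(2)[OF True \<delta>] by simp
        then have "(1 + \<bar>y\<bar>) powr k \<le> (3 * (1 + \<bar>x\<bar>)) powr k" using k by (intro powr_mono2) auto
        moreover have "0 < (1 + \<bar>y\<bar>) powr k" using abs_ge_zero[of y] by (simp add: powr_gt_zero)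
        ultimately have "1 \<le> (3 * (1 + \<bar>x\<bar>)) powr k * (1 + \<bar>y\<bar>) powr (- k)"
          by (simp add: powr_minus divide_inverse[symmetric] le_divide_eq)
        then have "ennreal 1 \<le> ennreal ((3 * (1 + \<bar>x\<bar>)) powr k * (1 + \<bar>y\<bar>) powr (- k))" by (rule ennreal_leI)
        then show ?thesis using True by (simp add: ennreal_mult)
      qed simp
    qed
    also have "\<dots> = ennreal ((3 * (1 + \<bar>x\<bar>)) powr k) * ennreal G"
      unfolding G(2)[symmetric] by (intro nn_integral_cmult) measurable
    also have "\<dots> = ennreal (3 powr k * G * (1 + \<bar>x\<bar>) powr k)"
      unfolding powr_mult using G(1) by (simp add: mult_ac flip: ennreal_mult)
    finally show ?thesis .
  qed
  with G(1) show ?thesis by (intro that[of "3 powr k * G"]) auto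
qed

text \<open>
  The function \<open>(1 + \<bar>y\<bar>) powr (- s)\<close> changes at most by a constant factor over a bounded distance, so the
  transfer works with \<open>p = 0\<close>, and the factor \<open>exp (- 2 * \<delta> * \<bar>x\<bar>)\<close> beats the weight.
\<close>

lemma dominated_polynomial_growth:
  "(\<integral>\<^sup>+y. ennreal ((1 + \<bar>y\<bar>) powr (- (k + n))) \<partial>M) < \<infinity>"
proof -
  have [measurable_cong]: "sets N = sets borel" by (rule sets_N)
  define s where "s = k + n"
  have s: "s \<ge> 0" using k n by (simp add: s_def)
  have pos: "0 < (1 + \<bar>y\<bar>) powr s" for y :: real using abs_ge_zero[of y] by (simp add: powr_gt_zero)
  define \<phi> where "\<phi> y = ennreal ((1 + \<bar>y\<bar>) powr (- s))" for y
  define P where "P y = ennreal (4 powr s) * \<phi> y" for y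
  have \<phi>: "\<phi> y \<le> P y'" if "\<bar>y'\<bar> \<le> \<bar>y\<bar> + 3" for y y'
  proof -
    have "(1 + \<bar>y'\<bar>) powr s \<le> (4 * (1 + \<bar>y\<bar>)) powr s" using that s by (intro powr_mono2) auto
    also have "\<dots> = 4 powr s * (1 + \<bar>y\<bar>) powr s" by (rule powr_mult)
    finally have "(1 + \<bar>y\<bar>) powr (- s) \<le> 4 powr s * (1 + \<bar>y'\<bar>) powr (- s)"
      using pos[of y] pos[of y'] by (simp add: powr_minus field_simps)
    then have "ennreal ((1 + \<bar>y\<bar>) powr (- s)) \<le> ennreal (4 powr s * (1 + \<bar>y'\<bar>) powr (- s))" by (rule ennreal_leI)
    then show ?thesis by (simp add: \<phi>_def P_def ennreal_mult)
  qed
  have [measurable]: "\<phi> \<in> borel_measurable borel" "P \<in> borel_measurable borel"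
    unfolding \<phi>_def[abs_def] P_def[abs_def] by measurable
  have "(\<integral>\<^sup>+y. \<phi> y \<partial>M) \<le> ennreal (exp (2 * \<delta>) / 2) * (ennreal C *
     (ennreal (4 * exp (4 * \<delta>) * 3 powr n) * (\<integral>\<^sup>+y. P y * ennreal ((1 + \<bar>y\<bar>) powr n) \<partial>N)
      + (\<integral>\<^sup>+x. ennreal ((1 + \<bar>x\<bar>) powr n * exp (\<delta> * \<bar>x\<bar>)) *
           (0 * emeasure N (exp_interval 2 x \<delta>) + ennreal (exp (- 2 * \<delta> * \<bar>x\<bar>)) * P x) \<partial>lborel)))"
  proof (rule nn_integral_transfer)
    fix x y y'
    assume y: "y \<in> exp_interval 1 x \<delta>" and y': "y' \<in> exp_interval 2 x \<delta>"
    have "\<bar>y'\<bar> \<le> \<bar>y\<bar> + 3"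
      using exp_interval_bounded(2)[OF y' \<delta>] exp_interval_bounded(3)[OF y \<delta>] by simp
    then show "\<phi> y \<le> P y' + 0" using \<phi> by simp
  next
    fix x y
    assume y: "y \<in> exp_interval 1 x \<delta>"
    show "\<phi> y \<le> P x" using exp_interval_bounded(3)[OF y \<delta>] by (intro \<phi>) simp
  qed measurable
  also have "\<dots> < \<infinity>"
  proof -
    have "(\<integral>\<^sup>+y. P y * ennreal ((1 + \<bar>y\<bar>) powr n) \<partial>N) = (\<integral>\<^sup>+y. ennreal (4 powr s) * ennreal ((1 + \<bar>y\<bar>) powr (- k)) \<partial>N)"
    proof (rule nn_integral_cong)
      fix y :: real
      have "(1 + \<bar>y\<bar>) powr (- s) * (1 + \<bar>y\<bar>) powr n = (1 + \<bar>y\<bar>) powr (- k)"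
        by (simp add: s_def flip: powr_add)
      then show "P y * ennreal ((1 + \<bar>y\<bar>) powr n) = ennreal (4 powr s) * ennreal ((1 + \<bar>y\<bar>) powr (- k))"
        by (simp add: P_def \<phi>_def mult.assoc flip: ennreal_mult)
    qed
    also have "\<dots> = ennreal (4 powr s) * (\<integral>\<^sup>+y. ennreal ((1 + \<bar>y\<bar>) powr (- k)) \<partial>N)"
      by (intro nn_integral_cmult) measurable
    also have "\<dots> < \<infinity>" using growth by (simp add: ennreal_mult_less_top)
    finally have 1: "(\<integral>\<^sup>+y. P y * ennreal ((1 + \<bar>y\<bar>) powr n) \<partial>N) < \<infinity>" .
    have "(\<integral>\<^sup>+x. ennreal ((1 + \<bar>x\<bar>) powr n * exp (\<delta> * \<bar>x\<bar>)) *
           (0 * emeasure N (exp_interval 2 x \<delta>) + ennreal (exp (- 2 * \<delta> * \<bar>x\<bar>)) * P x) \<partial>lborel)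
        \<le> (\<integral>\<^sup>+x. ennreal (4 powr s) * ennreal (exp (- \<delta> * \<bar>x\<bar>)) \<partial>lborel)"
    proof (rule nn_integral_mono)
      fix x :: real
      have "(1 + \<bar>x\<bar>) powr n * (1 + \<bar>x\<bar>) powr (- s) = (1 + \<bar>x\<bar>) powr (- k)"
        by (simp add: s_def flip: powr_add)
      moreover have "(1 + \<bar>x\<bar>) powr (- k) \<le> 1"
      proof -
        have "(1 + \<bar>x\<bar>) powr (- k) \<le> (1 + \<bar>x\<bar>) powr 0" using k by (intro powr_mono) auto
        also have "\<dots> = 1"
        proof -
          have "1 + \<bar>x\<bar> \<noteq> 0" using abs_ge_zero[of x] by linarith
          then show ?thesis by simp
        qed
        finally show ?thesis .
      qed
      moreover have "exp (\<delta> * \<bar>x\<bar>) * exp (- 2 * \<delta> * \<bar>x\<bar>) = exp (- \<delta> * \<bar>x\<bar>)" by (simp flip: exp_add)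
      ultimately have "((1 + \<bar>x\<bar>) powr n * (1 + \<bar>x\<bar>) powr (- s)) * (exp (\<delta> * \<bar>x\<bar>) * exp (- 2 * \<delta> * \<bar>x\<bar>)) * 4 powr s
          \<le> 1 * exp (- \<delta> * \<bar>x\<bar>) * 4 powr s"
        by (intro mult_mono) auto
      then have "ennreal (((1 + \<bar>x\<bar>) powr n * exp (\<delta> * \<bar>x\<bar>)) * (exp (- 2 * \<delta> * \<bar>x\<bar>) * (4 powr s * (1 + \<bar>x\<bar>) powr (- s))))
          \<le> ennreal (4 powr s * exp (- \<delta> * \<bar>x\<bar>))"
        by (intro ennreal_leI) (simp add: mult_ac)
      then show "ennreal ((1 + \<bar>x\<bar>) powr n * exp (\<delta> * \<bar>x\<bar>)) *
           (0 * emeasure N (exp_interval 2 x \<delta>) + ennreal (exp (- 2 * \<delta> * \<bar>x\<bar>)) * P x)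
         \<le> ennreal (4 powr s) * ennreal (exp (- \<delta> * \<bar>x\<bar>))"
        unfolding P_def \<phi>_def by (simp add: ennreal_mult)
    qed
    also have "\<dots> = ennreal (4 powr s) * (\<integral>\<^sup>+x. ennreal (exp (- \<delta> * \<bar>x\<bar>)) \<partial>lborel)"
      by (intro nn_integral_cmult) measurable
    also have "\<dots> < \<infinity>" using nn_integral_exp_abs_finite[OF \<delta>] by (simp add: ennreal_mult_less_top)
    finally have 2: "(\<integral>\<^sup>+x. ennreal ((1 + \<bar>x\<bar>) powr n * exp (\<delta> * \<bar>x\<bar>)) *
           (0 * emeasure N (exp_interval 2 x \<delta>) + ennreal (exp (- 2 * \<delta> * \<bar>x\<bar>)) * P x) \<partial>lborel) < \<infinity>" .
    show ?thesis
      unfolding infinity_ennreal_def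
      by (intro ennreal_mult_less_top[THEN iffD2] disjI2 conjI ennreal_add_less_top[THEN iffD2])
         (use 1 2 in auto)
  qed
  finally show ?thesis by (simp add: \<phi>_def s_def)
qed

text \<open>
  On an interval of length of order \<open>exp (- \<delta> * \<bar>x\<bar>)\<close> the function \<open>F\<close> oscillates at most by
  \<open>3 * m * exp (- 3 / 4 * \<delta> * \<bar>x\<bar>)\<close>. After squaring, this beats the weight \<open>exp (\<delta> * \<bar>x\<bar>)\<close>, as does
  \<open>exp (- 2 * \<delta> * \<bar>x\<bar>) * \<bar>F\<bar>\<^sup>2\<close>. The total error is therefore a convergent integral, and a small multiple of
  \<open>m\<^sup>2\<close> if only centres with \<open>\<bar>x\<bar> > R - 1\<close> contribute. The radius \<open>R\<close> does not depend on \<open>F\<close>.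
\<close>

lemma tail_estimate:
  obtains K where "K \<ge> 0"
    "\<And>\<theta>. \<theta> > 0 \<Longrightarrow> \<exists>R\<ge>0. \<forall>F m. controlled_growth (\<delta> / 4) m F \<longrightarrow>
       (\<integral>\<^sup>+y. ennreal ((cmod (F y))\<^sup>2) * indicator {y. R < \<bar>y\<bar>} y \<partial>M) \<le>
         ennreal K * (\<integral>\<^sup>+y. ennreal ((cmod (F y))\<^sup>2 * (1 + \<bar>y\<bar>) powr n) \<partial>N) + ennreal (\<theta> * m\<^sup>2)"
proof -
  have [measurable_cong]: "sets N = sets borel" by (rule sets_N)
  obtain g where g: "g \<ge> 0" "\<And>x. emeasure N (exp_interval 2 x \<delta>) \<le> ennreal (g * (1 + \<bar>x\<bar>) powr k)"
    using emeasure_interval_polynomial by blast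
  obtain L where L: "L \<ge> 0" "\<And>x. (1 + \<bar>x\<bar>) powr (n + k) \<le> L * exp (\<delta> / 4 * \<bar>x\<bar>)"
    using powr_le_exp[of "n + k" "\<delta> / 4"] n k \<delta> by auto
  obtain J where J: "J \<ge> 0" "(\<integral>\<^sup>+x. ennreal (exp (- (\<delta> / 8) * \<bar>x\<bar>)) \<partial>lborel) = ennreal J"
    using nn_integral_exp_abs_finite[of "\<delta> / 8"] \<delta>
    by (cases "\<integral>\<^sup>+x. ennreal (exp (- (\<delta> / 8) * \<bar>x\<bar>)) \<partial>lborel") auto
  define a where "a = exp (2 * \<delta>) / 2 * C"
  have a: "a \<ge> 0" using C by (simp add: a_def)
  define H where "H = a * ((18 * g + 1) * L * J)"
  have H: "H \<ge> 0" using a g L J by (simp add: H_def)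
  define K where "K = a * (4 * exp (4 * \<delta>) * 3 powr n) * 2"
  have "\<exists>R\<ge>0. \<forall>F m. controlled_growth (\<delta> / 4) m F \<longrightarrow>
       (\<integral>\<^sup>+y. ennreal ((cmod (F y))\<^sup>2) * indicator {y. R < \<bar>y\<bar>} y \<partial>M) \<le>
         ennreal K * (\<integral>\<^sup>+y. ennreal ((cmod (F y))\<^sup>2 * (1 + \<bar>y\<bar>) powr n) \<partial>N) + ennreal (\<theta> * m\<^sup>2)"
    if \<theta>: "\<theta> > 0" for \<theta>
  proof -
    \<comment> \<open>From \<open>exp t \<ge> 1 + t\<close>, it is enough that \<open>\<delta> / 8 * (R - 1) \<ge> H / \<theta>\<close>.\<close>
    define R where "R = 1 + 8 * H / (\<theta> * \<delta>)"
    have e: "\<delta> / 8 * (R - 1) = H / \<theta>" using \<delta> \<theta> by (simp add: R_def)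
    have "H / \<theta> \<le> exp (\<delta> / 8 * (R - 1))" unfolding e using exp_ge_add_one_self[of "H / \<theta>"] by linarith
    then have "H * exp (- (\<delta> / 8) * (R - 1)) \<le> \<theta>"
      using \<theta> by (simp add: exp_minus field_simps)
    moreover have "R \<ge> 0" using H \<theta> \<delta> by (simp add: R_def)
    ultimately have R: "R \<ge> 0" "H * exp (- (\<delta> / 8) * (R - 1)) \<le> \<theta>" by auto
    show ?thesis
    proof (intro exI[of _ R] conjI allI impI R(1))
      fix F :: "real \<Rightarrow> complex" and m :: real
      assume "controlled_growth (\<delta> / 4) m F"
      then have [measurable]: "F \<in> borel_measurable borel" and m: "m \<ge> 0"
        and Fm: "\<forall>x y. \<bar>y - x\<bar> \<le> 2 \<longrightarrow> cmod (F y) \<le> m * exp (\<delta> / 4 * \<bar>x\<bar>)"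
        and Fd: "\<forall>x y y'. \<bar>y - x\<bar> \<le> 2 \<longrightarrow> \<bar>y' - x\<bar> \<le> 2 \<longrightarrow> cmod (F y - F y') \<le> \<bar>y - y'\<bar> * (m * exp (\<delta> / 4 * \<bar>x\<bar>))"
        by (simp_all add: controlled_growth_def)
      define T where "T = {x::real. R - 1 < \<bar>x\<bar>}"
      have [measurable]: "T \<in> sets borel" unfolding T_def by measurable
      define \<phi> where "\<phi> y = ennreal ((cmod (F y))\<^sup>2) * indicator {y. R < \<bar>y\<bar>} y" for y
      define P where "P y = ennreal (2 * (cmod (F y))\<^sup>2)" for y
      define p where "p x = ennreal (18 * m\<^sup>2 * exp (- (3 / 2 * \<delta>) * \<bar>x\<bar>)) * indicator T x" for x
      define q where "q x = ennreal (m\<^sup>2 * exp (\<delta> / 2 * \<bar>x\<bar>)) * indicator T x" for x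
      have sq: "(m * exp (\<delta> / 4 * \<bar>x\<bar>))\<^sup>2 = m\<^sup>2 * exp (\<delta> / 2 * \<bar>x\<bar>)" for x
        by (simp add: power_mult_distrib flip: exp_double)
      have "(\<integral>\<^sup>+y. \<phi> y \<partial>M) \<le> ennreal (exp (2 * \<delta>) / 2) * (ennreal C *
       (ennreal (4 * exp (4 * \<delta>) * 3 powr n) * (\<integral>\<^sup>+y. P y * ennreal ((1 + \<bar>y\<bar>) powr n) \<partial>N)
        + (\<integral>\<^sup>+x. ennreal ((1 + \<bar>x\<bar>) powr n * exp (\<delta> * \<bar>x\<bar>)) *
             (p x * emeasure N (exp_interval 2 x \<delta>) + ennreal (exp (- 2 * \<delta> * \<bar>x\<bar>)) * q x) \<partial>lborel)))"
      proof (rule nn_integral_transfer)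
        fix x y y'
        assume y: "y \<in> exp_interval 1 x \<delta>" and y': "y' \<in> exp_interval 2 x \<delta>"
        show "\<phi> y \<le> P y' + p x"
        proof (cases "R < \<bar>y\<bar>")
          case True
          then have xT: "x \<in> T" using exp_interval_bounded(2)[OF y \<delta>] by (simp add: T_def)
          have "\<bar>y - y'\<bar> \<le> \<bar>y - x\<bar> + \<bar>y' - x\<bar>" by linarith
          also have "\<dots> \<le> 3 * exp (- \<delta> * \<bar>x\<bar>)" using y y' by (simp add: mem_exp_interval)
          finally have yy: "\<bar>y - y'\<bar> \<le> 3 * exp (- \<delta> * \<bar>x\<bar>)" .
          have "cmod (F y - F y') \<le> \<bar>y - y'\<bar> * (m * exp (\<delta> / 4 * \<bar>x\<bar>))"
            using Fd exp_interval_bounded(1)[OF y \<delta>] exp_interval_bounded(1)[OF y' \<delta>] by simp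
          also have "\<dots> \<le> 3 * exp (- \<delta> * \<bar>x\<bar>) * (m * exp (\<delta> / 4 * \<bar>x\<bar>))"
            using yy m by (intro mult_right_mono) auto
          finally have "(cmod (F y - F y'))\<^sup>2 \<le> (3 * exp (- \<delta> * \<bar>x\<bar>) * (m * exp (\<delta> / 4 * \<bar>x\<bar>)))\<^sup>2"
            by (intro power_mono) auto
          also have "\<dots> = 9 * m\<^sup>2 * (exp (- \<delta> * \<bar>x\<bar>) ^ 2 * exp (\<delta> / 2 * \<bar>x\<bar>))"
            unfolding power_mult_distrib[of "3 * exp (- \<delta> * \<bar>x\<bar>)"] sq by (simp add: power_mult_distrib)
          also have "exp (- \<delta> * \<bar>x\<bar>) ^ 2 * exp (\<delta> / 2 * \<bar>x\<bar>) = exp (- (3 / 2 * \<delta>) * \<bar>x\<bar>)"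
            by (simp flip: exp_double exp_add)
          finally have d: "(cmod (F y - F y'))\<^sup>2 \<le> 9 * m\<^sup>2 * exp (- (3 / 2 * \<delta>) * \<bar>x\<bar>)" .
          have "(cmod (F y))\<^sup>2 \<le> (cmod (F y') + cmod (F y - F y'))\<^sup>2"
            using norm_triangle_ineq[of "F y'" "F y - F y'"] by (intro power_mono) auto
          also have "\<dots> \<le> 2 * (cmod (F y'))\<^sup>2 + 2 * (cmod (F y - F y'))\<^sup>2"
            using zero_le_power2[of "cmod (F y') - cmod (F y - F y')"] by (simp add: power2_sum power2_diff)
          also have "\<dots> \<le> 2 * (cmod (F y'))\<^sup>2 + 18 * m\<^sup>2 * exp (- (3 / 2 * \<delta>) * \<bar>x\<bar>)" using d by simp
          finally have "ennreal ((cmod (F y))\<^sup>2) \<le> ennreal (2 * (cmod (F y'))\<^sup>2 + 18 * m\<^sup>2 * exp (- (3 / 2 * \<delta>) * \<bar>x\<bar>))"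
            by (rule ennreal_leI)
          then show ?thesis using xT True by (simp add: \<phi>_def P_def p_def ennreal_plus)
        qed (simp add: \<phi>_def)
      next
        fix x y
        assume y: "y \<in> exp_interval 1 x \<delta>"
        show "\<phi> y \<le> q x"
        proof (cases "R < \<bar>y\<bar>")
          case True
          then have xT: "x \<in> T" using exp_interval_bounded(2)[OF y \<delta>] by (simp add: T_def)
          have "cmod (F y) \<le> m * exp (\<delta> / 4 * \<bar>x\<bar>)" using Fm exp_interval_bounded(1)[OF y \<delta>] by simp
          then have "(cmod (F y))\<^sup>2 \<le> (m * exp (\<delta> / 4 * \<bar>x\<bar>))\<^sup>2" by (intro power_mono) auto
          then show ?thesis using xT True unfolding sq by (simp add: \<phi>_def q_def ennreal_leI)
        qed (simp add: \<phi>_def)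
      qed (unfold \<phi>_def[abs_def] P_def[abs_def] p_def[abs_def] q_def[abs_def], measurable)
      also have "(\<integral>\<^sup>+x. ennreal ((1 + \<bar>x\<bar>) powr n * exp (\<delta> * \<bar>x\<bar>)) *
             (p x * emeasure N (exp_interval 2 x \<delta>) + ennreal (exp (- 2 * \<delta> * \<bar>x\<bar>)) * q x) \<partial>lborel)
          \<le> ennreal (m\<^sup>2 * ((18 * g + 1) * L) * exp (- (\<delta> / 8) * (R - 1)) * J)"
      proof -
        define B where "B = m\<^sup>2 * ((18 * g + 1) * L) * exp (- (\<delta> / 8) * (R - 1))"
        have B: "B \<ge> 0" using g L by (simp add: B_def)
        have "(\<integral>\<^sup>+x. ennreal ((1 + \<bar>x\<bar>) powr n * exp (\<delta> * \<bar>x\<bar>)) *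
             (p x * emeasure N (exp_interval 2 x \<delta>) + ennreal (exp (- 2 * \<delta> * \<bar>x\<bar>)) * q x) \<partial>lborel)
          \<le> (\<integral>\<^sup>+x. ennreal B * ennreal (exp (- (\<delta> / 8) * \<bar>x\<bar>)) \<partial>lborel)"
        proof (rule nn_integral_mono)
          fix x :: real
          show "ennreal ((1 + \<bar>x\<bar>) powr n * exp (\<delta> * \<bar>x\<bar>)) *
             (p x * emeasure N (exp_interval 2 x \<delta>) + ennreal (exp (- 2 * \<delta> * \<bar>x\<bar>)) * q x)
            \<le> ennreal B * ennreal (exp (- (\<delta> / 8) * \<bar>x\<bar>))"
          proof (cases "x \<in> T")
            case True
            define u where "u = (1 + \<bar>x\<bar>) powr k"
            have u: "1 \<le> u" unfolding u_def using k by (intro ge_one_powr_ge_zero) auto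
            define E1 where "E1 = exp (- (3 / 2 * \<delta>) * \<bar>x\<bar>)"
            have E1: "exp (- 2 * \<delta> * \<bar>x\<bar>) * exp (\<delta> / 2 * \<bar>x\<bar>) = E1" "E1 > 0"
              by (simp_all add: E1_def flip: exp_add)
            have "p x * emeasure N (exp_interval 2 x \<delta>) \<le> ennreal (18 * m\<^sup>2 * E1) * ennreal (g * u)"
              using True g(2)[of x] by (simp add: p_def u_def E1_def mult_left_mono)
            moreover have "ennreal (exp (- 2 * \<delta> * \<bar>x\<bar>)) * q x = ennreal (m\<^sup>2 * E1)"
              using True by (simp add: q_def E1(1)[symmetric] mult_ac flip: ennreal_mult)
            ultimately have "p x * emeasure N (exp_interval 2 x \<delta>) + ennreal (exp (- 2 * \<delta> * \<bar>x\<bar>)) * q x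
              \<le> ennreal (18 * m\<^sup>2 * E1) * ennreal (g * u) + ennreal (m\<^sup>2 * E1)"
              by (simp add: add_right_mono)
            also have "\<dots> = ennreal (18 * m\<^sup>2 * E1 * (g * u) + m\<^sup>2 * E1)"
              using g(1) u E1(2) by (simp add: ennreal_mult ennreal_plus)
            also have "\<dots> \<le> ennreal (m\<^sup>2 * (18 * g + 1) * (E1 * u))"
            proof (rule ennreal_leI)
              have "m\<^sup>2 * E1 * 1 \<le> m\<^sup>2 * E1 * u" using u E1(2) by (intro mult_left_mono) auto
              then show "18 * m\<^sup>2 * E1 * (g * u) + m\<^sup>2 * E1 \<le> m\<^sup>2 * (18 * g + 1) * (E1 * u)"
                by (simp add: algebra_simps)
            qed
            finally have 1: "p x * emeasure N (exp_interval 2 x \<delta>) + ennreal (exp (- 2 * \<delta> * \<bar>x\<bar>)) * q x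
              \<le> ennreal (m\<^sup>2 * (18 * g + 1) * (E1 * u))" .
            have "((1 + \<bar>x\<bar>) powr n * u) * (exp (\<delta> * \<bar>x\<bar>) * E1) = (1 + \<bar>x\<bar>) powr (n + k) * exp (- (\<delta> / 2) * \<bar>x\<bar>)"
              by (simp add: u_def E1_def powr_add flip: exp_add)
            also have "\<dots> \<le> L * exp (\<delta> / 4 * \<bar>x\<bar>) * exp (- (\<delta> / 2) * \<bar>x\<bar>)"
              by (intro mult_right_mono L(2)) simp
            also have "\<dots> = L * (exp (- (\<delta> / 8) * \<bar>x\<bar>) * exp (- (\<delta> / 8) * \<bar>x\<bar>))"
              by (simp add: mult.assoc flip: exp_add)
            also have "\<dots> \<le> L * (exp (- (\<delta> / 8) * (R - 1)) * exp (- (\<delta> / 8) * \<bar>x\<bar>))"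
              using True \<delta> L(1) by (intro mult_left_mono mult_right_mono) (auto simp: T_def)
            finally have "m\<^sup>2 * (18 * g + 1) * (((1 + \<bar>x\<bar>) powr n * u) * (exp (\<delta> * \<bar>x\<bar>) * E1)) \<le>
                m\<^sup>2 * (18 * g + 1) * (L * (exp (- (\<delta> / 8) * (R - 1)) * exp (- (\<delta> / 8) * \<bar>x\<bar>)))"
              using g(1) by (intro mult_left_mono) auto
            then have 2: "((1 + \<bar>x\<bar>) powr n * exp (\<delta> * \<bar>x\<bar>)) * (m\<^sup>2 * (18 * g + 1) * (E1 * u)) \<le> B * exp (- (\<delta> / 8) * \<bar>x\<bar>)"
              unfolding B_def by (simp only: mult_ac)
            have "ennreal ((1 + \<bar>x\<bar>) powr n * exp (\<delta> * \<bar>x\<bar>)) *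
             (p x * emeasure N (exp_interval 2 x \<delta>) + ennreal (exp (- 2 * \<delta> * \<bar>x\<bar>)) * q x)
             \<le> ennreal ((1 + \<bar>x\<bar>) powr n * exp (\<delta> * \<bar>x\<bar>)) * ennreal (m\<^sup>2 * (18 * g + 1) * (E1 * u))"
              by (rule mult_left_mono[OF 1]) simp
            also have "\<dots> = ennreal (((1 + \<bar>x\<bar>) powr n * exp (\<delta> * \<bar>x\<bar>)) * (m\<^sup>2 * (18 * g + 1) * (E1 * u)))"
              using g(1) u E1(2) by (intro ennreal_mult[symmetric]) auto
            also have "\<dots> \<le> ennreal (B * exp (- (\<delta> / 8) * \<bar>x\<bar>))" by (rule ennreal_leI[OF 2])
            also have "\<dots> = ennreal B * ennreal (exp (- (\<delta> / 8) * \<bar>x\<bar>))" using B by (intro ennreal_mult) auto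
            finally show ?thesis .
          qed (simp add: p_def q_def)
        qed
        also have "\<dots> = ennreal B * ennreal J" unfolding J(2)[symmetric] by (intro nn_integral_cmult) measurable
        also have "\<dots> = ennreal (B * J)" using B J(1) by (intro ennreal_mult[symmetric])
        finally show ?thesis by (simp add: B_def)
      qed
      finally have "(\<integral>\<^sup>+y. \<phi> y \<partial>M) \<le> ennreal (exp (2 * \<delta>) / 2) * (ennreal C *
         (ennreal (4 * exp (4 * \<delta>) * 3 powr n) * (\<integral>\<^sup>+y. P y * ennreal ((1 + \<bar>y\<bar>) powr n) \<partial>N)
          + ennreal (m\<^sup>2 * ((18 * g + 1) * L) * exp (- (\<delta> / 8) * (R - 1)) * J)))"
        by (simp add: mult_left_mono add_left_mono)
      also have "(\<integral>\<^sup>+y. P y * ennreal ((1 + \<bar>y\<bar>) powr n) \<partial>N) =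
          2 * (\<integral>\<^sup>+y. ennreal ((cmod (F y))\<^sup>2 * (1 + \<bar>y\<bar>) powr n) \<partial>N)"
        unfolding P_def by (subst nn_integral_cmult[symmetric]) (auto simp: ennreal_mult mult.assoc)
      also have "ennreal (exp (2 * \<delta>) / 2) * (ennreal C *
         (ennreal (4 * exp (4 * \<delta>) * 3 powr n) * (2 * (\<integral>\<^sup>+y. ennreal ((cmod (F y))\<^sup>2 * (1 + \<bar>y\<bar>) powr n) \<partial>N))
          + ennreal (m\<^sup>2 * ((18 * g + 1) * L) * exp (- (\<delta> / 8) * (R - 1)) * J)))
        = ennreal K * (\<integral>\<^sup>+y. ennreal ((cmod (F y))\<^sup>2 * (1 + \<bar>y\<bar>) powr n) \<partial>N)
          + ennreal (m\<^sup>2 * (H * exp (- (\<delta> / 8) * (R - 1))))"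
      proof -
        have "ennreal (exp (2 * \<delta>) / 2) * ennreal C = ennreal a"
          unfolding a_def using C by (intro ennreal_mult[symmetric]) auto
        moreover have "ennreal a * (ennreal (4 * exp (4 * \<delta>) * 3 powr n) * 2) = ennreal K"
        proof -
          have "ennreal K = ennreal a * ennreal (4 * exp (4 * \<delta>) * 3 powr n) * ennreal 2"
            unfolding K_def using a by (simp only: ennreal_mult mult_nonneg_nonneg exp_ge_zero powr_ge_zero zero_le_numeral)
          then show ?thesis by (simp only: mult.assoc ennreal_numeral)
        qed
        moreover have "ennreal a * ennreal (m\<^sup>2 * ((18 * g + 1) * L) * exp (- (\<delta> / 8) * (R - 1)) * J) =
            ennreal (m\<^sup>2 * (H * exp (- (\<delta> / 8) * (R - 1))))"
          unfolding H_def using a g L J by (subst ennreal_mult[symmetric]) (auto simp: mult_ac)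
        ultimately show ?thesis by (metis (no_types, lifting) distrib_left mult.assoc)
      qed
      also have "ennreal (m\<^sup>2 * (H * exp (- (\<delta> / 8) * (R - 1)))) \<le> ennreal (\<theta> * m\<^sup>2)"
        using mult_left_mono[OF R(2), of "m\<^sup>2"] by (intro ennreal_leI) (simp add: mult.commute)
      finally show "(\<integral>\<^sup>+y. ennreal ((cmod (F y))\<^sup>2) * indicator {y. R < \<bar>y\<bar>} y \<partial>M) \<le>
         ennreal K * (\<integral>\<^sup>+y. ennreal ((cmod (F y))\<^sup>2 * (1 + \<bar>y\<bar>) powr n) \<partial>N) + ennreal (\<theta> * m\<^sup>2)"
        by (simp add: \<phi>_def add_left_mono)
    qed
  qed
  then show ?thesis using a by (intro that[of K]) (auto simp: K_def)
qed

end

end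

section \<open>Subexponential bounds on strips\<close>

lemma entire_space_nonvanishing:
  assumes a: "a > 0"
  shows "\<exists>F\<in>entire_space a. \<forall>x::real. \<bar>x\<bar> \<le> R \<longrightarrow> F (of_real x) \<noteq> 0"
proof -
  define s where "s = min (a / 2) (1 / (\<bar>R\<bar> + 1))"
  have s: "s > 0" "s \<le> a / 2" "s * (\<bar>R\<bar> + 1) \<le> 1"
  proof -
    show "s > 0" using a by (auto simp: s_def)
    show "s \<le> a / 2" unfolding s_def by (rule min.cobounded1)
    have "s \<le> 1 / (\<bar>R\<bar> + 1)" unfolding s_def by (rule min.cobounded2)
    then show "s * (\<bar>R\<bar> + 1) \<le> 1" by (simp add: field_simps)
  qed
  from fourier_bump[OF s(1)] obtain f where f: "test_function s f"
    "\<forall>t::real. \<bar>t\<bar> * s < pi / 2 \<longrightarrow> 0 < Re (fourier f (of_real t))" by blast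
  have "fourier f \<in> entire_space a"
    using a s by (intro entire_spaceI[OF a _ _ f(1)]) auto
  moreover have "fourier f (of_real x) \<noteq> 0" if "\<bar>x\<bar> \<le> R" for x
  proof -
    have "\<bar>x\<bar> * s \<le> (\<bar>R\<bar> + 1) * s" using that s by (intro mult_right_mono) auto
    also have "\<dots> < pi / 2" using s(3) pi_gt3 by (simp add: mult.commute)
    finally show ?thesis using f(2) by fastforce
  qed
  ultimately show ?thesis by blast
qed

lemma entire_space_bounded_below_on_imaginary_axis:
  assumes a: "a > 0"
  shows "\<exists>F\<in>entire_space a. \<exists>c>0. \<forall>y\<ge>0. c \<le> cmod (F (\<i> * of_real y))"
proof -
  have s: "a / 2 > 0" using a by simp
  from fourier_bump[OF s] obtain f where f: "test_function (a / 2) f"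
    "\<forall>t::real. \<bar>t\<bar> * (a / 2) < pi / 2 \<longrightarrow> 0 < Re (fourier f (of_real t))"
    "\<forall>y\<ge>0. Re (fourier f 0) \<le> Re (fourier f (\<i> * of_real y))" by blast
  have "fourier f \<in> entire_space a"
    using a by (intro entire_spaceI[OF a _ _ f(1)]) auto
  moreover have "0 < Re (fourier f 0)" using f(2)[rule_format, of 0] by simp
  moreover have "Re (fourier f 0) \<le> cmod (fourier f (\<i> * of_real y))" if "0 \<le> y" for y
    using f(3)[rule_format, OF that] complex_Re_le_cmod[of "fourier f (\<i> * of_real y)"] by linarith
  ultimately show ?thesis by blast
qed

lemma entire_space_division_space:
  assumes "a > 0" "sets M = sets borel" "\<And>F. F \<in> entire_space a \<Longrightarrow> (\<lambda>x. F (of_real x)) \<in> L2_functions M"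
  shows "division_space (entire_space a) M"
  using assms
  by unfold_locales
    (auto intro: entire_space_add entire_space_cmult entire_space_mult_ident entire_space_cnj entire_space_holomorphic
        dest: entire_space_divide)

text \<open>
  The rapid decay of \<open>F\<close> along the line, combined with \<open>1 + \<bar>x\<bar> \<le> (1 + \<bar>x - t\<bar>) * (1 + \<bar>t\<bar>)\<close>.
\<close>

lemma entire_space_shift_decay:
  fixes s :: real
  assumes a: "a > 0" and F: "F \<in> entire_space a"
  obtains D N where "D > 0"
    "\<And>t x::real. (cmod (F (of_real x - of_real t)))\<^sup>2 \<le> D\<^sup>2 * (1 + \<bar>t\<bar>) ^ (2 * N) * (1 + \<bar>x\<bar>) powr (- s)"
proof -
  define N where "N = nat \<lceil>\<bar>s\<bar>\<rceil>"
  have N: "s \<le> 2 * real N" unfolding N_def by linarith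
  obtain D where D: "D > 0" "\<forall>x::real. (1 + \<bar>x\<bar>) ^ N * cmod (F (of_real x)) \<le> D"
    using entire_space_decay[OF a F] by blast
  have "(cmod (F (of_real x - of_real t)))\<^sup>2 \<le> D\<^sup>2 * (1 + \<bar>t\<bar>) ^ (2 * N) * (1 + \<bar>x\<bar>) powr (- s)" for x t :: real
  proof -
    have "1 + \<bar>x\<bar> \<le> (1 + \<bar>x - t\<bar>) * (1 + \<bar>t\<bar>)"
    proof -
      have "\<bar>x\<bar> \<le> \<bar>x - t\<bar> + \<bar>t\<bar>" by linarith
      moreover have "0 \<le> \<bar>x - t\<bar> * \<bar>t\<bar>" by simp
      ultimately have "1 + \<bar>x\<bar> \<le> 1 + \<bar>t\<bar> + \<bar>x - t\<bar> + \<bar>x - t\<bar> * \<bar>t\<bar>" by linarith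
      then show ?thesis by (simp add: algebra_simps)
  qed
    then have "(1 + \<bar>x\<bar>) ^ N \<le> (1 + \<bar>x - t\<bar>) ^ N * (1 + \<bar>t\<bar>) ^ N"
      unfolding power_mult_distrib[symmetric] by (intro power_mono) auto
    then have "(1 + \<bar>x\<bar>) ^ N * cmod (F (of_real (x - t))) \<le> (1 + \<bar>x - t\<bar>) ^ N * (1 + \<bar>t\<bar>) ^ N * cmod (F (of_real (x - t)))"
      by (intro mult_right_mono) auto
    also have "\<dots> \<le> (1 + \<bar>t\<bar>) ^ N * D"
      using mult_left_mono[OF D(2)[rule_format, of "x - t"], of "(1 + \<bar>t\<bar>) ^ N"] by (simp add: mult_ac)
    finally have "((1 + \<bar>x\<bar>) ^ N * cmod (F (of_real (x - t))))\<^sup>2 \<le> ((1 + \<bar>t\<bar>) ^ N * D)\<^sup>2"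
      by (intro power_mono) auto
    then have "(1 + \<bar>x\<bar>) ^ (2 * N) * (cmod (F (of_real x - of_real t)))\<^sup>2 \<le> D\<^sup>2 * (1 + \<bar>t\<bar>) ^ (2 * N)"
      by (simp add: power_mult_distrib mult.commute flip: power_mult)
    moreover have pos: "0 < 1 + \<bar>x\<bar>" by linarith
    moreover have "(1 + \<bar>x\<bar>) powr s \<le> (1 + \<bar>x\<bar>) powr (2 * real N)" using N by (intro powr_mono) auto
    then have "(1 + \<bar>x\<bar>) powr s \<le> (1 + \<bar>x\<bar>) ^ (2 * N)" using pos by (simp flip: powr_realpow)
    then have "(1 + \<bar>x\<bar>) powr s * (cmod (F (of_real x - of_real t)))\<^sup>2 \<le> (1 + \<bar>x\<bar>) ^ (2 * N) * (cmod (F (of_real x - of_real t)))\<^sup>2"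
      by (rule mult_right_mono) simp
    ultimately have "(1 + \<bar>x\<bar>) powr s * (cmod (F (of_real x - of_real t)))\<^sup>2 \<le> D\<^sup>2 * (1 + \<bar>t\<bar>) ^ (2 * N)" by linarith
    then have "(cmod (F (of_real x - of_real t)))\<^sup>2 \<le> D\<^sup>2 * (1 + \<bar>t\<bar>) ^ (2 * N) / (1 + \<bar>x\<bar>) powr s"
      using pos by (simp add: pos_le_divide_eq mult.commute)
    then show ?thesis by (simp add: powr_minus divide_inverse)
  qed
  with D(1) show ?thesis by (rule that)
qed

lemma entire_space_square_integrable:
  assumes a: "a > 0" and sets_M: "sets M = sets borel"
    and growth: "(\<integral>\<^sup>+y. ennreal ((1 + \<bar>y\<bar>) powr (- s)) \<partial>M) < \<infinity>" and F: "F \<in> entire_space a"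
  shows "(\<lambda>x. F (of_real x)) \<in> L2_functions M"
proof -
  have [measurable_cong]: "sets M = sets borel" by (rule sets_M)
  have "continuous_on UNIV (\<lambda>x. F (complex_of_real x))"
    by (rule continuous_on_compose2[OF holomorphic_on_imp_continuous_on[OF entire_space_holomorphic[OF a F]]])
       (auto intro!: continuous_intros)
  then have [measurable]: "(\<lambda>x. F (complex_of_real x)) \<in> borel_measurable borel"
    by (rule borel_measurable_continuous_onI)
  obtain D N where D: "\<And>t x::real. (cmod (F (of_real x - of_real t)))\<^sup>2 \<le> D\<^sup>2 * (1 + \<bar>t\<bar>) ^ (2 * N) * (1 + \<bar>x\<bar>) powr (- s)"
    using entire_space_shift_decay[OF a F] by blast
  have pt: "(cmod (F (of_real x)))\<^sup>2 \<le> D\<^sup>2 * (1 + \<bar>x\<bar>) powr (- s)" for x :: real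
    using D[of x 0] by simp
  have "integrable M (\<lambda>x. (cmod (F (of_real x)))\<^sup>2)"
  proof (rule integrableI_bounded)
    have "(\<integral>\<^sup>+x. ennreal (norm ((cmod (F (of_real x)))\<^sup>2)) \<partial>M) \<le> (\<integral>\<^sup>+x. ennreal (D\<^sup>2) * ennreal ((1 + \<bar>x\<bar>) powr (- s)) \<partial>M)"
      by (intro nn_integral_mono) (simp add: pt ennreal_leI flip: ennreal_mult)
    also have "\<dots> = ennreal (D\<^sup>2) * (\<integral>\<^sup>+x. ennreal ((1 + \<bar>x\<bar>) powr (- s)) \<partial>M)" by (intro nn_integral_cmult) measurable
    also have "\<dots> < \<infinity>" using growth by (simp add: ennreal_mult_less_top)
    finally show "(\<integral>\<^sup>+x. ennreal (norm ((cmod (F (of_real x)))\<^sup>2)) \<partial>M) < \<infinity>" .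
  qed measurable
  then show ?thesis by (simp add: L2_functions_def)
qed

lemma shifted_norm_polynomial:
  assumes a: "a > 0" and sets_M: "sets M = sets borel"
    and growth: "(\<integral>\<^sup>+y. ennreal ((1 + \<bar>y\<bar>) powr (- s)) \<partial>M) < \<infinity>"
    and F: "F \<in> entire_space a"
  obtains D N where "D > 0" "\<And>t. L2_norm M (\<lambda>x. F (of_real x - of_real t)) \<le> D * (1 + \<bar>t\<bar>) ^ N"
proof -
  have [measurable_cong]: "sets M = sets borel" by (rule sets_M)
  obtain D0 N where D0: "D0 > 0"
    and pt: "\<And>t x::real. (cmod (F (of_real x - of_real t)))\<^sup>2 \<le> D0\<^sup>2 * (1 + \<bar>t\<bar>) ^ (2 * N) * (1 + \<bar>x\<bar>) powr (- s)"
    using entire_space_shift_decay[OF a F] by blast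
  obtain G where G: "G \<ge> 0" "(\<integral>\<^sup>+y. ennreal ((1 + \<bar>y\<bar>) powr (- s)) \<partial>M) = ennreal G"
    using growth by (cases "\<integral>\<^sup>+y. ennreal ((1 + \<bar>y\<bar>) powr (- s)) \<partial>M") auto
  have "L2_norm M (\<lambda>x. F (of_real x - of_real t)) \<le> (D0 * (sqrt G + 1)) * (1 + \<bar>t\<bar>) ^ N" for t
  proof (rule power2_le_imp_le)
    have Ft: "(\<lambda>x. F (of_real x - of_real t)) \<in> L2_functions M"
      by (rule entire_space_square_integrable[OF a sets_M growth entire_space_shift[OF a F]])
    have "ennreal ((L2_norm M (\<lambda>x. F (of_real x - of_real t)))\<^sup>2) = (\<integral>\<^sup>+x. ennreal ((cmod (F (of_real x - of_real t)))\<^sup>2) \<partial>M)"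
      unfolding L2_norm_power2 using L2_functionsD(2)[OF Ft] by (intro nn_integral_eq_integral[symmetric]) auto
    also have "\<dots> \<le> (\<integral>\<^sup>+x. ennreal (D0\<^sup>2 * (1 + \<bar>t\<bar>) ^ (2 * N)) * ennreal ((1 + \<bar>x\<bar>) powr (- s)) \<partial>M)"
    proof (rule nn_integral_mono)
      fix x
      have "0 \<le> D0\<^sup>2 * (1 + \<bar>t\<bar>) ^ (2 * N)" by simp
      then show "ennreal ((cmod (F (of_real x - of_real t)))\<^sup>2) \<le> ennreal (D0\<^sup>2 * (1 + \<bar>t\<bar>) ^ (2 * N)) * ennreal ((1 + \<bar>x\<bar>) powr (- s))"
        using pt[of x t] by (simp add: ennreal_leI flip: ennreal_mult)
    qed
    also have "\<dots> = ennreal (D0\<^sup>2 * (1 + \<bar>t\<bar>) ^ (2 * N)) * ennreal G"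
      unfolding G(2)[symmetric] by (intro nn_integral_cmult) measurable
    also have "\<dots> = ennreal (D0\<^sup>2 * (1 + \<bar>t\<bar>) ^ (2 * N) * G)" using G(1) by (intro ennreal_mult[symmetric]) auto
    finally have "(L2_norm M (\<lambda>x. F (of_real x - of_real t)))\<^sup>2 \<le> D0\<^sup>2 * (1 + \<bar>t\<bar>) ^ (2 * N) * G"
      using G(1) by (subst (asm) ennreal_le_iff) auto
    also have "\<dots> \<le> D0\<^sup>2 * (1 + \<bar>t\<bar>) ^ (2 * N) * (sqrt G + 1)\<^sup>2"
      using G(1) by (intro mult_left_mono) (auto simp: power2_sum)
    also have "\<dots> = ((D0 * (sqrt G + 1)) * (1 + \<bar>t\<bar>) ^ N)\<^sup>2"
      by (simp add: power_mult_distrib power_mult[symmetric] mult_ac)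
    finally show "(L2_norm M (\<lambda>x. F (of_real x - of_real t)))\<^sup>2 \<le> ((D0 * (sqrt G + 1)) * (1 + \<bar>t\<bar>) ^ N)\<^sup>2" .
  qed (use D0 G in auto)
  moreover have "D0 * (sqrt G + 1) > 0" using D0 G(1) by (intro mult_pos_pos) (auto simp: add_nonneg_pos)
  ultimately show ?thesis by (intro that[of "D0 * (sqrt G + 1)" N])
qed

text \<open>
  Translates of one \<open>F1\<close> bounded below on the positive imaginary axis are members of the space of polynomially
  bounded norm. Inserted into the majorant estimate, they show that \<open>k\<close> has no zeros, and in fact that
  \<open>\<bar>k\<bar> \<ge> Im z\<close> after multiplication by a polynomial in \<open>z + \<i>\<close>.
\<close>

lemma lower_bounded_majorant:
  assumes a: "a > 0" and sets_M: "sets M = sets borel"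
    and growth: "(\<integral>\<^sup>+y. ennreal ((1 + \<bar>y\<bar>) powr (- s)) \<partial>M) < \<infinity>"
    and ev: "\<And>F. F \<in> entire_space a \<Longrightarrow> cmod (F \<i>) \<le> B * L2_norm M (\<lambda>x. F (of_real x))"
  shows "\<exists>\<Phi> C. \<Phi> holomorphic_on {z. 0 < Im z} \<and> (\<forall>z. 0 < Im z \<longrightarrow> Im z \<le> cmod (\<Phi> z)) \<and> C > 0 \<and>
     (\<forall>F\<in>entire_space a. \<forall>z. 0 < Im z \<longrightarrow> cmod (F z) \<le> C * cmod (\<Phi> z) / Im z * L2_norm M (\<lambda>x. F (of_real x)))"
proof -
  interpret division_space "entire_space a" M by (rule entire_space_division_space[OF a sets_M entire_space_square_integrable[OF a sets_M growth]])
  obtain F1 c where F1: "F1 \<in> entire_space a" "c > 0" "\<forall>y\<ge>0. c \<le> cmod (F1 (\<i> * of_real y))"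
    using entire_space_bounded_below_on_imaginary_axis[OF a] by blast
  have "F1 \<i> \<noteq> 0" using F1(2) F1(3)[rule_format, of 1] by auto
  then have "\<exists>F\<in>entire_space a. F \<i> \<noteq> 0" using F1(1) by blast
  from evaluation_majorant[OF ev this] obtain k C where
    k: "k holomorphic_on {z. 0 < Im z}" "C > 0"
    "\<And>F z. F \<in> entire_space a \<Longrightarrow> 0 < Im z \<Longrightarrow> cmod (F z) \<le> C * cmod (z + \<i>) * kernel_bound z * cmod (k z) * norm_E F"
    by blast
  obtain D N where D: "D > 0" "\<And>t. L2_norm M (\<lambda>x. F1 (of_real x - of_real t)) \<le> D * (1 + \<bar>t\<bar>) ^ N"
    using shifted_norm_polynomial[OF a sets_M growth F1(1)] by blast
  have geo: "kernel_bound z \<le> 2 * cmod (z + \<i>) / Im z" "1 \<le> cmod (z + \<i>)" "1 + \<bar>Re z\<bar> \<le> 2 * cmod (z + \<i>)"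
    if z: "0 < Im z" for z
  proof -
    have sq: "(cmod (z + \<i>))\<^sup>2 = (Re z)\<^sup>2 + (Im z + 1)\<^sup>2" "(cmod (z - \<i>))\<^sup>2 = (Re z)\<^sup>2 + (Im z - 1)\<^sup>2"
      by (simp_all add: cmod_power2)
    have "cmod (z - \<i>) \<le> cmod (z + \<i>)"
      by (rule power2_le_imp_le) (unfold sq, use z in \<open>auto simp: power2_eq_square algebra_simps\<close>)
    moreover have im: "1 + Im z \<le> cmod (z + \<i>)" using abs_Im_le_cmod[of "z + \<i>"] z by simp
    moreover have "kernel_bound z = (Im z + cmod (z - \<i>)) / Im z" using z by (simp add: kernel_bound_def add_divide_distrib)
    ultimately show "kernel_bound z \<le> 2 * cmod (z + \<i>) / Im z" using z by (auto intro!: divide_right_mono)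
    show "1 \<le> cmod (z + \<i>)" using im z by linarith
    then show "1 + \<bar>Re z\<bar> \<le> 2 * cmod (z + \<i>)" using abs_Re_le_cmod[of "z + \<i>"] by simp
  qed
  \<comment> \<open>Exactly the constant that turns the lower bound for the translates into \<open>Im z \<le> \<bar>\<Phi> z\<bar>\<close>.\<close>
  define Q where "Q = 2 * C * D * 2 ^ N / c"
  have Q: "Q > 0" using k(2) D(1) F1(2) by (simp add: Q_def)
  define \<Phi> where "\<Phi> z = of_real Q * k z * (z + \<i>) ^ (N + 2)" for z
  have cQ: "c * Q = 2 * C * D * 2 ^ N" using F1(2) by (simp add: Q_def)
  have norm_\<Phi>: "cmod (\<Phi> z) = Q * (cmod (k z) * cmod (z + \<i>) ^ (N + 2))" for z
    unfolding \<Phi>_def norm_mult norm_power norm_of_real using Q by (simp only: abs_of_pos mult.assoc)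
  have bound: "cmod (F z) \<le> 2 * C * (cmod (k z) * cmod (z + \<i>) ^ 2) / Im z * norm_E F"
    if F: "F \<in> entire_space a" and z: "0 < Im z" for F z
  proof -
    have "cmod (F z) \<le> (C * cmod (z + \<i>) * cmod (k z) * norm_E F) * kernel_bound z"
      using k(3)[OF F z] by (simp add: mult_ac)
    also have "\<dots> \<le> (C * cmod (z + \<i>) * cmod (k z) * norm_E F) * (2 * cmod (z + \<i>) / Im z)"
      using k(2) by (intro mult_left_mono geo(1)[OF z]) auto
    finally show ?thesis by (simp add: power2_eq_square mult_ac)
  qed
  have lower: "Im z \<le> cmod (\<Phi> z)" if z: "0 < Im z" for z
  proof -
    have E: "(\<lambda>w. F1 (w - of_real (Re z))) \<in> entire_space a" by (rule entire_space_shift[OF a F1(1)])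
    have "z - of_real (Re z) = \<i> * of_real (Im z)" by (simp add: complex_eq_iff)
    then have "c \<le> cmod (F1 (z - of_real (Re z)))" using F1(3) z by simp
    also have "\<dots> \<le> 2 * C * (cmod (k z) * cmod (z + \<i>) ^ 2) / Im z * L2_norm M (\<lambda>x. F1 (of_real x - of_real (Re z)))"
      using bound[OF E z] by simp
    also have "\<dots> \<le> 2 * C * (cmod (k z) * cmod (z + \<i>) ^ 2) / Im z * (D * (2 * cmod (z + \<i>)) ^ N)"
    proof (rule mult_left_mono)
      have "(1 + \<bar>Re z\<bar>) ^ N \<le> (2 * cmod (z + \<i>)) ^ N" using geo(3)[OF z] by (intro power_mono) auto
      then have "D * (1 + \<bar>Re z\<bar>) ^ N \<le> D * (2 * cmod (z + \<i>)) ^ N" using D(1) by (intro mult_left_mono) auto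
      with D(2)[of "Re z"] show "L2_norm M (\<lambda>x. F1 (of_real x - of_real (Re z))) \<le> D * (2 * cmod (z + \<i>)) ^ N" by linarith
    qed (use k(2) z in auto)
    also have "\<dots> = (c * Q) * (cmod (k z) * cmod (z + \<i>) ^ (N + 2)) / Im z"
      unfolding cQ by (simp add: power_mult_distrib power_add power2_eq_square mult_ac)
    also have "\<dots> = c * cmod (\<Phi> z) / Im z" by (simp only: norm_\<Phi> mult.assoc)
    finally have "c * Im z \<le> c * cmod (\<Phi> z)" using z by (simp add: field_simps)
    then show ?thesis using F1(2) by simp
  qed
  have "cmod (F z) \<le> (2 * C / Q) * cmod (\<Phi> z) / Im z * norm_E F" if F: "F \<in> entire_space a" and z: "0 < Im z" for F z
  proof -
    have "cmod (k z) * cmod (z + \<i>) ^ 2 \<le> cmod (k z) * cmod (z + \<i>) ^ (N + 2)"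
      using geo(2)[OF z] by (intro mult_left_mono power_increasing) auto
    also have "\<dots> = cmod (\<Phi> z) / Q" using Q by (simp add: norm_\<Phi>)
    finally have "2 * C * (cmod (k z) * cmod (z + \<i>) ^ 2) / Im z * norm_E F \<le> 2 * C * (cmod (\<Phi> z) / Q) / Im z * norm_E F"
      using k(2) z by (intro mult_right_mono divide_right_mono mult_left_mono) auto
    then show ?thesis using bound[OF F z] by simp
  qed
  moreover have "\<Phi> holomorphic_on {z. 0 < Im z}" unfolding \<Phi>_def by (intro holomorphic_intros k(1))
  moreover have "2 * C / Q > 0" using k(2) Q by simp
  ultimately show ?thesis using lower by blast
qed

text \<open>
  Harnack's inequality turns the majorant \<open>\<Phi>\<close> into explicit bounds off the real axis. These hold also in
  the lower half-plane, by reflection, and are precisely the hypotheses of the estimate in the right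
  half-strip; the left half-strip is treated through \<open>F (- z)\<close>.
\<close>

lemma subexponential_bound:
  assumes a: "a > 0" and sets_M: "sets M = sets borel"
    and growth: "(\<integral>\<^sup>+y. ennreal ((1 + \<bar>y\<bar>) powr (- s)) \<partial>M) < \<infinity>"
    and ev: "\<And>F. F \<in> entire_space a \<Longrightarrow> cmod (F \<i>) \<le> B * L2_norm M (\<lambda>x. F (of_real x))"
    and \<epsilon>: "\<epsilon> > 0" and L: "L \<ge> 0"
  shows "\<exists>A>0. \<forall>F\<in>entire_space a. \<forall>z. \<bar>Im z\<bar> \<le> L \<longrightarrow>
    cmod (F z) \<le> A * exp (\<epsilon> * \<bar>Re z\<bar>) * L2_norm M (\<lambda>x. F (of_real x))"
proof -
  interpret division_space "entire_space a" M by (rule entire_space_division_space[OF a sets_M entire_space_square_integrable[OF a sets_M growth]])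
  obtain \<Phi> C where \<Phi>: "\<Phi> holomorphic_on {z. 0 < Im z}" "\<And>z. 0 < Im z \<Longrightarrow> Im z \<le> cmod (\<Phi> z)" "C > 0"
    "\<And>F z. F \<in> entire_space a \<Longrightarrow> 0 < Im z \<Longrightarrow> cmod (F z) \<le> C * cmod (\<Phi> z) / Im z * norm_E F"
    using lower_bounded_majorant[OF a sets_M growth ev] by blast
  obtain c where c: "c \<ge> 0"
    "\<And>\<eta>. \<eta> > 0 \<Longrightarrow> \<exists>B\<ge>0. \<forall>z. 2 \<le> Im z \<longrightarrow> cmod (\<Phi> z) \<le> exp (c * Im z + (\<eta> * (cmod z)\<^sup>2 + B) / Im z)"
    using growth_away_from_real_axis[OF \<Phi>(1,2)] by blast
  have "\<forall>\<eta>. \<exists>b. \<eta> > 0 \<longrightarrow> b \<ge> 0 \<and> (\<forall>z. 2 \<le> Im z \<longrightarrow> cmod (\<Phi> z) \<le> exp (c * Im z + (\<eta> * (cmod z)\<^sup>2 + b) / Im z))"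
    using c(2) by blast
  then obtain B' where B': "\<forall>\<eta>. \<eta> > 0 \<longrightarrow> B' \<eta> \<ge> 0 \<and>
      (\<forall>z. 2 \<le> Im z \<longrightarrow> cmod (\<Phi> z) \<le> exp (c * Im z + (\<eta> * (cmod z)\<^sup>2 + B' \<eta>) / Im z))"
    by (rule choice[THEN exE])
  obtain C1 where C1: "C1 > 0"
    "\<And>z. 0 < Im z \<Longrightarrow> Im z \<le> 2 \<Longrightarrow> cmod (\<Phi> z) \<le> exp (C1 * (1 + (cmod z)\<^sup>2) / (Im z)\<^sup>2)"
    using growth_near_real_axis[OF \<Phi>(1,2)] by blast
  define c0 where "c0 = ln C"
  have c0: "exp c0 = C" using \<Phi>(3) by (simp add: c0_def)
  have B'0: "B' \<eta> \<ge> 0" if "\<eta> > 0" for \<eta> using B' that by blast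
  have C12: "C1 + 2 > 0" using C1(1) by simp
  obtain A where A: "\<forall>F K b. F holomorphic_on UNIV \<longrightarrow> b \<ge> 0 \<longrightarrow>
      (\<forall>z. cmod (F z) \<le> exp (K + b * \<bar>Im z\<bar>)) \<longrightarrow>
      (\<forall>\<eta>>0. \<forall>z. 2 \<le> \<bar>Im z\<bar> \<longrightarrow>
        cmod (F z) \<le> exp (c0 + c * \<bar>Im z\<bar> + (\<eta> * (cmod z)\<^sup>2 + B' \<eta>) / \<bar>Im z\<bar>)) \<longrightarrow>
      (\<forall>z. 0 < \<bar>Im z\<bar> \<longrightarrow> \<bar>Im z\<bar> \<le> 2 \<longrightarrow> cmod (F z) \<le> exp (c0 + (C1 + 2) * (1 + (cmod z)\<^sup>2) / (Im z)\<^sup>2)) \<longrightarrow>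
      (\<forall>z. 0 \<le> Re z \<longrightarrow> \<bar>Im z\<bar> \<le> L \<longrightarrow> cmod (F z) \<le> exp (A + \<epsilon> * Re z))"
    using subexponential_on_right_half_strip[where B = B' and ?c0.0 = c0, OF c(1) C12 B'0 \<epsilon> L] ..
  have normalized: "cmod (F z) \<le> exp (A + \<epsilon> * \<bar>Re z\<bar>)"
    if F: "F \<in> entire_space a" and n: "norm_E F \<le> 1" and z: "\<bar>Im z\<bar> \<le> L" for F z
  proof -
    have off: "cmod (F z) \<le> C / \<bar>Im z\<bar> * X" if z: "0 < \<bar>Im z\<bar>"
      and X: "\<And>w. 0 < Im w \<Longrightarrow> Im w = \<bar>Im z\<bar> \<Longrightarrow> cmod w = cmod z \<Longrightarrow> cmod (\<Phi> w) \<le> X" for z X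
    proof -
      have up: "cmod (G w) \<le> C / \<bar>Im z\<bar> * X"
        if G: "G \<in> entire_space a" "norm_E G \<le> 1" and w: "0 < Im w" "Im w = \<bar>Im z\<bar>" "cmod w = cmod z" for G w
      proof -
        have "cmod (G w) \<le> C * cmod (\<Phi> w) / Im w * norm_E G" by (rule \<Phi>(4)[OF G(1) w(1)])
        also have "\<dots> \<le> C * cmod (\<Phi> w) / Im w * 1"
          using \<Phi>(3) w(1) G(2) by (intro mult_left_mono) auto
        also have "\<dots> \<le> C * X / Im w"
          using \<Phi>(3) w(1) X[OF w] by (auto intro!: divide_right_mono mult_left_mono)
        finally show ?thesis using w(2) by simp
      qed
      show ?thesis
      proof (cases "0 < Im z")
        case True
        then show ?thesis by (intro up[OF F n]) auto
      next
        case False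
        have "cmod (cnj (F (cnj (cnj z)))) \<le> C / \<bar>Im z\<bar> * X"
        proof (rule up[of "\<lambda>z. cnj (F (cnj z))" "cnj z"])
          show "(\<lambda>z. cnj (F (cnj z))) \<in> entire_space a" by (rule cnj[OF F])
          show "norm_E (\<lambda>z. cnj (F (cnj z))) \<le> 1" using n norm_E_reflect[of F] by simp
        qed (use False z in auto)
        then show ?thesis by simp
      qed
    qed
    have far: "cmod (F z) \<le> exp (c0 + c * \<bar>Im z\<bar> + (\<eta> * (cmod z)\<^sup>2 + B' \<eta>) / \<bar>Im z\<bar>)"
      if \<eta>: "\<eta> > 0" and z: "2 \<le> \<bar>Im z\<bar>" for \<eta> z
    proof -
      have "cmod (F z) \<le> C / \<bar>Im z\<bar> * exp (c * \<bar>Im z\<bar> + (\<eta> * (cmod z)\<^sup>2 + B' \<eta>) / \<bar>Im z\<bar>)"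
      proof (rule off)
        fix w assume w: "0 < Im w" "Im w = \<bar>Im z\<bar>" "cmod w = cmod z"
        have "2 \<le> Im w" using w z by simp
        then have "cmod (\<Phi> w) \<le> exp (c * Im w + (\<eta> * (cmod w)\<^sup>2 + B' \<eta>) / Im w)" using B' \<eta> by blast
        then show "cmod (\<Phi> w) \<le> exp (c * \<bar>Im z\<bar> + (\<eta> * (cmod z)\<^sup>2 + B' \<eta>) / \<bar>Im z\<bar>)" using w by simp
      qed (use z in auto)
      also have "\<dots> \<le> C * exp (c * \<bar>Im z\<bar> + (\<eta> * (cmod z)\<^sup>2 + B' \<eta>) / \<bar>Im z\<bar>)"
        using z \<Phi>(3) by (intro mult_right_mono) (auto simp: field_simps)
      finally show ?thesis by (simp add: exp_add c0 mult.assoc)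
    qed
    have near: "cmod (F z) \<le> exp (c0 + (C1 + 2) * (1 + (cmod z)\<^sup>2) / (Im z)\<^sup>2)"
      if z: "0 < \<bar>Im z\<bar>" "\<bar>Im z\<bar> \<le> 2" for z
    proof -
      define X where "X = (1 + (cmod z)\<^sup>2) / (Im z)\<^sup>2"
      have "cmod (F z) \<le> C / \<bar>Im z\<bar> * exp (C1 * X)"
      proof (rule off[OF z(1)])
        fix w assume w: "0 < Im w" "Im w = \<bar>Im z\<bar>" "cmod w = cmod z"
        have "cmod (\<Phi> w) \<le> exp (C1 * (1 + (cmod w)\<^sup>2) / (Im w)\<^sup>2)" using w z by (intro C1(2)) auto
        then show "cmod (\<Phi> w) \<le> exp (C1 * X)" using w by (simp add: X_def)
      qed
      also have "\<dots> \<le> C * exp (2 * X) * exp (C1 * X)"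
      proof (rule mult_right_mono)
        have "1 / \<bar>Im z\<bar> \<le> 2 / (Im z)\<^sup>2"
        proof -
          have "(Im z)\<^sup>2 \<le> 2 * \<bar>Im z\<bar>" using mult_right_mono[OF z(2), of "\<bar>Im z\<bar>"] by (simp add: power2_eq_square)
          moreover have "0 < (Im z)\<^sup>2" using z by simp
          ultimately show ?thesis using z by (simp add: divide_simps mult.commute)
        qed
        also have "\<dots> \<le> 2 * X" unfolding X_def using z by (simp add: divide_right_mono)
        also have "\<dots> \<le> exp (2 * X)" using exp_ge_add_one_self[of "2 * X"] by linarith
        finally have "C * (1 / \<bar>Im z\<bar>) \<le> C * exp (2 * X)" using \<Phi>(3) by (intro mult_left_mono) auto
        then show "C / \<bar>Im z\<bar> \<le> C * exp (2 * X)" by simp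
      qed simp
      also have "\<dots> = exp (c0 + (C1 + 2) * X)" unfolding distrib_right exp_add c0 by (simp only: mult_ac)
      finally show ?thesis by (simp add: X_def)
    qed
    obtain K where K: "\<forall>z. cmod (F z) \<le> exp (K + a * \<bar>Im z\<bar>)"
      using entire_space_exponential_type[OF a F] ..
    show ?thesis
    proof (cases "0 \<le> Re z")
      case True
      have "cmod (F z) \<le> exp (A + \<epsilon> * Re z)"
        by (rule A[rule_format, OF entire[OF F], of a K]) (use a K far near True z in auto)
      then show ?thesis using True by simp
    next
      case False
      have "(F \<circ> uminus) holomorphic_on UNIV"
        by (rule holomorphic_on_compose_gen[OF _ entire[OF F]]) (auto intro!: holomorphic_intros)
      then have hol: "(\<lambda>z. F (- z)) holomorphic_on UNIV" by (simp add: o_def)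
      have "cmod (F (- (- z))) \<le> exp (A + \<epsilon> * Re (- z))"
      proof (rule A[rule_format, OF hol, of a K])
        show "cmod (F (- w)) \<le> exp (K + a * \<bar>Im w\<bar>)" for w using K[rule_format, of "- w"] by simp
        show "cmod (F (- w)) \<le> exp (c0 + c * \<bar>Im w\<bar> + (\<eta> * (cmod w)\<^sup>2 + B' \<eta>) / \<bar>Im w\<bar>)"
          if "\<eta> > 0" "2 \<le> \<bar>Im w\<bar>" for \<eta> w using far[of \<eta> "- w"] that by simp
        show "cmod (F (- w)) \<le> exp (c0 + (C1 + 2) * (1 + (cmod w)\<^sup>2) / (Im w)\<^sup>2)"
          if "0 < \<bar>Im w\<bar>" "\<bar>Im w\<bar> \<le> 2" for w using near[of "- w"] that by simp
      qed (use a False z in auto)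
      then show ?thesis using False by simp
    qed
  qed
  \<comment> \<open>Scaling to norm at most \<open>1\<close> with \<open>norm_E F + e\<close> covers functions of norm \<open>0\<close> as well.\<close>
  have "cmod (F z) \<le> exp A * exp (\<epsilon> * \<bar>Re z\<bar>) * norm_E F"
    if F: "F \<in> entire_space a" and z: "\<bar>Im z\<bar> \<le> L" for F z
  proof -
    define X where "X = exp A * exp (\<epsilon> * \<bar>Re z\<bar>)"
    have X: "X > 0" by (simp add: X_def)
    have "cmod (F z) / X \<le> norm_E F"
    proof (rule field_le_epsilon)
      fix e :: real assume e: "e > 0"
      define h where "h = norm_E F + e"
      have h: "h > 0" using e by (simp add: h_def add_nonneg_pos)
      have "(\<lambda>z. of_real (1 / h) * F z) \<in> entire_space a" by (rule cmult[OF F])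
      moreover have "norm_E (\<lambda>z. of_real (1 / h) * F z) \<le> 1"
        unfolding L2_norm_cmult norm_of_real using h e by (simp add: h_def field_simps)
      ultimately have "cmod (of_real (1 / h) * F z) \<le> exp (A + \<epsilon> * \<bar>Re z\<bar>)" using z by (intro normalized)
      then have "1 / h * cmod (F z) \<le> X" unfolding norm_mult norm_of_real X_def exp_add using h by simp
      then show "cmod (F z) / X \<le> norm_E F + e" unfolding h_def[symmetric] using h X by (simp add: field_simps)
    qed
    then show ?thesis using X by (simp add: X_def[symmetric] pos_divide_le_eq mult.commute)
  qed
  then show ?thesis by (intro exI[of _ "exp A"]) auto
qed

section \<open>Passing from one measure to the other\<close>

lemma nn_integral_weighted:
  assumes sets_N: "sets N = sets borel" and g: "g \<in> L2_functions (weighted_measure N t)"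
  shows "(\<integral>\<^sup>+y. ennreal ((cmod (g y))\<^sup>2 * (1 + \<bar>y\<bar>) powr t) \<partial>N) = ennreal ((L2_norm (weighted_measure N t) g)\<^sup>2)"
proof -
  have [measurable_cong]: "sets N = sets borel" by (rule sets_N)
  have gm [measurable]: "g \<in> borel_measurable borel"
    using L2_functionsD(1)[OF g] by (simp add: weighted_measure_def measurable_cong_sets[OF sets_N refl] cong: measurable_cong_sets)
  have "ennreal ((L2_norm (weighted_measure N t) g)\<^sup>2) = (\<integral>\<^sup>+y. ennreal ((cmod (g y))\<^sup>2) \<partial>weighted_measure N t)"
    unfolding L2_norm_power2 using L2_functionsD(2)[OF g] by (intro nn_integral_eq_integral[symmetric]) auto
  also have "\<dots> = (\<integral>\<^sup>+y. ennreal ((1 + \<bar>y\<bar>) powr t) * ennreal ((cmod (g y))\<^sup>2) \<partial>N)"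
    unfolding weighted_measure_def by (rule nn_integral_density) measurable
  also have "\<dots> = (\<integral>\<^sup>+y. ennreal ((cmod (g y))\<^sup>2 * (1 + \<bar>y\<bar>) powr t) \<partial>N)"
    by (simp add: ennreal_mult mult.commute)
  finally show ?thesis ..
qed

lemma sets_weighted: "sets N = sets borel \<Longrightarrow> sets (weighted_measure N t) = sets borel"
  by (simp add: weighted_measure_def)

text \<open>
  Take \<open>H\<close> in the space with \<open>H \<i> \<noteq> 0\<close>. The function \<open>H / (x - \<i>)\<close> is approximated by some \<open>G\<close>; multiplication
  by \<open>x - \<i>\<close> costs two powers of the weight, and gives \<open>H - (z - \<i>) * G\<close> of small norm. Its value at \<open>\<i>\<close> is
  \<open>H \<i>\<close>, independently of \<open>G\<close>.
\<close>

lemma dense_imp_evaluation_unbounded: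
  assumes a: "a > 0" and sets_N: "sets N = sets borel"
    and dense: "dense_in_L2 (entire_space a) (weighted_measure N (t + 2))"
    and L2t: "\<And>F. F \<in> entire_space a \<Longrightarrow> (\<lambda>x. F (of_real x)) \<in> L2_functions (weighted_measure N t)"
    and bounded: "\<And>F. F \<in> entire_space a \<Longrightarrow> cmod (F \<i>) \<le> B * L2_norm (weighted_measure N t) (\<lambda>x. F (of_real x))"
  shows False
proof -
  obtain H c where H: "H \<in> entire_space a" "c > 0" "\<forall>y\<ge>0. c \<le> cmod (H (\<i> * of_real y))"
    using entire_space_bounded_below_on_imaginary_axis[OF a] by blast
  have Hi: "c \<le> cmod (H \<i>)" using H(3)[rule_format, of 1] by simp
  have B: "B > 0"
  proof (rule ccontr)
    assume "\<not> B > 0"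
    then have "B * L2_norm (weighted_measure N t) (\<lambda>x. H (of_real x)) \<le> 0" by (intro mult_nonpos_nonneg) auto
    then show False using bounded[OF H(1)] Hi H(2) by linarith
  qed
  let ?M = "weighted_measure N (t + 2)"
  have HL: "(\<lambda>x. H (of_real x)) \<in> L2_functions ?M"
    using dense H(1) unfolding dense_in_L2_def by blast
  define g where "g x = H (of_real x) / (of_real x - \<i>)" for x :: real
  have ne: "complex_of_real x - \<i> \<noteq> 0" for x by (auto simp: complex_eq_iff)
  have ge: "1 \<le> cmod (complex_of_real x - \<i>)" for x using abs_Im_le_cmod[of "complex_of_real x - \<i>"] by simp
  have gL: "g \<in> L2_functions ?M"
  proof (rule L2_functions_dominated[OF HL, of _ 1])
    have "continuous_on UNIV (\<lambda>x. complex_of_real x - \<i>)" by (intro continuous_intros)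
    then have "(\<lambda>x. complex_of_real x - \<i>) \<in> borel_measurable borel" by (rule borel_measurable_continuous_onI)
    moreover have "(\<lambda>x. H (complex_of_real x)) \<in> borel_measurable borel"
      using L2_functionsD(1)[OF HL] by (simp add: measurable_cong_sets[OF sets_weighted[OF sets_N] refl])
    ultimately have "g \<in> borel_measurable borel" unfolding g_def by (intro borel_measurable_divide)
    then show "g \<in> borel_measurable ?M" by (simp add: measurable_cong_sets[OF sets_weighted[OF sets_N] refl])
    show "cmod (g x) \<le> 1 * cmod (H (of_real x))" for x
    proof -
      have "cmod (H (of_real x)) / cmod (of_real x - \<i>) \<le> cmod (H (of_real x)) / 1"
        by (rule divide_left_mono[OF ge]) (use ne[of x] in auto)
      then show ?thesis by (simp add: g_def norm_divide)
    qed
  qed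
  have eps: "c / (2 * B) > 0" using H(2) B by simp
  obtain G where G: "G \<in> entire_space a" "L2_norm ?M (\<lambda>x. g x - G (of_real x)) < c / (2 * B)"
    using dense gL eps unfolding dense_in_L2_def by blast
  define U where "U z = H z + (- 1) * (z * G z + (- \<i>) * G z)" for z
  have U: "U \<in> entire_space a" unfolding U_def
    by (intro entire_space_add[OF a] entire_space_cmult[OF a] entire_space_mult_ident[OF a] H(1) G(1))
  have GL: "(\<lambda>x. G (of_real x)) \<in> L2_functions ?M"
    using dense G(1) unfolding dense_in_L2_def by blast
  have dL: "(\<lambda>x. g x - G (of_real x)) \<in> L2_functions ?M" by (rule L2_functions_diff[OF gL GL])
  have pt: "(cmod (U (of_real x)))\<^sup>2 * (1 + \<bar>x\<bar>) powr t \<le> (cmod (g x - G (of_real x)))\<^sup>2 * (1 + \<bar>x\<bar>) powr (t + 2)" for x :: real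
  proof -
    have "U (of_real x) = (of_real x - \<i>) * (g x - G (of_real x))"
    proof -
      have gx: "(of_real x - \<i>) * g x = H (of_real x)" using ne[of x] by (simp add: g_def)
      have "U (of_real x) = H (of_real x) - (of_real x - \<i>) * G (of_real x)"
        by (simp add: U_def left_diff_distrib)
      then show ?thesis by (simp only: right_diff_distrib gx)
    qed
    moreover have "cmod (complex_of_real x - \<i>) \<le> 1 + \<bar>x\<bar>"
      using norm_triangle_ineq4[of "complex_of_real x" \<i>] by simp
    ultimately have "cmod (U (of_real x)) \<le> (1 + \<bar>x\<bar>) * cmod (g x - G (of_real x))"
      by (simp add: norm_mult mult_right_mono)
    then have "(cmod (U (of_real x)))\<^sup>2 \<le> ((1 + \<bar>x\<bar>) * cmod (g x - G (of_real x)))\<^sup>2" by (intro power_mono) auto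
    then have "(cmod (U (of_real x)))\<^sup>2 * (1 + \<bar>x\<bar>) powr t \<le> ((1 + \<bar>x\<bar>) * cmod (g x - G (of_real x)))\<^sup>2 * (1 + \<bar>x\<bar>) powr t"
      by (rule mult_right_mono) simp
    also have "\<dots> = (cmod (g x - G (of_real x)))\<^sup>2 * (1 + \<bar>x\<bar>) powr (t + 2)"
    proof -
      have "0 < 1 + \<bar>x\<bar>" by linarith
      then have "(1 + \<bar>x\<bar>) powr (t + 2) = (1 + \<bar>x\<bar>) powr t * (1 + \<bar>x\<bar>)\<^sup>2"
        by (simp add: powr_add powr_numeral)
      then show ?thesis by (simp add: power_mult_distrib)
    qed
    finally show ?thesis .
  qed
  have "ennreal ((L2_norm (weighted_measure N t) (\<lambda>x. U (of_real x)))\<^sup>2) \<le> ennreal ((L2_norm ?M (\<lambda>x. g x - G (of_real x)))\<^sup>2)"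
    unfolding nn_integral_weighted[OF sets_N L2t[OF U], symmetric] nn_integral_weighted[OF sets_N dL, symmetric]
    by (intro nn_integral_mono ennreal_leI pt)
  then have "(L2_norm (weighted_measure N t) (\<lambda>x. U (of_real x)))\<^sup>2 \<le> (L2_norm ?M (\<lambda>x. g x - G (of_real x)))\<^sup>2"
    by (subst (asm) ennreal_le_iff) auto
  then have "L2_norm (weighted_measure N t) (\<lambda>x. U (of_real x)) \<le> L2_norm ?M (\<lambda>x. g x - G (of_real x))"
    by (rule power2_le_imp_le) simp
  then have "L2_norm (weighted_measure N t) (\<lambda>x. U (of_real x)) \<le> c / (2 * B)" using G(2) by linarith
  then have "B * L2_norm (weighted_measure N t) (\<lambda>x. U (of_real x)) \<le> B * (c / (2 * B))" using B by (intro mult_left_mono) auto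
  also have "\<dots> = c / 2" using B by simp
  finally have "cmod (U \<i>) \<le> c / 2" using bounded[OF U] by linarith
  moreover have "U \<i> = H \<i>" by (simp add: U_def)
  ultimately show False using Hi H(2) by simp
qed

text \<open>
  Some \<open>F\<close> has no zeros on \<open>[-R, R]\<close> and is square-integrable. The growth condition by itself would not do:
  for negative \<open>s\<close> its integrand tends to \<open>0\<close> at the origin.
\<close>

lemma locally_finite_of_L2:
  assumes a: "a > 0" and sets_N: "sets N = sets borel"
    and L2: "\<And>F. F \<in> entire_space a \<Longrightarrow> (\<lambda>x. F (of_real x)) \<in> L2_functions (weighted_measure N 0)"
  shows "emeasure N {-R..R::real} < \<infinity>"
proof (cases "R \<ge> 0")
  case True
  have [measurable_cong]: "sets N = sets borel" by (rule sets_N)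
  obtain F where F: "F \<in> entire_space a" "\<forall>x::real. \<bar>x\<bar> \<le> R \<longrightarrow> F (of_real x) \<noteq> 0"
    using entire_space_nonvanishing[OF a] by blast
  have cont: "continuous_on {-R..R} (\<lambda>x. cmod (F (of_real x)))"
    by (intro continuous_intros continuous_on_compose2[OF holomorphic_on_imp_continuous_on[OF entire_space_holomorphic[OF a F(1)]]]) auto
  obtain x0 where x0: "x0 \<in> {-R..R}" "\<forall>x\<in>{-R..R}. cmod (F (of_real x0)) \<le> cmod (F (of_real x))"
    using continuous_attains_inf[OF _ _ cont] True by auto
  define m where "m = (cmod (F (of_real x0)))\<^sup>2"
  have "\<bar>x0\<bar> \<le> R" using x0(1) by auto
  then have m: "m > 0" using F(2) by (simp add: m_def)
  have one: "(1 + \<bar>x\<bar>) powr 0 = 1" for x :: real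
  proof -
    have "1 + \<bar>x\<bar> \<noteq> 0" using abs_ge_zero[of x] by linarith
    then show ?thesis by simp
  qed
  have "ennreal m * emeasure N {-R..R} = (\<integral>\<^sup>+x. ennreal m * indicator {-R..R} x \<partial>N)"
    by (rule nn_integral_cmult_indicator[symmetric]) measurable
  also have "\<dots> \<le> (\<integral>\<^sup>+x. ennreal ((cmod (F (of_real x)))\<^sup>2 * (1 + \<bar>x\<bar>) powr 0) \<partial>N)"
  proof (rule nn_integral_mono)
    fix x
    show "ennreal m * indicator {-R..R} x \<le> ennreal ((cmod (F (of_real x)))\<^sup>2 * (1 + \<bar>x\<bar>) powr 0)"
    proof (cases "x \<in> {-R..R}")
      case T: True
      then have "m \<le> (cmod (F (of_real x)))\<^sup>2" unfolding m_def using x0(2) by (intro power_mono) auto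
      then show ?thesis using T unfolding one by (simp add: ennreal_leI)
    qed simp
  qed
  also have "\<dots> < \<infinity>" unfolding nn_integral_weighted[OF sets_N L2[OF F(1)]] by simp
  finally show ?thesis using m by (auto simp: ennreal_mult_less_top)
qed simp

lemma polynomial_growth_powr:
  assumes sets_N: "sets N = sets borel" and growth: "at_most_polynomial_growth N"
    and locfin: "\<And>R::real. emeasure N {-R..R} < \<infinity>"
  obtains k where "k \<ge> 0" "(\<integral>\<^sup>+x. ennreal ((1 + \<bar>x\<bar>) powr (- k)) \<partial>N) < \<infinity>"
proof -
  have [measurable_cong]: "sets N = sets borel" by (rule sets_N)
  obtain s where s: "(\<integral>\<^sup>+x. ennreal (1 / (1 + \<bar>x\<bar> powr (2 * s))) \<partial>N) < \<infinity>"
    using growth unfolding at_most_polynomial_growth_def by blast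
  define k where "k = 2 * \<bar>s\<bar>"
  have k: "k \<ge> 0" "2 * s \<le> k" by (auto simp: k_def)
  have "(\<integral>\<^sup>+x. ennreal ((1 + \<bar>x\<bar>) powr (- k)) \<partial>N) \<le>
    (\<integral>\<^sup>+x. indicator {-1..1} x + 2 * ennreal (1 / (1 + \<bar>x\<bar> powr (2 * s))) \<partial>N)"
  proof (rule nn_integral_mono)
    fix x
    show "ennreal ((1 + \<bar>x\<bar>) powr (- k)) \<le> indicator {-1..1} x + 2 * ennreal (1 / (1 + \<bar>x\<bar> powr (2 * s)))"
    proof (cases "x \<in> {-1..1}")
      case True
      have "(1 + \<bar>x\<bar>) powr (- k) \<le> (1 + \<bar>x\<bar>) powr 0" using k by (intro powr_mono) auto
      then have "(1 + \<bar>x\<bar>) powr (- k) \<le> 1" by (simp split: if_splits)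
      then have "ennreal ((1 + \<bar>x\<bar>) powr (- k)) \<le> ennreal 1" by (rule ennreal_leI)
      also have "\<dots> \<le> indicator {-1..1} x + 2 * ennreal (1 / (1 + \<bar>x\<bar> powr (2 * s)))" using True by simp
      finally show ?thesis .
    next
      case False
      then have x: "1 < \<bar>x\<bar>" by auto
      have "1 + \<bar>x\<bar> powr (2 * s) \<le> 2 * \<bar>x\<bar> powr k"
      proof -
        have "\<bar>x\<bar> powr (2 * s) \<le> \<bar>x\<bar> powr k" using x k by (intro powr_mono) auto
        moreover have "1 \<le> \<bar>x\<bar> powr k" using x k by (intro ge_one_powr_ge_zero) auto
        ultimately show ?thesis by linarith
      qed
      also have "\<bar>x\<bar> powr k \<le> (1 + \<bar>x\<bar>) powr k" using k by (intro powr_mono2) auto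
      finally have "1 + \<bar>x\<bar> powr (2 * s) \<le> 2 * (1 + \<bar>x\<bar>) powr k" by simp
      moreover have "0 < 1 + \<bar>x\<bar> powr (2 * s)" by (simp add: add_pos_nonneg)
      moreover have "0 < (1 + \<bar>x\<bar>) powr k" using x by (simp add: powr_gt_zero)
      ultimately have "(1 + \<bar>x\<bar>) powr (- k) \<le> 2 * (1 / (1 + \<bar>x\<bar> powr (2 * s)))"
        by (simp add: powr_minus field_simps)
      then have "ennreal ((1 + \<bar>x\<bar>) powr (- k)) \<le> ennreal (2 * (1 / (1 + \<bar>x\<bar> powr (2 * s))))" by (rule ennreal_leI)
      also have "\<dots> = 2 * ennreal (1 / (1 + \<bar>x\<bar> powr (2 * s)))" by (subst ennreal_mult) auto
      finally show ?thesis using False by simp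
    qed
  qed
  also have "\<dots> = emeasure N {-1..1} + 2 * (\<integral>\<^sup>+x. ennreal (1 / (1 + \<bar>x\<bar> powr (2 * s))) \<partial>N)"
    by (subst nn_integral_add, measurable, subst nn_integral_cmult, measurable)
  also have "\<dots> < \<infinity>" using s locfin[of 1] by (simp add: ennreal_mult_less_top)
  finally show ?thesis using k by (intro that)
qed

lemma real_axis_derivative_bound:
  assumes hol: "F holomorphic_on UNIV" and m: "\<And>w. \<bar>Re w - x\<bar> \<le> r + 1 \<Longrightarrow> \<bar>Im w\<bar> \<le> 1 \<Longrightarrow> cmod (F w) \<le> m"
    and y: "\<bar>y - x\<bar> \<le> r" "\<bar>y' - x\<bar> \<le> r"
  shows "cmod (F (of_real y) - F (of_real y')) \<le> \<bar>y - y'\<bar> * m"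
proof -
  define S where "S = complex_of_real ` {x - r..x + r}"
  have conv: "convex S" unfolding S_def by (intro convex_linear_image convex_real_interval bounded_linear.linear[OF bounded_linear_of_real])
  have "cmod (F (of_real y) - F (of_real y')) \<le> m * cmod (of_real y - of_real y')"
  proof (rule field_differentiable_bound[OF conv, where f' = "deriv F"])
    fix \<xi> assume "\<xi> \<in> S"
    then obtain u where u: "\<xi> = of_real u" "\<bar>u - x\<bar> \<le> r" by (auto simp: S_def abs_le_iff)
    show "(F has_field_derivative deriv F \<xi>) (at \<xi> within S)"
      using hol by (meson DERIV_subset UNIV_I holomorphic_derivI open_UNIV subset_UNIV)
    have "norm ((deriv ^^ 1) F \<xi>) \<le> fact 1 * m / 1 ^ 1"
    proof (rule Cauchy_inequality)
      show "F holomorphic_on ball \<xi> 1" by (rule holomorphic_on_subset[OF hol]) simp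
      show "continuous_on (cball \<xi> 1) F"
        by (rule continuous_on_subset[OF holomorphic_on_imp_continuous_on[OF hol]]) simp
      fix w assume w: "cmod (\<xi> - w) = 1"
      show "cmod (F w) \<le> m"
      proof (rule m)
        have "\<bar>Re (\<xi> - w)\<bar> \<le> 1" "\<bar>Im (\<xi> - w)\<bar> \<le> 1" using abs_Re_le_cmod[of "\<xi> - w"] abs_Im_le_cmod[of "\<xi> - w"] w by auto
        then show "\<bar>Re w - x\<bar> \<le> r + 1" "\<bar>Im w\<bar> \<le> 1" using u by auto
      qed
    qed simp
    then show "cmod (deriv F \<xi>) \<le> m" by simp
  qed (use y in \<open>auto simp: S_def abs_le_iff\<close>)
  then show ?thesis by (simp add: mult.commute flip: of_real_diff)
qed

text \<open>
  The maximum principle for \<open>G\<close> on the disc of radius \<open>2 * R\<close>: the factor \<open>z ^ m\<close> loses \<open>2 ^ m\<close> between the two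
  circles.
\<close>

lemma high_order_zero_bound:
  assumes hol: "G holomorphic_on UNIV" and R: "R > 0" and bd: "\<And>w. cmod w = 2 * R \<Longrightarrow> cmod (w ^ m * G w) \<le> A"
    and z: "cmod z \<le> R"
  shows "cmod (z ^ m * G z) \<le> A / 2 ^ m"
proof -
  have "cmod (G z) \<le> A / (2 * R) ^ m"
  proof (rule maximum_modulus_frontier[of G "ball 0 (2 * R)"])
    show "G holomorphic_on interior (ball 0 (2 * R))" by (rule holomorphic_on_subset[OF hol]) simp
    show "continuous_on (closure (ball 0 (2 * R))) G"
      by (rule continuous_on_subset[OF holomorphic_on_imp_continuous_on[OF hol]]) simp
    show "z \<in> ball 0 (2 * R)" using z R by simp
    show "cmod (G w) \<le> A / (2 * R) ^ m" if "w \<in> frontier (ball 0 (2 * R))" for w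
    proof -
      have w: "cmod w = 2 * R" using that R by simp
      show ?thesis using bd[OF w] R w by (simp add: norm_mult norm_power pos_le_divide_eq mult.commute)
    qed
  qed simp
  moreover have "cmod z ^ m \<le> R ^ m" using z by (intro power_mono) auto
  ultimately have "cmod z ^ m * cmod (G z) \<le> R ^ m * (A / (2 * R) ^ m)"
    using R by (intro mult_mono) auto
  also have "\<dots> = A / 2 ^ m" using R by (simp add: power_mult_distrib)
  finally show ?thesis by (simp add: norm_mult norm_power)
qed

text \<open>
  Let \<open>h\<close> be the norm of \<open>F = z ^ m * G\<close> in \<open>L\<^sup>2(M)\<close>. By the subexponential bound, \<open>F\<close> is controlled by \<open>h\<close> on strips.
  So, with \<open>R\<close> large, the part of \<open>h\<^sup>2\<close> outside \<open>[-R, R]\<close> is at most a multiple of a weighted integral for \<open>N\<close> plus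
  \<open>h\<^sup>2 / 4\<close>; and with \<open>m\<close> large, the part inside is at most \<open>h\<^sup>2 / 4\<close>, because \<open>F\<close> has a zero of high order at
  the origin. Absorbing \<open>h\<^sup>2 / 2\<close> bounds \<open>h\<close> by a weighted norm of \<open>G\<close> for \<open>N\<close>. Moreover \<open>F\<close> and \<open>G\<close> have the same modulus
  at \<open>\<i>\<close>.
\<close>

lemma bounded_evaluation_transfers:
  assumes a: "a > 0" and sets_M: "sets M = sets borel" and sets_N: "sets N = sets borel"
    and \<delta>: "\<delta> > 0" and C: "C > 0" and n: "n \<ge> 0"
    and locfin: "\<And>R::real. emeasure N {-R..R} < \<infinity>"
    and dom: "\<And>x. emeasure M (exp_interval 1 x \<delta>)
          \<le> ennreal (C * (1 + \<bar>x\<bar>) powr n) * (emeasure N (exp_interval 2 x \<delta>) + ennreal (exp (- 2 * \<delta> * \<bar>x\<bar>)))"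
    and k: "k \<ge> 0" and growth: "(\<integral>\<^sup>+x. ennreal ((1 + \<bar>x\<bar>) powr (- k)) \<partial>N) < \<infinity>"
    and L2N: "\<And>F t. F \<in> entire_space a \<Longrightarrow> t \<ge> 0 \<Longrightarrow> (\<lambda>x. F (of_real x)) \<in> L2_functions (weighted_measure N t)"
    and ev: "\<And>F. F \<in> entire_space a \<Longrightarrow> cmod (F \<i>) \<le> B * L2_norm M (\<lambda>x. F (of_real x))"
  shows "\<exists>t\<ge>0. \<exists>K. \<forall>G\<in>entire_space a. cmod (G \<i>) \<le> K * L2_norm (weighted_measure N t) (\<lambda>x. G (of_real x))"
proof -
  have [measurable_cong]: "sets M = sets borel" "sets N = sets borel" by (rule sets_M, rule sets_N)
  define s where "s = k + n"
  have growthM: "(\<integral>\<^sup>+y. ennreal ((1 + \<bar>y\<bar>) powr (- s)) \<partial>M) < \<infinity>"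
    unfolding s_def by (rule dominated_polynomial_growth[OF sets_M sets_N \<delta> C n locfin dom k growth])
  have s: "s \<ge> 0" using k n by (simp add: s_def)
  note L2M = entire_space_square_integrable[OF a sets_M growthM]
  obtain V where V: "V \<ge> 0" "(\<integral>\<^sup>+y. ennreal ((1 + \<bar>y\<bar>) powr (- s)) \<partial>M) = ennreal V"
    using growthM by (cases "\<integral>\<^sup>+y. ennreal ((1 + \<bar>y\<bar>) powr (- s)) \<partial>M") auto
  let ?n = "\<lambda>F. L2_norm M (\<lambda>x. F (complex_of_real x))"
  have \<delta>4: "\<delta> / 4 > 0" using \<delta> by simp
  note sub = subexponential_bound[OF a sets_M growthM ev \<delta>4]
  obtain A1 where A1: "A1 > 0" "\<forall>F\<in>entire_space a. \<forall>z. \<bar>Im z\<bar> \<le> 1 \<longrightarrow> cmod (F z) \<le> A1 * exp (\<delta> / 4 * \<bar>Re z\<bar>) * ?n F"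
    using sub[of 1] by auto
  define A2 where "A2 = A1 * exp (3 * \<delta> / 4)"
  have A2: "A2 > 0" using A1(1) by (simp add: A2_def)
  obtain K where K: "K \<ge> 0"
    "\<And>\<theta>. \<theta> > 0 \<Longrightarrow> \<exists>R\<ge>0. \<forall>F m. controlled_growth (\<delta> / 4) m F \<longrightarrow>
       (\<integral>\<^sup>+y. ennreal ((cmod (F y))\<^sup>2) * indicator {y. R < \<bar>y\<bar>} y \<partial>M) \<le>
         ennreal K * (\<integral>\<^sup>+y. ennreal ((cmod (F y))\<^sup>2 * (1 + \<bar>y\<bar>) powr n) \<partial>N) + ennreal (\<theta> * m\<^sup>2)"
    using tail_estimate[OF sets_M sets_N \<delta> C n locfin dom k growth] by blast
  \<comment> \<open>The error \<open>\<theta> * (A2 * h)\<^sup>2\<close> in the tail is then \<open>h\<^sup>2 / 4\<close>.\<close>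
  define \<theta> where "\<theta> = 1 / (4 * A2\<^sup>2)"
  have \<theta>: "\<theta> > 0" using A2 by (simp add: \<theta>_def)
  obtain R where R: "R \<ge> 0" "\<forall>F m. controlled_growth (\<delta> / 4) m F \<longrightarrow>
       (\<integral>\<^sup>+y. ennreal ((cmod (F y))\<^sup>2) * indicator {y. R < \<bar>y\<bar>} y \<partial>M) \<le>
         ennreal K * (\<integral>\<^sup>+y. ennreal ((cmod (F y))\<^sup>2 * (1 + \<bar>y\<bar>) powr n) \<partial>N) + ennreal (\<theta> * m\<^sup>2)"
    using K(2)[OF \<theta>] by blast
  \<comment> \<open>The next bound is needed on a circle, whose radius must not be \<open>0\<close>.\<close>
  define R1 where "R1 = R + 1"
  have R1: "R1 > 0" "R \<le> R1" using R(1) by (auto simp: R1_def)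
  obtain A3 where A3: "A3 > 0" "\<forall>F\<in>entire_space a. \<forall>z. \<bar>Im z\<bar> \<le> 2 * R1 \<longrightarrow> cmod (F z) \<le> A3 * exp (\<delta> / 4 * \<bar>Re z\<bar>) * ?n F"
    using sub[of "2 * R1"] R1 by auto
  define A4 where "A4 = A3 * exp (\<delta> / 4 * (2 * R1))"
  have A4: "A4 > 0" using A3(1) by (simp add: A4_def)
  define Q where "Q = A4\<^sup>2 * ((1 + R1) powr s * V)"
  \<comment> \<open>The mass inside \<open>[-R, R]\<close> turns out to be at most \<open>h\<^sup>2 * (Q / 4 ^ m)\<close>.\<close>
  obtain m where m: "4 * Q < 4 ^ m" using real_arch_pow[of 4 "4 * Q"] by auto
  \<comment> \<open>The weight \<open>(1 + \<bar>y\<bar>) powr n\<close> on \<open>\<bar>y ^ m * G y\<bar>\<^sup>2\<close> is this weight on \<open>\<bar>G y\<bar>\<^sup>2\<close>.\<close>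
  define t where "t = n + 2 * real m"
  have t: "t \<ge> 0" using n by (simp add: t_def)
  have main: "(?n (\<lambda>z. z ^ m * G z))\<^sup>2 \<le> 2 * K * (L2_norm (weighted_measure N t) (\<lambda>x. G (of_real x)))\<^sup>2"
    if G: "G \<in> entire_space a" for G
  proof -
    define F where "F z = z ^ m * G z" for z
    have F: "F \<in> entire_space a" unfolding F_def by (rule entire_space_power[OF a G])
    have Fhol: "F holomorphic_on UNIV" by (rule entire_space_holomorphic[OF a F])
    have Fm [measurable]: "(\<lambda>x. F (complex_of_real x)) \<in> borel_measurable borel"
      using L2_functionsD(1)[OF L2M[OF F]] by (simp add: measurable_cong_sets[OF sets_M refl])
    define h where "h = ?n F"
    have h: "h \<ge> 0" by (simp add: h_def)
    have strip: "cmod (F w) \<le> A2 * h * exp (\<delta> / 4 * \<bar>x\<bar>)" if "\<bar>Re w - x\<bar> \<le> 3" "\<bar>Im w\<bar> \<le> 1" for w x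
    proof -
      have "\<bar>Re w\<bar> \<le> \<bar>x\<bar> + 3" using that(1) by linarith
      then have "\<delta> / 4 * \<bar>Re w\<bar> \<le> \<delta> / 4 * (\<bar>x\<bar> + 3)" using \<delta>4 by (intro mult_left_mono) auto
      then have "exp (\<delta> / 4 * \<bar>Re w\<bar>) \<le> exp (3 * \<delta> / 4 + \<delta> / 4 * \<bar>x\<bar>)"
        by (subst exp_le_cancel_iff) (simp add: algebra_simps)
      then have "A1 * exp (\<delta> / 4 * \<bar>Re w\<bar>) * h \<le> A1 * exp (3 * \<delta> / 4 + \<delta> / 4 * \<bar>x\<bar>) * h"
        using A1(1) h by (intro mult_right_mono mult_left_mono) auto
      then show ?thesis using A1(2) F that(2) unfolding A2_def h_def exp_add by (force simp: mult_ac)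
    qed
    have tail: "(\<integral>\<^sup>+y. ennreal ((cmod (F (of_real y)))\<^sup>2) * indicator {y. R < \<bar>y\<bar>} y \<partial>M) \<le>
         ennreal K * (\<integral>\<^sup>+y. ennreal ((cmod (F (of_real y)))\<^sup>2 * (1 + \<bar>y\<bar>) powr n) \<partial>N) + ennreal (\<theta> * (A2 * h)\<^sup>2)"
    proof (rule R(2)[rule_format], unfold controlled_growth_def, intro conjI allI impI Fm)
      show "0 \<le> A2 * h" using A2 h by simp
      show "cmod (F (of_real y)) \<le> A2 * h * exp (\<delta> / 4 * \<bar>x\<bar>)" if "\<bar>y - x\<bar> \<le> 2" for x y :: real
        by (rule strip) (use that in auto)
      show "cmod (F (of_real y) - F (of_real y')) \<le> \<bar>y - y'\<bar> * (A2 * h * exp (\<delta> / 4 * \<bar>x\<bar>))"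
        if "\<bar>y - x\<bar> \<le> 2" "\<bar>y' - x\<bar> \<le> 2" for x y y' :: real
        by (rule real_axis_derivative_bound[OF Fhol _ that]) (rule strip, auto)
    qed
    have near_pt: "cmod (F (of_real y)) \<le> A4 * h / 2 ^ m" if y: "\<bar>y\<bar> \<le> R" for y :: real
    proof -
      have "cmod ((of_real y) ^ m * G (of_real y)) \<le> A4 * h / 2 ^ m"
      proof (rule high_order_zero_bound[OF entire_space_holomorphic[OF a G] R1(1)])
        fix w :: complex assume w: "cmod w = 2 * R1"
        have "\<bar>Im w\<bar> \<le> 2 * R1" "\<bar>Re w\<bar> \<le> 2 * R1" using abs_Im_le_cmod[of w] abs_Re_le_cmod[of w] w by auto
        then have "cmod (F w) \<le> A3 * exp (\<delta> / 4 * \<bar>Re w\<bar>) * h" and le: "exp (\<delta> / 4 * \<bar>Re w\<bar>) \<le> exp (\<delta> / 4 * (2 * R1))"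
          using A3(2) F \<delta> unfolding h_def by auto
        moreover have "A3 * exp (\<delta> / 4 * \<bar>Re w\<bar>) * h \<le> A4 * h"
          unfolding A4_def using A3(1) h le by (intro mult_right_mono mult_left_mono) auto
        ultimately show "cmod (w ^ m * G w) \<le> A4 * h" unfolding F_def by linarith
      qed (use y R1 in auto)
      then show ?thesis by (simp add: F_def)
    qed
    have near: "(\<integral>\<^sup>+y. ennreal ((cmod (F (of_real y)))\<^sup>2) * indicator {y. \<bar>y\<bar> \<le> R} y \<partial>M) \<le> ennreal (h\<^sup>2 / 4)"
    proof -
      define c where "c = (A4 * h / 2 ^ m)\<^sup>2 * (1 + R1) powr s"
      have c: "c \<ge> 0" by (simp add: c_def)
      have "(\<integral>\<^sup>+y. ennreal ((cmod (F (of_real y)))\<^sup>2) * indicator {y. \<bar>y\<bar> \<le> R} y \<partial>M) \<le>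
          (\<integral>\<^sup>+y. ennreal c * ennreal ((1 + \<bar>y\<bar>) powr (- s)) \<partial>M)"
      proof (rule nn_integral_mono)
        fix y :: real
        show "ennreal ((cmod (F (of_real y)))\<^sup>2) * indicator {y. \<bar>y\<bar> \<le> R} y \<le> ennreal c * ennreal ((1 + \<bar>y\<bar>) powr (- s))"
        proof (cases "\<bar>y\<bar> \<le> R")
          case True
          have "(1 + \<bar>y\<bar>) powr s \<le> (1 + R1) powr s" using True R1 s by (intro powr_mono2) auto
          moreover have "0 < (1 + \<bar>y\<bar>) powr s" using abs_ge_zero[of y] by (simp add: powr_gt_zero)
          ultimately have one: "1 \<le> (1 + R1) powr s * (1 + \<bar>y\<bar>) powr (- s)"
            by (simp add: powr_minus divide_inverse[symmetric] le_divide_eq)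
          have "(cmod (F (of_real y)))\<^sup>2 \<le> (A4 * h / 2 ^ m)\<^sup>2" using near_pt[OF True] by (intro power_mono) auto
          also have "\<dots> \<le> (A4 * h / 2 ^ m)\<^sup>2 * ((1 + R1) powr s * (1 + \<bar>y\<bar>) powr (- s))"
            using mult_left_mono[OF one, of "(A4 * h / 2 ^ m)\<^sup>2"] by simp
          also have "\<dots> = c * (1 + \<bar>y\<bar>) powr (- s)" by (simp only: c_def mult.assoc)
          finally have "ennreal ((cmod (F (of_real y)))\<^sup>2) \<le> ennreal (c * (1 + \<bar>y\<bar>) powr (- s))" by (rule ennreal_leI)
          then show ?thesis using True c by (simp add: ennreal_mult)
        qed simp
      qed
      also have "\<dots> = ennreal c * ennreal V" unfolding V(2)[symmetric] by (intro nn_integral_cmult) measurable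
      also have "\<dots> = ennreal (c * V)" using c V(1) by (intro ennreal_mult[symmetric])
      also have "c * V \<le> h\<^sup>2 / 4"
      proof -
        have "c * V = h\<^sup>2 * (Q / 4 ^ m)"
          by (simp add: c_def Q_def power_mult_distrib power_divide power_mult[symmetric] mult.commute[of m] power_mult)
        also have "\<dots> \<le> h\<^sup>2 * (1 / 4)" using m by (intro mult_left_mono) (auto simp: field_simps)
        finally show ?thesis by simp
      qed
      then have "ennreal (c * V) \<le> ennreal (h\<^sup>2 / 4)" by (rule ennreal_leI)
      finally show ?thesis .
    qed
    define w where "w = (L2_norm (weighted_measure N n) (\<lambda>x. F (of_real x)))\<^sup>2"
    have w: "(\<integral>\<^sup>+y. ennreal ((cmod (F (of_real y)))\<^sup>2 * (1 + \<bar>y\<bar>) powr n) \<partial>N) = ennreal w" "w \<ge> 0"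
      unfolding w_def by (rule nn_integral_weighted[OF sets_N L2N[OF F n]]) simp
    have "ennreal (h\<^sup>2) = (\<integral>\<^sup>+y. ennreal ((cmod (F (of_real y)))\<^sup>2) \<partial>M)"
      unfolding h_def L2_norm_power2 using L2_functionsD(2)[OF L2M[OF F]] by (intro nn_integral_eq_integral[symmetric]) auto
    also have "\<dots> = (\<integral>\<^sup>+y. ennreal ((cmod (F (of_real y)))\<^sup>2) * indicator {y. R < \<bar>y\<bar>} y
        + ennreal ((cmod (F (of_real y)))\<^sup>2) * indicator {y. \<bar>y\<bar> \<le> R} y \<partial>M)"
      by (intro nn_integral_cong) (auto simp: indicator_def)
    also have "\<dots> = (\<integral>\<^sup>+y. ennreal ((cmod (F (of_real y)))\<^sup>2) * indicator {y. R < \<bar>y\<bar>} y \<partial>M)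
        + (\<integral>\<^sup>+y. ennreal ((cmod (F (of_real y)))\<^sup>2) * indicator {y. \<bar>y\<bar> \<le> R} y \<partial>M)"
      by (intro nn_integral_add) measurable
    also have "\<dots> \<le> (ennreal K * ennreal w + ennreal (\<theta> * (A2 * h)\<^sup>2)) + ennreal (h\<^sup>2 / 4)"
      by (rule add_mono[OF tail[unfolded w(1)] near])
    also have "\<dots> = ennreal (K * w + \<theta> * (A2 * h)\<^sup>2 + h\<^sup>2 / 4)"
      using K(1) w(2) \<theta> by (simp add: ennreal_mult ennreal_plus)
    finally have "h\<^sup>2 \<le> K * w + \<theta> * (A2 * h)\<^sup>2 + h\<^sup>2 / 4"
      using K(1) w(2) \<theta> by (subst (asm) ennreal_le_iff) auto
    moreover have "\<theta> * (A2 * h)\<^sup>2 = h\<^sup>2 / 4" using A2 by (simp add: \<theta>_def power_mult_distrib)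
    ultimately have hw: "h\<^sup>2 \<le> 2 * (K * w)" by linarith
    have "w \<le> (L2_norm (weighted_measure N t) (\<lambda>x. G (of_real x)))\<^sup>2"
    proof -
      have pt: "(cmod (F (of_real y)))\<^sup>2 * (1 + \<bar>y\<bar>) powr n \<le> (cmod (G (of_real y)))\<^sup>2 * (1 + \<bar>y\<bar>) powr t" for y :: real
      proof -
        have pos: "0 < 1 + \<bar>y\<bar>" by linarith
        have "(cmod (F (of_real y)))\<^sup>2 = (\<bar>y\<bar> ^ m)\<^sup>2 * (cmod (G (of_real y)))\<^sup>2"
          by (simp add: F_def norm_mult norm_power power_mult_distrib)
        also have "\<dots> \<le> ((1 + \<bar>y\<bar>) ^ m)\<^sup>2 * (cmod (G (of_real y)))\<^sup>2"
          by (intro mult_right_mono power_mono) auto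
        also have "((1 + \<bar>y\<bar>) ^ m)\<^sup>2 = (1 + \<bar>y\<bar>) powr (2 * real m)"
        proof -
          have "((1 + \<bar>y\<bar>) ^ m)\<^sup>2 = (1 + \<bar>y\<bar>) ^ (2 * m)" by (simp add: mult.commute flip: power_mult)
          also have "\<dots> = (1 + \<bar>y\<bar>) powr (real (2 * m))" by (rule powr_realpow[OF pos, symmetric])
          finally show ?thesis by simp
        qed
        finally have "(cmod (F (of_real y)))\<^sup>2 * (1 + \<bar>y\<bar>) powr n \<le> (1 + \<bar>y\<bar>) powr (2 * real m) * (cmod (G (of_real y)))\<^sup>2 * (1 + \<bar>y\<bar>) powr n"
          by (rule mult_right_mono) simp
        then show ?thesis by (simp add: t_def powr_add mult_ac)
      qed
      have "ennreal w \<le> ennreal ((L2_norm (weighted_measure N t) (\<lambda>x. G (of_real x)))\<^sup>2)"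
        unfolding w(1)[symmetric] nn_integral_weighted[OF sets_N L2N[OF G t], symmetric]
        by (intro nn_integral_mono ennreal_leI pt)
      then show ?thesis by (subst (asm) ennreal_le_iff) auto
    qed
    then have "K * w \<le> K * (L2_norm (weighted_measure N t) (\<lambda>x. G (of_real x)))\<^sup>2" using K(1) by (rule mult_left_mono)
    then show ?thesis using hw by (simp add: h_def F_def)
  qed
  have "cmod (G \<i>) \<le> (\<bar>B\<bar> * sqrt (2 * K)) * L2_norm (weighted_measure N t) (\<lambda>x. G (of_real x))" if G: "G \<in> entire_space a" for G
  proof -
    let ?g = "L2_norm (weighted_measure N t) (\<lambda>x. G (of_real x))"
    have "?n (\<lambda>z. z ^ m * G z) \<le> sqrt (2 * K) * ?g"
      using main[OF G] K(1) by (intro power2_le_imp_le[of "?n (\<lambda>z. z ^ m * G z)"]) (simp_all add: power_mult_distrib)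
    have "cmod (G \<i>) = cmod (\<i> ^ m * G \<i>)" by (simp add: norm_mult norm_power)
    also have "\<dots> \<le> B * ?n (\<lambda>z. z ^ m * G z)" using ev[OF entire_space_power[OF a G, of m]] .
    also have "\<dots> \<le> \<bar>B\<bar> * ?n (\<lambda>z. z ^ m * G z)" by (intro mult_right_mono) auto
    also have "\<dots> \<le> \<bar>B\<bar> * (sqrt (2 * K) * ?g)" by (intro mult_left_mono) (fact, simp)
    finally show ?thesis by (simp only: mult.assoc)
  qed
  with t show ?thesis by blast
qed

theorem theorem1p3:
  fixes a :: real and \<mu> \<mu>' :: "real measure"
  assumes "a > 0"
    and "sets \<mu>' = sets borel" and "at_most_polynomial_growth \<mu>'"
    and "sets \<mu> = sets borel"
    and "\<mu> \<preceq>\<^sub>e \<mu>'"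
    and "stably_dense_in_L2 (entire_space a) \<mu>'"
  shows "dense_in_L2 (entire_space a) \<mu>"
proof (rule ccontr)
  assume not_dense: "\<not> dense_in_L2 (entire_space a) \<mu>"
  note a = assms(1) and sets_N = assms(2) and sets_M = assms(4)
  have dense: "dense_in_L2 (entire_space a) (weighted_measure \<mu>' t)" if "t \<ge> 0" for t
    using assms(6) that unfolding stably_dense_in_L2_def by blast
  have L2N: "(\<lambda>x. F (of_real x)) \<in> L2_functions (weighted_measure \<mu>' t)" if "F \<in> entire_space a" "t \<ge> 0" for F t
    using dense[OF that(2)] that(1) unfolding dense_in_L2_def by blast
  have locfin: "emeasure \<mu>' {-R..R} < \<infinity>" for R :: real
    by (rule locally_finite_of_L2[OF a sets_N L2N]) auto
  obtain k where k: "k \<ge> 0" "(\<integral>\<^sup>+x. ennreal ((1 + \<bar>x\<bar>) powr (- k)) \<partial>\<mu>') < \<infinity>"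
    by (rule polynomial_growth_powr[OF sets_N assms(3) locfin])
  obtain \<delta> C n where \<delta>: "\<delta> > 0" and C: "C > 0" and n: "n \<ge> 0"
    and dom: "\<forall>x. emeasure \<mu> (exp_interval 1 x \<delta>)
          \<le> ennreal (C * (1 + \<bar>x\<bar>) powr n) * (emeasure \<mu>' (exp_interval 2 x \<delta>) + ennreal (exp (- 2 * \<delta> * \<bar>x\<bar>)))"
    using assms(5) unfolding dominated_def by blast
  note dom = dom[rule_format]
  have growthM: "(\<integral>\<^sup>+y. ennreal ((1 + \<bar>y\<bar>) powr (- (k + n))) \<partial>\<mu>) < \<infinity>"
    by (rule dominated_polynomial_growth[OF sets_M sets_N \<delta> C n locfin dom k])
  interpret division_space "entire_space a" \<mu>
    by (rule entire_space_division_space[OF a sets_M entire_space_square_integrable[OF a sets_M growthM]])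
  obtain \<epsilon> where \<epsilon>: "\<epsilon> > 0" "\<And>G. G \<in> entire_space a \<Longrightarrow> G \<i> = 1 \<Longrightarrow> \<epsilon> \<le> norm_E G"
    using dense_if_evaluation_unbounded[OF _ entire_space_nonvanishing[OF a]] not_dense by (meson not_le)
  have ev: "cmod (F \<i>) \<le> (1 / \<epsilon>) * norm_E F" if F: "F \<in> entire_space a" for F
  proof (cases "F \<i> = 0")
    case True
    then show ?thesis using \<epsilon>(1) by simp
  next
    case False
    have "\<epsilon> \<le> norm_E (\<lambda>z. (1 / F \<i>) * F z)" by (rule \<epsilon>(2)[OF cmult[OF F]]) (use False in simp)
    then have "\<epsilon> \<le> norm_E F / cmod (F \<i>)" unfolding L2_norm_cmult by (simp add: norm_divide)
    then show ?thesis using \<epsilon>(1) False by (simp add: field_simps)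
  qed
  obtain t K where t: "t \<ge> 0"
    and K: "\<forall>G\<in>entire_space a. cmod (G \<i>) \<le> K * L2_norm (weighted_measure \<mu>' t) (\<lambda>x. G (of_real x))"
    using bounded_evaluation_transfers[OF a sets_M sets_N \<delta> C n locfin dom k L2N ev] by blast
  have "t + 2 \<ge> 0" using t by simp
  then show False
    using dense_imp_evaluation_unbounded[OF a sets_N dense L2N[OF _ t], of K] K by blast
qed

end
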